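(* Let $G$ be a compact Abelian topological group such that $w(G)\geq \mathrm{non}(\mathcal N)$. Then $G$ is not determined.
   Context: All groups are Abelian. $\mathbb T$ is the circle group, $(-\tfrac12,\tfrac12]$ with addition mod $1$ and its usual compact metrizable topology. For a topological Abelian group $G$, $\widehat G$ is the group of continuous homomorphisms $G\to\mathbb T$ with the compact-open topology. A dense subgroup $D$ of $G$ determines $G$ if the restriction map $\widehat G\to\widehat D$, $h\mapsto h|D$ (which is always a continuous group isomorphism) is a homeomorphism. $G$ is determined if every dense subgroup of $G$ determines $G$. $w(G)$ is the weight of $G$ (least cardinality of a base of the topology). $\mathrm{non}(\mathcal N)$ is the least cardinality of a subset of $\mathbb T$ that does not have Haar (Lebesgue) measure zero, i.e. that has positive outer Haar measure. *)

theory Defs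
  imports "HOL-Analysis.Analysis"
begin

unbundle cardinal_syntax

section \<open>The circle group\<close>

typedef circle = "{-1/2<..1/2::real}"
  morphisms rep_circle Abs_circle
  by (rule exI[of _ 0]) auto

text \<open>Reduction mod 1: \<open>r - \<lceil>r - 1/2\<rceil>\<close> is the representative of \<open>r\<close> in \<open>(-1/2, 1/2]\<close>.\<close>

definition to_circle :: "real \<Rightarrow> circle" where
  "to_circle r = Abs_circle (r - of_int \<lceil>r - 1/2\<rceil>)"

lemma rep_circle_bounds: "-1/2 < rep_circle x" "rep_circle x \<le> 1/2"
  using rep_circle[of x] by auto

lemma rep_to_circle: "rep_circle (to_circle r) = r - of_int \<lceil>r - 1/2\<rceil>"
proof -
  have "-1/2 < r - of_int \<lceil>r - 1/2\<rceil> \<and> r - of_int \<lceil>r - 1/2\<rceil> \<le> 1/2"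
    by linarith
  then show ?thesis
    unfolding to_circle_def by (subst Abs_circle_inverse) auto
qed

lemma to_circle_rep [simp]: "to_circle (rep_circle x) = x"
proof -
  have "\<lceil>rep_circle x - 1/2\<rceil> = 0"
    using rep_circle_bounds[of x] by linarith
  then show ?thesis
    by (simp add: to_circle_def rep_circle_inverse)
qed

lemma rep_to_circle_0: "rep_circle (to_circle 0) = 0"
proof -
  have "\<lceil>0 - 1/2 :: real\<rceil> = 0" by linarith
  then show ?thesis unfolding rep_to_circle by simp
qed

lemma to_circle_add_int: "to_circle (r + of_int k) = to_circle r"
proof -
  have "r + of_int k - 1/2 = (r - 1/2) + of_int k" by simp
  then have "\<lceil>r + of_int k - 1/2\<rceil> = \<lceil>r - 1/2\<rceil> + k"
    by (metis ceiling_add_of_int)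
  then show ?thesis by (simp add: to_circle_def)
qed

lemma to_circle_cong: "r - s = of_int k \<Longrightarrow> to_circle r = to_circle s"
  using to_circle_add_int[of s k] by (simp add: algebra_simps)

lemma abs_rep_to_circle_le: "\<bar>rep_circle (to_circle r)\<bar> \<le> \<bar>r\<bar>"
proof (cases "-1/2 < r \<and> r \<le> 1/2")
  case True
  then have "\<lceil>r - 1/2\<rceil> = 0" by linarith
  then show ?thesis by (simp add: rep_to_circle)
next
  case False
  then show ?thesis
    using rep_circle_bounds[of "to_circle r"] by auto
qed

instantiation circle :: ab_group_add
begin

definition zero_circle :: circle where "0 = to_circle 0"
definition plus_circle :: "circle \<Rightarrow> circle \<Rightarrow> circle"
  where "x + y = to_circle (rep_circle x + rep_circle y)"
definition uminus_circle :: "circle \<Rightarrow> circle"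
  where "- x = to_circle (- rep_circle x)"
definition minus_circle :: "circle \<Rightarrow> circle \<Rightarrow> circle"
  where "x - y = to_circle (rep_circle x - rep_circle y)"

instance
proof
  fix a b c :: circle
  show "a + b + c = a + (b + c)"
    unfolding plus_circle_def rep_to_circle
    by (rule to_circle_cong[where k = "\<lceil>rep_circle b + rep_circle c - 1/2\<rceil>
          - \<lceil>rep_circle a + rep_circle b - 1/2\<rceil>"]) simp
  show "a + b = b + a"
    by (simp add: plus_circle_def add.commute)
  show "0 + a = a"
    unfolding plus_circle_def zero_circle_def by (simp add: rep_to_circle_0)
  show "- a + a = 0"
    unfolding plus_circle_def zero_circle_def uminus_circle_def rep_to_circle
    by (rule to_circle_cong[where k = "- \<lceil>- rep_circle a - 1/2\<rceil>"]) simp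
  show "a - b = a + - b"
    unfolding plus_circle_def minus_circle_def uminus_circle_def rep_to_circle
    by (rule to_circle_cong[where k = "\<lceil>- rep_circle b - 1/2\<rceil>"]) simp
qed

end

lemma to_circle_add: "to_circle (r + s) = to_circle r + to_circle s"
  unfolding plus_circle_def rep_to_circle
  by (rule to_circle_cong[where k = "\<lceil>r - 1/2\<rceil> + \<lceil>s - 1/2\<rceil>"]) simp

lemma to_circle_minus: "to_circle (- r) = - to_circle r"
  unfolding uminus_circle_def rep_to_circle
  by (rule to_circle_cong[where k = "- \<lceil>r - 1/2\<rceil>"]) simp

lemma to_circle_diff: "to_circle (r - s) = to_circle r - to_circle s"
  using to_circle_add[of r "- s"] by (simp add: to_circle_minus)

lemma rep_circle_eq_0_iff: "rep_circle x = 0 \<longleftrightarrow> x = 0"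
proof -
  have "rep_circle 0 = 0" by (simp add: zero_circle_def rep_to_circle_0)
  then show ?thesis by (metis rep_circle_inject)
qed

lemma abs_rep_circle_add: "\<bar>rep_circle (x + y)\<bar> \<le> \<bar>rep_circle x\<bar> + \<bar>rep_circle y\<bar>"
  unfolding plus_circle_def
  by (rule order_trans[OF abs_rep_to_circle_le]) (rule abs_triangle_ineq)

lemma abs_rep_circle_minus: "\<bar>rep_circle (- x)\<bar> = \<bar>rep_circle x\<bar>"
proof -
  have "\<bar>rep_circle (- z)\<bar> \<le> \<bar>rep_circle z\<bar>" for z
    unfolding uminus_circle_def using abs_rep_to_circle_le[of "- rep_circle z"] by simp
  from this[of x] this[of "- x"] show ?thesis by simp
qed

text \<open>The arc-length metric, which induces the quotient topology of \<open>\<real>/\<int>\<close>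
  (see \<open>open_circle_iff\<close>).\<close>

instantiation circle :: metric_space
begin

definition dist_circle :: "circle \<Rightarrow> circle \<Rightarrow> real"
  where "dist x y = \<bar>rep_circle (x - y)\<bar>"
definition uniformity_circle :: "(circle \<times> circle) filter"
  where "uniformity = (INF e\<in>{0 <..}. principal {(x :: circle, y). dist x y < e})"
definition open_circle :: "circle set \<Rightarrow> bool"
  where "open (U :: circle set) \<longleftrightarrow> (\<forall>x\<in>U. eventually (\<lambda>(x', y). x' = x \<longrightarrow> y \<in> U) uniformity)"

instance
proof
  fix x y z :: circle
  show "dist x y = 0 \<longleftrightarrow> x = y"
    by (simp add: dist_circle_def rep_circle_eq_0_iff)
  have "\<bar>rep_circle ((x - z) + - (y - z))\<bar> \<le> \<bar>rep_circle (x - z)\<bar> + \<bar>rep_circle (- (y - z))\<bar>"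
    by (rule abs_rep_circle_add)
  then show "dist x y \<le> dist x z + dist y z"
    unfolding abs_rep_circle_minus by (simp add: dist_circle_def)
qed (auto simp: uniformity_circle_def open_circle_def)

end

lemma dist_circle_add: "dist (a + b) (c + d) \<le> dist a c + dist b (d :: circle)"
proof -
  have "a + b - (c + d) = (a - c) + (b - d)" by simp
  then show ?thesis
    unfolding dist_circle_def using abs_rep_circle_add by metis
qed

instance circle :: topological_ab_group_add
proof
  fix a b :: circle
  show "LIM x (nhds a \<times>\<^sub>F nhds b). fst x + snd x :> nhds (a + b)"
  proof (rule tendstoI)
    fix e :: real assume "e > 0"
    have "eventually (\<lambda>x. dist x a < e/2) (nhds a)" "eventually (\<lambda>x. dist x b < e/2) (nhds b)"
      using \<open>e > 0\<close> by (auto simp: eventually_nhds_metric intro!: exI[of _ "e/2"])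
    then have "eventually (\<lambda>x. dist (fst x) a < e/2 \<and> dist (snd x) b < e/2) (nhds a \<times>\<^sub>F nhds b)"
      by (auto simp: eventually_prod_filter)
    then show "eventually (\<lambda>x. dist (fst x + snd x) (a + b) < e) (nhds a \<times>\<^sub>F nhds b)"
    proof (rule eventually_mono)
      fix x assume "dist (fst x) a < e/2 \<and> dist (snd x) b < e/2"
      then show "dist (fst x + snd x) (a + b) < e"
        using dist_circle_add[of "fst x" "snd x" a b] by linarith
    qed
  qed
next
  fix a :: circle
  have "dist (- x) (- a) = dist x a" for x
    using abs_rep_circle_minus[of "x - a"] by (simp add: dist_circle_def)
  then show "(uminus \<longlongrightarrow> - a) (nhds a)"
    by (auto intro!: tendstoI simp: eventually_nhds_metric)
qed

lemma dist_to_circle_le: "dist (to_circle r) (to_circle s) \<le> \<bar>r - s\<bar>"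
  unfolding dist_circle_def using abs_rep_to_circle_le[of "r - s"] by (simp add: to_circle_diff)

lemma continuous_to_circle: "continuous_on S to_circle"
  unfolding continuous_on_iff
  using dist_to_circle_le by (metis dist_real_def order_le_less_trans)

lemma open_circle_iff: "open (U :: circle set) \<longleftrightarrow> open (to_circle -` U)"
proof
  assume "open U"
  then show "open (to_circle -` U)"
    using continuous_to_circle by (intro open_vimage) auto
next
  assume *: "open (to_circle -` U)"
  show "open U"
    unfolding open_dist
  proof
    fix x assume "x \<in> U"
    then have "rep_circle x \<in> to_circle -` U" by simp
    with * obtain e where e: "e > 0" "\<And>r. dist r (rep_circle x) < e \<Longrightarrow> to_circle r \<in> U"
      unfolding open_dist by (meson vimageD)
    have "y \<in> U" if "dist y x < e" for y
    proof -
      have "to_circle (rep_circle x + rep_circle (y - x)) = y"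
        by (simp add: to_circle_add)
      moreover have "dist (rep_circle x + rep_circle (y - x)) (rep_circle x) < e"
        using that by (simp add: dist_real_def dist_circle_def)
      ultimately show ?thesis using e(2) by metis
    qed
    with e(1) show "\<exists>e>0. \<forall>y. dist y x < e \<longrightarrow> y \<in> U" by blast
  qed
qed

lemma compact_circle: "compact (UNIV :: circle set)"
proof -
  have "to_circle ` {-1/2..1/2} = UNIV"
  proof (intro equalityI subsetI UNIV_I)
    fix x :: circle
    show "x \<in> to_circle ` {-1/2..1/2}"
      using rep_circle_bounds[of x] by (intro image_eqI[of _ _ "rep_circle x"]) simp_all
  qed
  then show ?thesis
    by (metis compact_continuous_image continuous_to_circle compact_Icc)
qed

section \<open>Weight and \<open>non(\<N>)\<close>\<close>

definition least_card :: "('a set \<Rightarrow> bool) \<Rightarrow> 'a rel" where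
  "least_card P = |SOME A. P A \<and> (\<forall>B. P B \<longrightarrow> |A| \<le>o |B| )|"

lemma ex_least_card:
  assumes "P A0"
  shows "\<exists>A. P A \<and> (\<forall>B. P B \<longrightarrow> |A| \<le>o |B| )"
proof -
  have "\<exists>r\<in>card_of ` Collect P. \<forall>r'\<in>card_of ` Collect P. r \<le>o r'"
    by (rule exists_minim_Card_order) (use assms in \<open>auto simp: card_of_Card_order\<close>)
  then show ?thesis by auto
qed

lemma least_card_attained:
  assumes "P A0"
  shows "\<exists>A. P A \<and> least_card P = |A|"
  unfolding least_card_def using someI_ex[OF ex_least_card[of P, OF assms]] by blast

lemma least_card_le: "P B \<Longrightarrow> least_card P \<le>o |B|"
  unfolding least_card_def using someI_ex[OF ex_least_card[of P B]] by blast

definition weight :: "'a::topological_space itself \<Rightarrow> 'a set rel" where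
  "weight _ = least_card (topological_basis :: 'a set set \<Rightarrow> bool)"

text \<open>The normalized Haar measure of the circle is Lebesgue measure on the representatives
  in \<open>(-1/2, 1/2]\<close>. Since \<open>lebesgue\<close> is complete, its null sets are exactly the sets of
  outer measure zero, so that a set that is not \<open>haar_null\<close> has positive outer measure,
  be it measurable or not.\<close>

definition haar_null :: "circle set \<Rightarrow> bool" where
  "haar_null A \<longleftrightarrow> rep_circle ` A \<in> null_sets lebesgue"

definition non_N :: "circle rel" where
  "non_N = least_card (\<lambda>A. \<not> haar_null A)"

lemma not_haar_null_UNIV: "\<not> haar_null UNIV"
proof -
  have "rep_circle ` UNIV = {-1/2<..1/2}"
    by (rule type_definition.Rep_range[OF type_definition_circle])
  moreover have "emeasure lebesgue {-1/2<..1/2::real} \<noteq> 0"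
    by simp
  ultimately show ?thesis by (auto simp: haar_null_def null_sets_def)
qed

section \<open>Dual groups and determined groups\<close>

definition add_subgroup :: "'a::ab_group_add set \<Rightarrow> bool" where
  "add_subgroup D \<longleftrightarrow> 0 \<in> D \<and> (\<forall>x\<in>D. \<forall>y\<in>D. x + y \<in> D) \<and> (\<forall>x\<in>D. - x \<in> D)"

text \<open>Characters of a subgroup \<open>D\<close> with the subspace topology. A function on \<open>D\<close> is represented
  by the extensional function that is \<open>undefined\<close> outside \<open>D\<close>.\<close>

definition dual :: "'a::topological_ab_group_add set \<Rightarrow> ('a \<Rightarrow> circle) set" where
  "dual D = {h \<in> extensional D. continuous_on D h \<and> (\<forall>x\<in>D. \<forall>y\<in>D. h (x + y) = h x + h y)}"

definition compact_open :: "'a::topological_ab_group_add set \<Rightarrow> ('a \<Rightarrow> circle) topology" where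
  "compact_open D =
     topology_generated_by {{h \<in> dual D. h ` K \<subseteq> U} | K U. K \<subseteq> D \<and> compact K \<and> open U}"

lemma topspace_compact_open [simp]: "topspace (compact_open D) = dual D"
  unfolding compact_open_def topology_generated_by_topspace
  by (auto intro!: exI[of _ "dual D"] exI[of _ "{}"])

definition determines :: "'a::topological_ab_group_add set \<Rightarrow> bool" where
  "determines D \<longleftrightarrow>
     homeomorphic_map (compact_open UNIV) (compact_open D) (\<lambda>h. restrict h D)"

definition determined :: "'a::topological_ab_group_add itself \<Rightarrow> bool" where
  "determined _ \<longleftrightarrow> (\<forall>D :: 'a set. add_subgroup D \<and> closure D = UNIV \<longrightarrow> determines D)"

end

theory Submission
  imports Defs "HOL-Library.Function_Algebras"
begin

text \<open>
Let \<open>G\<close> be compact. Since the circle has no small subgroups, the zero character is isolated in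
the dual of \<open>G\<close>. If a dense subgroup \<open>D\<close> determined \<open>G\<close>, zero would be isolated in the dual
of \<open>D\<close> too: some compact \<open>K \<subseteq> D\<close> and some \<open>e > 0\<close> would force every character of \<open>G\<close> that is
\<open>e\<close>-small on \<open>K\<close> to vanish on \<open>D\<close> (\<open>determines_compact_set\<close>). The proof builds a dense \<open>D\<close> whose
compact subsets are so small, seen through an infinite family of characters, that the pigeonhole
principle always provides a nonzero character that is small on \<open>K\<close>.

The source of \<open>D\<close> is a countable group \<open>\<A>\<close> of functions on the circle, in the simplest case all
\<open>y \<mapsto> n y\<close>. Composed with the standard character of the circle, distinct elements of \<open>\<A>\<close> become
orthogonal functions, and by Chebyshev's inequality a sequence of distinct elements of \<open>\<A>\<close>
converges only on a null set of points \<open>y\<close> (\<open>convergent_null\<close>). Choose a set \<open>Y\<close> of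
cardinality \<open>non(\<N>)\<close> that is not null, a maximal subset \<open>S\<close> of \<open>Y\<close> whose evaluations on \<open>\<A>\<close> are
independent, and independent continuous characters \<open>\<gamma> s\<close> of \<open>G\<close> indexed by \<open>S\<close>. Let \<open>D\<close> consist of
the \<open>g\<close> for which \<open>s \<mapsto> \<gamma> s g\<close> agrees on \<open>S\<close> with an element of \<open>\<A>\<close>. Only countably many functions
\<open>s \<mapsto> \<gamma> s g\<close> arise from a compact \<open>K \<subseteq> D\<close>. If they were infinitely many, compactness would give
a sequence of distinct elements of \<open>\<A>\<close> that converges on \<open>S\<close>. By maximality of \<open>S\<close> a multiple of
it would converge at each point of \<open>Y\<close>, so \<open>Y\<close> would be a countable union of null sets
(\<open>not_all_convergent\<close>). Hence they are finitely many, and two of the infinitely many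
\<open>\<gamma> s\<close> are uniformly close on \<open>K\<close>: their difference is the required character.

The characters \<open>\<gamma> s\<close> exist because \<open>G\<close> has at least \<open>non(\<N>)\<close> continuous characters
(\<open>card_characters_ge\<close>), and because a group of that size contains \<open>non(\<N>)\<close> independent elements which
either all have infinite order or all have the same prime order \<open>p\<close> (\<open>large_indep\<close>). In the second
case \<open>\<A>\<close> is generated by the base \<open>p\<close> digit functions. The cardinal \<open>non(\<N>)\<close> is suited
to this since a countable union of sets that are smaller than \<open>non(\<N>)\<close> is null.

Three facts about a compact group are needed. Its continuous characters
separate a point of an open set from the points outside (\<open>characters_separate\<close>). The proof
follows Bogolyubov and Foelner: finite Fourier analysis on finite groups
that approximate \<open>G\<close> gives approximate characters, and a cluster point of these is a character. Next,
every homomorphism into the circle defined on the functions on \<open>G\<close> acts on the characters as evaluation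
at a point (\<open>evaluation_surjective\<close>), and a subgroup that is annihilated by no nonzero character is
dense (\<open>dense_if_separates_characters\<close>). Both are instances of one approximation theorem of
Kronecker type (\<open>kronecker\<close>). Together with the extension of homomorphisms into the divisible group
of the circle they show that \<open>D\<close> is dense.
\<close>

section \<open>Integer multiples, generated subgroups and additive maps\<close>

definition zmul :: "int \<Rightarrow> 'g::ab_group_add \<Rightarrow> 'g" where
  "zmul n x = (if 0 \<le> n then (\<Sum>i<nat n. x) else - (\<Sum>i<nat (- n). x))"

lemma zmul_0 [simp]: "zmul 0 x = 0" by (simp add: zmul_def)
lemma zmul_1 [simp]: "zmul 1 x = x" by (simp add: zmul_def)

lemma zmul_add1: "zmul (n + 1) x = zmul n x + x"
proof (cases "0 \<le> n")
  case True
  then have "nat (n + 1) = Suc (nat n)" by simp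
  then show ?thesis using True by (simp add: zmul_def)
next
  case False
  define k where "k = nat (- n - 1)"
  then have n: "n = - 1 - int k" using False by simp
  have "nat (- n) = Suc k" using n by simp
  moreover have "n + 1 = - int k" using n by simp
  ultimately show ?thesis using False by (cases "k = 0") (simp_all add: zmul_def)
qed

lemma zmul_sub1: "zmul (n - 1) x = zmul n x - x"
  using zmul_add1[of "n - 1" x] by simp

lemma zmul_distrib_left: "zmul (m + n) x = zmul m x + zmul n x"
  by (induction n rule: int_induct[where k = 0])
     (simp_all add: zmul_add1 zmul_sub1 add.assoc[symmetric] add_diff_eq)

lemma zmul_distrib_right: "zmul n (x + y) = zmul n x + zmul n y"
  by (induction n rule: int_induct[where k = 0]) (simp_all add: zmul_add1 zmul_sub1)

lemma zmul_zero_right [simp]: "zmul n 0 = 0"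
  by (simp add: zmul_def)

lemma zmul_minus_left: "zmul (- n) x = - zmul n x"
  using zmul_distrib_left[of n "- n" x] by (simp add: eq_neg_iff_add_eq_0 add.commute)

lemma zmul_minus_right: "zmul n (- x) = - zmul n x"
  using zmul_distrib_right[of n x "- x"] by (simp add: eq_neg_iff_add_eq_0 add.commute)

lemma zmul_diff_left: "zmul (m - n) x = zmul m x - zmul n x"
  using zmul_distrib_left[of m "- n" x] by (simp add: zmul_minus_left)

lemma zmul_diff_right: "zmul n (x - y) = zmul n x - zmul n y"
  using zmul_distrib_right[of n x "- y"] by (simp add: zmul_minus_right)

lemma zmul_mult: "zmul (m * n) x = zmul m (zmul n x)"
  by (induction m rule: int_induct[where k = 0])
     (simp_all add: zmul_add1 zmul_sub1 zmul_distrib_left distrib_right left_diff_distrib zmul_diff_left)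

lemma zmul_dvd_eq_0: "zmul m x = 0 \<Longrightarrow> m dvd n \<Longrightarrow> zmul n x = 0"
  by (metis dvd_def mult.commute zmul_mult zmul_zero_right)

lemma zmul_fun_apply: "zmul n f x = zmul n (f x)"
  by (induction n rule: int_induct[where k = 0]) (simp_all add: zmul_add1 zmul_sub1)

lemma sum_fun_apply: "(\<Sum>i\<in>A. f i) x = (\<Sum>i\<in>A. f i x)"
  by (induction A rule: infinite_finite_induct) simp_all

definition additive_on :: "'g set \<Rightarrow> ('g::ab_group_add \<Rightarrow> 'h::ab_group_add) \<Rightarrow> bool" where
  "additive_on D h \<longleftrightarrow> (\<forall>x\<in>D. \<forall>y\<in>D. h (x + y) = h x + h y)"

lemma additive_onD: "additive_on D h \<Longrightarrow> x \<in> D \<Longrightarrow> y \<in> D \<Longrightarrow> h (x + y) = h x + h y"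
  by (auto simp: additive_on_def)

lemma add_subgroup_UNIV [simp]: "add_subgroup UNIV" by (simp add: add_subgroup_def)

lemma add_subgroupD:
  assumes "add_subgroup D"
  shows "0 \<in> D" "x \<in> D \<Longrightarrow> y \<in> D \<Longrightarrow> x + y \<in> D" "x \<in> D \<Longrightarrow> - x \<in> D"
    "x \<in> D \<Longrightarrow> y \<in> D \<Longrightarrow> x - y \<in> D"
  using assms by (auto simp: add_subgroup_def) (metis diff_conv_add_uminus)

lemma add_subgroup_zmul: "add_subgroup D \<Longrightarrow> x \<in> D \<Longrightarrow> zmul n x \<in> D"
  by (induction n rule: int_induct[where k = 0]) (simp_all add: zmul_add1 zmul_sub1 add_subgroupD)

lemma add_subgroup_sum: "add_subgroup D \<Longrightarrow> (\<And>i. i \<in> A \<Longrightarrow> f i \<in> D) \<Longrightarrow> (\<Sum>i\<in>A. f i) \<in> D"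
  by (induction A rule: infinite_finite_induct) (simp_all add: add_subgroupD)

lemma additive_on_zero: "additive_on D h \<Longrightarrow> add_subgroup D \<Longrightarrow> h 0 = 0"
  using additive_onD[of D h 0 0] by (simp add: add_subgroupD)

lemma additive_on_minus:
  assumes "additive_on D h" "add_subgroup D" "x \<in> D" shows "h (- x) = - h x"
  using additive_onD[OF assms(1,3), of "- x"] assms
  by (simp add: add_subgroupD additive_on_zero eq_neg_iff_add_eq_0 add.commute)

lemma additive_on_diff:
  assumes "additive_on D h" "add_subgroup D" "x \<in> D" "y \<in> D" shows "h (x - y) = h x - h y"
  using additive_onD[OF assms(1,3), of "- y"] assms
  by (simp add: add_subgroupD additive_on_minus)

lemma additive_on_zmul:
  assumes "additive_on D h" "add_subgroup D" "x \<in> D" shows "h (zmul n x) = zmul n (h x)"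
  by (induction n rule: int_induct[where k = 0])
     (simp_all add: zmul_add1 zmul_sub1 additive_on_zero[OF assms(1,2)] additive_onD[OF assms(1)]
       additive_on_diff[OF assms(1,2)] add_subgroup_zmul assms)

lemma additive_on_sum:
  assumes "additive_on D h" "add_subgroup D" "\<And>i. i \<in> A \<Longrightarrow> f i \<in> D"
  shows "h (\<Sum>i\<in>A. f i) = (\<Sum>i\<in>A. h (f i))"
  using assms(3)
proof (induction A rule: infinite_finite_induct)
  case (insert x F)
  then have "(\<Sum>i\<in>F. f i) \<in> D" by (intro add_subgroup_sum assms(2)) auto
  with insert show ?case using additive_onD[OF assms(1), of "f x" "\<Sum>i\<in>F. f i"] by simp
qed (simp_all add: additive_on_zero[OF assms(1,2)])

text \<open>Lists of coefficients and generators, rather than an intersection of subgroups, make countability and cardinality of the generated subgroup immediate.\<close>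

definition gen :: "'g::ab_group_add set \<Rightarrow> 'g set" where
  "gen X = (\<lambda>l. \<Sum>(n, x)\<leftarrow>l. zmul n x) ` lists (UNIV \<times> X)"

lemma gen_incl: "x \<in> X \<Longrightarrow> x \<in> gen X"
  unfolding gen_def by (rule image_eqI[of _ _ "[(1, x)]"]) auto

lemma add_subgroup_gen: "add_subgroup (gen X)"
proof -
  have "0 \<in> gen X" unfolding gen_def by (rule image_eqI[of _ _ "[]"]) auto
  moreover have "x + y \<in> gen X" if "x \<in> gen X" "y \<in> gen X" for x y
  proof -
    from that(1) obtain k where "k \<in> lists (UNIV \<times> X)" "x = (\<Sum>(n, x)\<leftarrow>k. zmul n x)"
      unfolding gen_def by (elim imageE) blast
    moreover from that(2) obtain l where "l \<in> lists (UNIV \<times> X)" "y = (\<Sum>(n, x)\<leftarrow>l. zmul n x)"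
      unfolding gen_def by (elim imageE) blast
    ultimately show ?thesis unfolding gen_def by (intro image_eqI[of _ _ "k @ l"]) auto
  qed
  moreover have "- x \<in> gen X" if x: "x \<in> gen X" for x
  proof -
    obtain k where k: "k \<in> lists (UNIV \<times> X)" "x = (\<Sum>(n, x)\<leftarrow>k. zmul n x)"
      using x unfolding gen_def by (elim imageE) blast
    have "- (\<Sum>(n, x)\<leftarrow>k. zmul n x) = (\<Sum>(n, x)\<leftarrow>map (\<lambda>(n, x). (- n, x)) k. zmul n x)"
      by (induction k) (auto simp: zmul_minus_left)
    then show ?thesis using k unfolding gen_def
      by (intro image_eqI[of _ _ "map (\<lambda>(n, x). (- n, x)) k"]) auto
  qed
  ultimately show ?thesis by (auto simp: add_subgroup_def)
qed

lemma gen_minimal: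
  assumes "add_subgroup D" "X \<subseteq> D" shows "gen X \<subseteq> D"
proof -
  have "(\<Sum>(n, x)\<leftarrow>l. zmul n x) \<in> D" if "l \<in> lists (UNIV \<times> X)" for l
    using that assms(2)
    by (induction l) (auto simp: add_subgroupD[OF assms(1)] add_subgroup_zmul[OF assms(1)] subset_eq)
  then show ?thesis by (auto simp: gen_def)
qed

lemma gen_family:
  "gen (v ` S) = {\<Sum>s\<in>F. zmul (n s) (v s) | F n. finite F \<and> F \<subseteq> S}" (is "_ = ?R")
proof
  have sum_ext: "(\<Sum>s\<in>F. zmul (n s) (v s)) = (\<Sum>s\<in>H. zmul (if s \<in> F then n s else 0) (v s))"
    if "finite H" "F \<subseteq> H" for F H n
    by (rule sum.mono_neutral_cong_left) (use that in auto)
  have "add_subgroup ?R"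
    unfolding add_subgroup_def
  proof (intro conjI ballI)
    show "0 \<in> ?R" by (auto intro!: exI[of _ "{}"])
    fix x assume "x \<in> ?R"
    then obtain F n where F: "finite F" "F \<subseteq> S" "x = (\<Sum>s\<in>F. zmul (n s) (v s))" by auto
    then have "- x = (\<Sum>s\<in>F. zmul ((\<lambda>s. - n s) s) (v s))" by (simp add: zmul_minus_left sum_negf)
    then show "- x \<in> ?R" using F(1,2) by (intro CollectI exI[of _ F] exI[of _ "\<lambda>s. - n s"]) auto
    fix y assume "y \<in> ?R"
    then obtain H k where H: "finite H" "H \<subseteq> S" "y = (\<Sum>s\<in>H. zmul (k s) (v s))" by auto
    have "x + y = (\<Sum>s\<in>F \<union> H. zmul ((\<lambda>s. (if s \<in> F then n s else 0) + (if s \<in> H then k s else 0)) s) (v s))"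
      using F H sum_ext[of "F \<union> H" F n] sum_ext[of "F \<union> H" H k]
      by (simp add: zmul_distrib_left sum.distrib)
    moreover have "finite (F \<union> H)" "F \<union> H \<subseteq> S" using F H by auto
    ultimately show "x + y \<in> ?R"
      by (intro CollectI exI[of _ "F \<union> H"] exI[of _ "\<lambda>s. (if s \<in> F then n s else 0) + (if s \<in> H then k s else 0)"]) auto
  qed
  moreover have "v s \<in> ?R" if "s \<in> S" for s
    using that by (auto intro!: exI[of _ "{s}"] exI[of _ "\<lambda>_. 1"])
  ultimately show "gen (v ` S) \<subseteq> ?R" by (intro gen_minimal) auto
  show "?R \<subseteq> gen (v ` S)"
  proof clarify
    fix F n assume "F \<subseteq> S"
    then show "(\<Sum>s\<in>F. zmul (n s) (v s)) \<in> gen (v ` S)"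
      by (intro add_subgroup_sum add_subgroup_zmul add_subgroup_gen gen_incl) auto
  qed
qed

lemma gen_singleton: "gen {x} = range (\<lambda>n. zmul n x)"
proof -
  have "(\<Sum>u\<in>F. zmul (n u) x) \<in> range (\<lambda>n. zmul n x)" for F :: "unit set" and n
  proof (cases "() \<in> F")
    case True
    then have "F = {()}" by auto
    then show ?thesis by simp
  next
    case False
    then have "F = {}" by auto
    then show ?thesis by (auto intro: range_eqI[of _ _ 0])
  qed
  then have "gen ((\<lambda>_ :: unit. x) ` UNIV) \<subseteq> range (\<lambda>n. zmul n x)" unfolding gen_family by blast
  moreover have "range (\<lambda>n. zmul n x) \<subseteq> gen {x}"
    by (auto intro: add_subgroup_zmul[OF add_subgroup_gen] gen_incl)
  ultimately show ?thesis by auto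
qed

section \<open>The standard character of the circle\<close>

definition circle_exp :: "circle \<Rightarrow> complex" where
  "circle_exp t = cis (2 * pi * rep_circle t)"

lemma cis_2pi_of_int [simp]: "cis (2 * pi * of_int k) = 1"
  using cis_multiple_2pi[of "of_int k"] by (simp add: mult.commute mult.left_commute)

lemma circle_exp_to_circle: "circle_exp (to_circle r) = cis (2 * pi * r)"
proof -
  have "2 * pi * rep_circle (to_circle r) = 2 * pi * r - 2 * pi * of_int \<lceil>r - 1/2\<rceil>"
    by (simp add: rep_to_circle right_diff_distrib)
  then show ?thesis unfolding circle_exp_def by (metis cis_2pi_of_int cis_divide div_by_1)
qed

lemma circle_exp_0 [simp]: "circle_exp 0 = 1"
  by (simp add: zero_circle_def circle_exp_to_circle)

lemma circle_exp_add: "circle_exp (s + t) = circle_exp s * circle_exp t"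
  by (metis circle_exp_to_circle cis_mult distrib_left to_circle_add to_circle_rep)

lemma norm_circle_exp [simp]: "norm (circle_exp t) = 1"
  by (simp add: circle_exp_def)

lemma circle_exp_nonzero [simp]: "circle_exp t \<noteq> 0"
  by (metis norm_circle_exp norm_zero zero_neq_one)

lemma circle_exp_minus: "circle_exp (- t) = cnj (circle_exp t)"
  unfolding uminus_circle_def circle_exp_to_circle by (simp add: circle_exp_def cis_cnj)

lemma circle_exp_diff: "circle_exp (s - t) = circle_exp s * cnj (circle_exp t)"
  by (metis circle_exp_add circle_exp_minus diff_conv_add_uminus)

lemma circle_exp_sum: "circle_exp (\<Sum>i\<in>A. f i) = (\<Prod>i\<in>A. circle_exp (f i))"
  by (induction A rule: infinite_finite_induct) (simp_all add: circle_exp_add)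

lemma circle_exp_eq_1_iff: "circle_exp t = 1 \<longleftrightarrow> t = 0"
proof
  assume "circle_exp t = 1"
  then have "cos (2 * pi * rep_circle t) = 1" by (simp add: circle_exp_def complex_eq_iff)
  then obtain n :: int where "2 * pi * rep_circle t = of_int n * 2 * pi"
    by (auto simp: cos_one_2pi_int)
  then have "rep_circle t = of_int n" by simp
  moreover have "-1 < rep_circle t" "rep_circle t < 1" using rep_circle_bounds[of t] by linarith+
  ultimately have "rep_circle t = 0" by simp
  then show "t = 0" by (simp add: rep_circle_eq_0_iff)
qed simp

lemma circle_exp_inj: "circle_exp s = circle_exp t \<longleftrightarrow> s = t"
proof
  assume "circle_exp s = circle_exp t"
  then have "circle_exp (s - t) = 1"
    by (simp add: circle_exp_diff complex_norm_square[symmetric])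
  then show "s = t" by (simp add: circle_exp_eq_1_iff)
qed simp

lemma norm_circle_exp_diff: "norm (circle_exp s - circle_exp t) = norm (circle_exp (s - t) - 1)"
proof -
  have "circle_exp s - circle_exp t = circle_exp t * (circle_exp (s - t) - 1)"
    using circle_exp_add[of t "s - t"] by (simp add: algebra_simps)
  then show ?thesis by (simp add: norm_mult)
qed

lemma dist_circle_exp_le: "dist (circle_exp s) (circle_exp t) \<le> 2 * pi * dist s t"
proof -
  have "norm (cis x - 1) \<le> \<bar>x\<bar>" for x
  proof -
    have "(norm (cis x - 1))\<^sup>2 = (cos x - 1)\<^sup>2 + (sin x)\<^sup>2"
      by (simp add: cmod_power2)
    also have "\<dots> = 2 - 2 * cos x"
      by (simp add: power2_diff)
    also have "\<dots> = (2 * sin (x / 2))\<^sup>2"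
      using cos_double_sin[of "x / 2"] by (simp add: power2_eq_square)
    finally have "(norm (cis x - 1))\<^sup>2 = (2 * sin (x / 2))\<^sup>2" .
    then have "norm (cis x - 1) = \<bar>2 * sin (x / 2)\<bar>"
      using norm_ge_zero[of "cis x - 1"] unfolding power2_eq_iff by linarith
    also have "\<dots> \<le> \<bar>x\<bar>" using abs_sin_x_le_abs_x[of "x / 2"] by simp
    finally show ?thesis .
  qed
  from this[of "2 * pi * rep_circle (s - t)"] show ?thesis
    by (simp only: dist_norm norm_circle_exp_diff[of s t]) (simp add: circle_exp_def dist_circle_def abs_mult)
qed

lemma continuous_on_circle_exp: "continuous_on S circle_exp"
proof (rule continuous_on_subset)
  show "continuous_on UNIV circle_exp"
    unfolding continuous_on_iff
  proof (intro ballI allI impI)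
    fix s :: circle and e :: real assume "e > 0"
    then show "\<exists>d>0. \<forall>t\<in>UNIV. dist t s < d \<longrightarrow> dist (circle_exp t) (circle_exp s) < e"
      using dist_circle_exp_le
      by (intro exI[of _ "e / (2 * pi)"]) (auto simp: field_simps intro: order_le_less_trans)
  qed
qed simp

text \<open>Smallness of \<open>t\<close> can be read off from \<open>circle_exp t\<close>, because the circle is compact and \<open>circle_exp t = 1\<close> only for \<open>t = 0\<close>.\<close>

lemma circle_exp_near_1:
  assumes "e > 0"
  obtains d where "d > 0" "\<And>t. norm (circle_exp t - 1) < d \<Longrightarrow> dist t 0 < e"
proof (cases "{t :: circle. e \<le> dist t 0} = {}")
  case True
  then show ?thesis using that[of 1] by (auto simp: not_le)
next
  case False
  have "closed {t :: circle. e \<le> dist t 0}"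
    by (intro closed_Collect_le continuous_intros)
  then have "compact {t :: circle. e \<le> dist t 0}"
    using compact_Int_closed[OF compact_circle] by simp
  moreover have "continuous_on {t. e \<le> dist t 0} (\<lambda>t. norm (circle_exp t - 1))"
    by (intro continuous_intros continuous_on_circle_exp)
  ultimately obtain t where t: "e \<le> dist t 0"
    "\<And>s. e \<le> dist s 0 \<Longrightarrow> norm (circle_exp t - 1) \<le> norm (circle_exp s - 1)"
    using continuous_attains_inf[OF _ False] by blast
  have "t \<noteq> 0" using t(1) assms by auto
  then have "norm (circle_exp t - 1) > 0" by (simp add: circle_exp_eq_1_iff)
  then show ?thesis using that t(2) by (meson not_le)
qed

lemma circle_exp_zmul_nat: "circle_exp (zmul (int n) t) = circle_exp t ^ n"
proof (induction n)
  case (Suc n)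
  have "int (Suc n) = int n + 1" by simp
  then show ?case using Suc by (metis circle_exp_add power_Suc2 zmul_add1)
qed simp

lemma zmul_to_circle: "zmul n (to_circle r) = to_circle (of_int n * r)"
  by (induction n rule: int_induct[where k = 0])
     (simp_all add: zmul_add1 zmul_sub1 distrib_right left_diff_distrib to_circle_add to_circle_diff zero_circle_def)

lemma to_circle_eq_0_iff: "to_circle r = 0 \<longleftrightarrow> r \<in> \<int>"
proof
  assume "to_circle r = 0"
  then have "r - of_int \<lceil>r - 1/2\<rceil> = 0"
    by (metis rep_circle_eq_0_iff rep_to_circle)
  then show "r \<in> \<int>" by (metis Ints_of_int eq_iff_diff_eq_0)
next
  assume "r \<in> \<int>"
  then obtain k where "r = of_int k" by (auto elim: Ints_cases)
  then show "to_circle r = 0" using to_circle_add_int[of 0 k] by (simp add: zero_circle_def)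
qed

lemma compact_fun_circle: "compact (UNIV :: ('i \<Rightarrow> circle) set)"
  using compact_space_product_topology[of "\<lambda>_ :: 'i. euclidean :: circle topology" UNIV] compact_circle
  by (simp add: euclidean_product_topology compact_space_def)

section \<open>Characters of a group with a totally bounded seminorm\<close>

text \<open>The characters of the finite group \<open>(\<int>/N)\<^sup>\<Phi>\<close>, indexed by the same group through representatives in \<open>{0..<N}\<close>.\<close>

definition cyc_char :: "'i set \<Rightarrow> nat \<Rightarrow> ('i \<Rightarrow> nat) \<Rightarrow> ('i \<Rightarrow> int) \<Rightarrow> complex" where
  "cyc_char \<Phi> N j v = cis (2 * pi * (\<Sum>g\<in>\<Phi>. real (j g) * of_int (v g)) / real N)"

lemma cyc_char_add: "cyc_char \<Phi> N j (\<lambda>g. v g + w g) = cyc_char \<Phi> N j v * cyc_char \<Phi> N j w"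
  by (simp add: cyc_char_def cis_mult add_divide_distrib[symmetric] sum.distrib distrib_left)

lemma cyc_char_cnj: "cnj (cyc_char \<Phi> N j v) = cyc_char \<Phi> N j (\<lambda>g. - v g)"
  by (simp add: cyc_char_def cis_cnj sum_negf)

lemma cyc_char_diff: "cyc_char \<Phi> N j (\<lambda>g. v g - w g) = cyc_char \<Phi> N j v * cnj (cyc_char \<Phi> N j w)"
  using cyc_char_add[of \<Phi> N j v "\<lambda>g. - w g"] by (simp add: cyc_char_cnj)

lemma norm_cyc_char [simp]: "norm (cyc_char \<Phi> N j v) = 1"
  by (simp add: cyc_char_def)

lemma cyc_char_unit:
  assumes "finite \<Phi>" "g \<in> \<Phi>"
  shows "cyc_char \<Phi> N j (\<lambda>h. if h = g then k else 0) = cis (2 * pi * (real (j g) * of_int k) / real N)"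
proof -
  have "(\<Sum>h\<in>\<Phi>. real (j h) * of_int (if h = g then k else 0)) = (\<Sum>h\<in>\<Phi>. if h = g then real (j h) * of_int k else 0)"
    by (rule sum.cong) auto
  then show ?thesis using assms by (simp add: cyc_char_def)
qed

lemma cis_sum: "cis (\<Sum>i\<in>A. f i) = (\<Prod>i\<in>A. cis (f i))"
  by (induction A rule: infinite_finite_induct) (simp_all add: cis_mult[symmetric])

lemma sum_roots_of_unity:
  assumes "N > 0"
  shows "(\<Sum>j<N. cis (2 * pi * (real j * of_int v) / real N)) = (if int N dvd v then of_nat N else 0)"
proof -
  define z where "z = cis (2 * pi * of_int v / real N)"
  have pow: "cis (2 * pi * (real j * of_int v) / real N) = z ^ j" for j
    unfolding z_def Complex.DeMoivre by (rule arg_cong[where f = cis]) simp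
  show ?thesis
  proof (cases "int N dvd v")
    case True
    then obtain k where "v = int N * k" by (auto simp: dvd_def)
    then have "z = 1" using assms by (simp add: z_def mult.assoc[symmetric])
    then show ?thesis using True by (simp add: pow)
  next
    case False
    have "z \<noteq> 1"
    proof
      assume "z = 1"
      then have "circle_exp (to_circle (of_int v / real N)) = 1"
        by (simp add: circle_exp_to_circle z_def)
      then have "of_int v / real N \<in> \<int>" by (simp add: circle_exp_eq_1_iff to_circle_eq_0_iff)
      then obtain k where "of_int v / real N = of_int k" by (auto elim: Ints_cases)
      then have "of_int v = (of_int (k * int N) :: real)" using assms by (simp add: field_simps)
      then have "v = k * int N" by linarith
      then show False using False by simp
    qed
    moreover have "z ^ N = 1" using assms by (simp add: z_def Complex.DeMoivre)
    ultimately show ?thesis using False sum_gp_strict[of z N] by (simp add: pow)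
  qed
qed

lemma cyc_char_orthogonality:
  assumes "finite \<Phi>" "N > 0"
  shows "(\<Sum>j\<in>PiE \<Phi> (\<lambda>_. {..<N}). cyc_char \<Phi> N j v)
           = (if \<forall>g\<in>\<Phi>. int N dvd v g then of_nat (N ^ card \<Phi>) else 0)"
proof -
  have "cyc_char \<Phi> N j v = (\<Prod>g\<in>\<Phi>. cis (2 * pi * (real (j g) * of_int (v g)) / real N))" for j
    unfolding cyc_char_def cis_sum[symmetric] by (simp add: sum_distrib_left sum_divide_distrib)
  then have "(\<Sum>j\<in>PiE \<Phi> (\<lambda>_. {..<N}). cyc_char \<Phi> N j v)
      = (\<Prod>g\<in>\<Phi>. \<Sum>k<N. cis (2 * pi * (real k * of_int (v g)) / real N))"
    using assms(1) by (simp add: prod_sum_PiE)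
  also have "\<dots> = (\<Prod>g\<in>\<Phi>. if int N dvd v g then of_nat N else 0)"
    by (intro prod.cong refl sum_roots_of_unity assms)
  also have "\<dots> = (if \<forall>g\<in>\<Phi>. int N dvd v g then of_nat (N ^ card \<Phi>) else 0)"
  proof (cases "\<forall>g\<in>\<Phi>. int N dvd v g")
    case False
    then show ?thesis using assms(1) by (auto intro!: prod_zero)
  qed simp
  finally show ?thesis .
qed

text \<open>Let \<open>H j\<close> be the Fourier coefficient of \<open>F\<close> at \<open>j\<close>. Expanding \<open>(\<Sum>j. \<bar>H j\<bar>\<^sup>4 u j)\<close>, where \<open>u\<close> is
evaluation at the unit vector of \<open>g0\<close>, leads to a sum over quadruples in the support of \<open>F\<close> which the last
hypothesis declares empty, so the sum vanishes. The trivial character contributes a large positive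
term, and by Parseval's identity the small coefficients cannot compensate for it. Some large coefficient must
therefore carry a negative \<open>Re (u j)\<close>. The lower bound for that coefficient depends on the mean \<open>c\<close> alone, not
on \<open>\<Phi>\<close> or \<open>N\<close>: this is what allows passing to the limit over \<open>\<Phi>\<close> later.\<close>

lemma bogolyubov:
  fixes F :: "('i \<Rightarrow> nat) \<Rightarrow> real" and \<Phi> :: "'i set" and N :: nat
  defines "Q \<equiv> PiE \<Phi> (\<lambda>_. {..<N})"
  assumes fin: "finite \<Phi>" and N: "N > 0" and g0: "g0 \<in> \<Phi>"
    and F01: "\<And>n. n \<in> Q \<Longrightarrow> 0 \<le> F n \<and> F n \<le> 1"
    and c: "c > 0" and mean: "c * real (card Q) \<le> (\<Sum>n\<in>Q. F n)"
    and quad: "\<And>a b a' b'. \<lbrakk>a \<in> Q; b \<in> Q; a' \<in> Q; b' \<in> Q; F a \<noteq> 0; F b \<noteq> 0; F a' \<noteq> 0; F b' \<noteq> 0;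
      \<And>g. g \<in> \<Phi> \<Longrightarrow> int N dvd int (a g) - int (b g) + (int (a' g) - int (b' g)) + (if g = g0 then 1 else 0)\<rbrakk> \<Longrightarrow> False"
  shows "\<exists>j\<in>Q. c^2 / 2 \<le> norm ((\<Sum>n\<in>Q. of_real (F n) * cnj (cyc_char \<Phi> N j (\<lambda>g. int (n g)))) / of_nat (card Q))
            \<and> Re (cis (2 * pi * real (j g0) / real N)) < 0"
proof (rule ccontr)
  define H where "H j = (\<Sum>n\<in>Q. of_real (F n) * cyc_char \<Phi> N j (\<lambda>g. int (n g)))" for j
  define q where "q = real (card Q)"
  have finQ: "finite Q" unfolding Q_def by (intro finite_PiE fin) auto
  have cardQ: "card Q = N ^ card \<Phi>" unfolding Q_def by (simp add: card_PiE fin)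
  then have q: "q > 0" using N by (simp add: q_def)
  define d where "d p g = int (fst p g) - int (snd p g)" for p :: "('i \<Rightarrow> nat) \<times> ('i \<Rightarrow> nat)" and g
  define W where "W p = F (fst p) * F (snd p)" for p
  have sq: "complex_of_real ((norm (H j))\<^sup>2) = (\<Sum>p\<in>Q\<times>Q. of_real (W p) * cyc_char \<Phi> N j (d p))" for j
  proof -
    have "complex_of_real ((norm (H j))\<^sup>2) = H j * cnj (H j)"
      by (simp only: complex_norm_square)
    also have "\<dots> = (\<Sum>a\<in>Q. \<Sum>b\<in>Q. of_real (F a) * cyc_char \<Phi> N j (\<lambda>g. int (a g)) * cnj (of_real (F b) * cyc_char \<Phi> N j (\<lambda>g. int (b g))))"
      by (simp add: H_def sum_product)
    also have "\<dots> = (\<Sum>p\<in>Q\<times>Q. of_real (W p) * cyc_char \<Phi> N j (d p))"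
      unfolding sum.cartesian_product
      by (rule sum.cong) (auto simp: W_def d_def[abs_def] cyc_char_diff)
    finally show ?thesis .
  qed
  have W0: "0 \<le> W p" "W p \<le> 1" if "p \<in> Q \<times> Q" for p
    using that F01 by (auto simp: W_def intro: mult_le_one)
  have parseval: "(\<Sum>j\<in>Q. (norm (H j))\<^sup>2) \<le> q ^ 2"
  proof -
    have "complex_of_real (\<Sum>j\<in>Q. (norm (H j))\<^sup>2) = (\<Sum>j\<in>Q. \<Sum>p\<in>Q\<times>Q. of_real (W p) * cyc_char \<Phi> N j (d p))"
      by (simp only: of_real_sum sq)
    also have "\<dots> = (\<Sum>p\<in>Q\<times>Q. of_real (W p) * (\<Sum>j\<in>Q. cyc_char \<Phi> N j (d p)))"
      by (subst sum.swap) (simp add: sum_distrib_left)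
    also have "\<dots> = (\<Sum>p\<in>Q\<times>Q. if fst p = snd p then of_real (W p * q) else 0)"
    proof (rule sum.cong)
      fix p assume p: "p \<in> Q \<times> Q"
      have "(\<forall>g\<in>\<Phi>. int N dvd d p g) \<longleftrightarrow> fst p = snd p"
      proof
        assume *: "\<forall>g\<in>\<Phi>. int N dvd d p g"
        have "fst p g = snd p g" if "g \<in> \<Phi>" for g
        proof -
          have "fst p g < N" "snd p g < N" using p that by (auto simp: Q_def PiE_def Pi_def)
          then have "\<bar>d p g\<bar> < int N" by (auto simp: d_def)
          then have "d p g = 0" using * that zdvd_not_zless[of "\<bar>d p g\<bar>" "int N"] by fastforce
          then show ?thesis by (simp add: d_def)
        qed
        moreover have "fst p \<in> PiE \<Phi> (\<lambda>_. {..<N})" "snd p \<in> PiE \<Phi> (\<lambda>_. {..<N})"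
          using p by (simp_all add: Q_def mem_Times_iff)
        ultimately show "fst p = snd p" by (metis PiE_ext)
      qed (simp add: d_def)
      then show "of_real (W p) * (\<Sum>j\<in>Q. cyc_char \<Phi> N j (d p)) = (if fst p = snd p then of_real (W p * q) else 0)"
        unfolding Q_def cyc_char_orthogonality[OF fin N] by (simp add: q_def cardQ)
    qed simp
    also have "\<dots> = (\<Sum>a\<in>Q. \<Sum>b\<in>Q. if a = b then of_real (W (a, b) * q) else 0)"
      unfolding sum.cartesian_product by (rule sum.cong) auto
    also have "\<dots> = (\<Sum>a\<in>Q. of_real (W (a, a) * q))"
      by (intro sum.cong refl) (simp add: finQ)
    finally have "(\<Sum>j\<in>Q. (norm (H j))\<^sup>2) = (\<Sum>a\<in>Q. W (a, a) * q)"
      by (simp only: of_real_sum[symmetric] of_real_eq_iff)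
    also have "\<dots> \<le> (\<Sum>a\<in>Q. q)"
      using W0 q by (intro sum_mono) (auto intro: mult_left_le_one_le)
    also have "\<dots> = q ^ 2" by (simp add: q_def power2_eq_square)
    finally show ?thesis .
  qed
  define e where "e g = (if g = g0 then 1 else 0 :: int)" for g
  define u where "u j = cis (2 * pi * real (j g0) / real N)" for j :: "'i \<Rightarrow> nat"
  have u: "u j = cyc_char \<Phi> N j e" for j
    using cyc_char_unit[OF fin g0, of N j 1] by (simp add: u_def e_def[abs_def])
  have fourth: "(\<Sum>j\<in>Q. norm (H j) ^ 4 * Re (u j)) = 0"
  proof -
    have "complex_of_real (norm (H j) ^ 4) * u j
        = (\<Sum>p\<in>Q\<times>Q. \<Sum>p'\<in>Q\<times>Q. of_real (W p * W p') * cyc_char \<Phi> N j (\<lambda>g. d p g + d p' g + e g))" for j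
    proof -
      have "complex_of_real (norm (H j) ^ 4) = complex_of_real ((norm (H j))\<^sup>2) * complex_of_real ((norm (H j))\<^sup>2)"
        by (simp add: power4_eq_xxxx power2_eq_square)
      also have "\<dots> = (\<Sum>p\<in>Q\<times>Q. \<Sum>p'\<in>Q\<times>Q. of_real (W p) * cyc_char \<Phi> N j (d p) * (of_real (W p') * cyc_char \<Phi> N j (d p')))"
        unfolding sq sum_product ..
      finally show ?thesis
        by (simp add: u cyc_char_add sum_distrib_right sum_distrib_left mult_ac)
    qed
    then have "(\<Sum>j\<in>Q. complex_of_real (norm (H j) ^ 4) * u j)
        = (\<Sum>j\<in>Q. \<Sum>p\<in>Q\<times>Q. \<Sum>p'\<in>Q\<times>Q. of_real (W p * W p') * cyc_char \<Phi> N j (\<lambda>g. d p g + d p' g + e g))"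
      by simp
    also have "\<dots> = (\<Sum>p\<in>Q\<times>Q. \<Sum>p'\<in>Q\<times>Q. of_real (W p * W p') * (\<Sum>j\<in>Q. cyc_char \<Phi> N j (\<lambda>g. d p g + d p' g + e g)))"
      by (subst sum.swap, rule sum.cong[OF refl], subst sum.swap) (simp add: sum_distrib_left)
    also have "\<dots> = 0"
    proof (intro sum.neutral ballI)
      fix p p' assume p: "p \<in> Q \<times> Q" "p' \<in> Q \<times> Q"
      show "of_real (W p * W p') * (\<Sum>j\<in>Q. cyc_char \<Phi> N j (\<lambda>g. d p g + d p' g + e g)) = 0"
      proof (cases "W p * W p' = 0")
        case False
        then have nz: "F (fst p) \<noteq> 0" "F (snd p) \<noteq> 0" "F (fst p') \<noteq> 0" "F (snd p') \<noteq> 0"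
          by (auto simp: W_def)
        have "\<not> (\<forall>g\<in>\<Phi>. int N dvd d p g + d p' g + e g)"
        proof
          assume "\<forall>g\<in>\<Phi>. int N dvd d p g + d p' g + e g"
          with p nz show False
            by (intro quad[of "fst p" "snd p" "fst p'" "snd p'"]) (auto simp: d_def e_def mem_Times_iff)
        qed
        then show ?thesis unfolding Q_def cyc_char_orthogonality[OF fin N] by auto
      qed simp
    qed
    finally have "Re (\<Sum>j\<in>Q. complex_of_real (norm (H j) ^ 4) * u j) = 0" by simp
    then show ?thesis by (simp add: Re_sum)
  qed
  assume contra: "\<not> ?thesis"
  have Hcnj: "norm ((\<Sum>n\<in>Q. of_real (F n) * cnj (cyc_char \<Phi> N j (\<lambda>g. int (n g)))) / of_nat (card Q)) = norm (H j) / q" for j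
  proof -
    have "(\<Sum>n\<in>Q. of_real (F n) * cnj (cyc_char \<Phi> N j (\<lambda>g. int (n g)))) = cnj (H j)" by (simp add: H_def)
    then show ?thesis by (simp add: norm_divide q_def)
  qed
  define z where "z = restrict (\<lambda>_. 0 :: nat) \<Phi>"
  have z: "z \<in> Q" using N by (auto simp: z_def Q_def)
  have Hz: "c * q \<le> norm (H z)"
  proof -
    have "cyc_char \<Phi> N z v = 1" for v by (simp add: cyc_char_def z_def)
    then have "H z = of_real (\<Sum>n\<in>Q. F n)" by (simp add: H_def)
    moreover have "c * q \<le> (\<Sum>n\<in>Q. F n)" using mean by (simp add: q_def)
    ultimately show ?thesis using abs_ge_self[of "\<Sum>n\<in>Q. F n"] by (simp only: norm_of_real)
  qed
  \<comment> \<open>The threshold between small and large coefficients.\<close>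
  define k where "k = c^2 * q / 2"
  have k: "k > 0" using c q by (simp add: k_def)
  have ge: "- (k\<^sup>2 * (norm (H j))\<^sup>2) \<le> norm (H j) ^ 4 * Re (u j)" if "j \<in> Q" for j
  proof (cases "norm (H j) < k")
    case True
    have "(norm (H j))\<^sup>2 \<le> k\<^sup>2" using True k by (intro power_mono) auto
    then have "(norm (H j))\<^sup>2 * (norm (H j))\<^sup>2 \<le> k\<^sup>2 * (norm (H j))\<^sup>2" by (intro mult_right_mono) auto
    moreover have "norm (H j) ^ 4 * Re (u j) \<ge> norm (H j) ^ 4 * (-1)"
      by (intro mult_left_mono) (auto simp: u_def)
    ultimately show ?thesis by (simp add: power4_eq_xxxx power2_eq_square mult_ac)
  next
    case False
    then have "c^2 / 2 \<le> norm (H j) / q" using q by (simp add: k_def field_simps)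
    then have "0 \<le> Re (u j)" using contra that unfolding Hcnj u_def by (meson not_le)
    then have "0 \<le> norm (H j) ^ 4 * Re (u j)" by simp
    moreover have "0 \<le> k\<^sup>2 * (norm (H j))\<^sup>2" by simp
    ultimately show ?thesis by linarith
  qed
  have "u z = 1" by (simp add: u_def z_def g0)
  then have "0 = norm (H z) ^ 4 + (\<Sum>j\<in>Q - {z}. norm (H j) ^ 4 * Re (u j))"
    using fourth sum.remove[OF finQ z, of "\<lambda>j. norm (H j) ^ 4 * Re (u j)"] by simp
  moreover have "(\<Sum>j\<in>Q - {z}. - (k\<^sup>2 * (norm (H j))\<^sup>2)) \<le> (\<Sum>j\<in>Q - {z}. norm (H j) ^ 4 * Re (u j))"
    by (intro sum_mono ge) auto
  moreover have "(\<Sum>j\<in>Q - {z}. - (k\<^sup>2 * (norm (H j))\<^sup>2)) = - (k\<^sup>2 * (\<Sum>j\<in>Q - {z}. (norm (H j))\<^sup>2))"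
    by (simp add: sum_negf sum_distrib_left)
  ultimately have "norm (H z) ^ 4 \<le> k\<^sup>2 * (\<Sum>j\<in>Q - {z}. (norm (H j))\<^sup>2)" by linarith
  also have "\<dots> \<le> k\<^sup>2 * (\<Sum>j\<in>Q. (norm (H j))\<^sup>2)"
    by (intro mult_left_mono sum_mono2 finQ) auto
  also have "\<dots> \<le> k\<^sup>2 * q ^ 2" using parseval by (intro mult_left_mono) auto
  also have "\<dots> = (c * q) ^ 4 / 4" by (simp add: k_def power2_eq_square power4_eq_xxxx)
  also have "\<dots> < (c * q) ^ 4" using c q by simp
  also have "\<dots> \<le> norm (H z) ^ 4" using Hz c q by (intro power_mono) auto
  finally have "norm (H z) ^ 4 < norm (H z) ^ 4" .
  then show False by simp
qed

text \<open>A compact group topology enters the construction of characters only through such a seminorm. The character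
obtained is dominated by the seminorm, which makes it continuous.\<close>

locale tb_seminorm =
  fixes \<nu> :: "'g::ab_group_add \<Rightarrow> real"
  assumes zero: "\<nu> 0 = 0" and minus: "\<nu> (- x) = \<nu> x" and add: "\<nu> (x + y) \<le> \<nu> x + \<nu> y"
    and totally_bounded: "\<epsilon> > 0 \<Longrightarrow> \<exists>C. finite C \<and> (\<forall>x. \<exists>c\<in>C. \<nu> (x - c) < \<epsilon>)"
begin

lemma nonneg: "0 \<le> \<nu> x"
  using add[of x "- x"] by (simp add: minus zero)

lemma diff: "\<nu> (x - y) \<le> \<nu> x + \<nu> y"
  using add[of x "- y"] by (simp add: minus)

lemma sum: "\<nu> (\<Sum>i\<in>A. f i) \<le> (\<Sum>i\<in>A. \<nu> (f i))"
proof (induction A rule: infinite_finite_induct)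
  case (insert x F)
  then show ?case using add[of "f x" "sum f F"] by simp
qed (simp_all add: zero)

text \<open>Total boundedness and the pigeonhole principle: two multiples of all the \<open>g\<close> fall into the same
small sets simultaneously.\<close>

lemma common_period:
  assumes "finite \<Phi>" "\<tau> > 0"
  obtains N :: nat where "N > 0" "\<And>g. g \<in> \<Phi> \<Longrightarrow> \<nu> (zmul (int N) g) \<le> \<tau>"
proof -
  obtain C where C: "finite C" "\<And>x. \<exists>c\<in>C. \<nu> (x - c) < \<tau> / 2"
    using totally_bounded[of "\<tau> / 2"] assms(2) by auto
  obtain c where c: "c x \<in> C" "\<nu> (x - c x) < \<tau> / 2" for x
    using C(2) by metis
  define \<kappa> where "\<kappa> n = restrict (\<lambda>g. c (zmul (int n) g)) \<Phi>" for n :: nat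
  have "range \<kappa> \<subseteq> PiE \<Phi> (\<lambda>_. C)" using c(1) by (auto simp: \<kappa>_def)
  then have "finite (range \<kappa>)" using finite_PiE[OF assms(1)] C(1) by (meson finite_subset)
  then have "\<not> inj \<kappa>" using finite_imageD infinite_UNIV_nat by blast
  then obtain m n where mn: "m < n" "\<kappa> m = \<kappa> n"
    by (metis injI linorder_neqE_nat)
  show ?thesis
  proof
    show "n - m > 0" using mn by simp
    fix g assume "g \<in> \<Phi>"
    then have "c (zmul (int m) g) = c (zmul (int n) g)"
      using mn(2) by (metis \<kappa>_def restrict_apply')
    then have "zmul (int (n - m)) g
        = (zmul (int n) g - c (zmul (int n) g)) - (zmul (int m) g - c (zmul (int m) g))"
      using mn(1) by (simp add: zmul_diff_left of_nat_diff)
    then show "\<nu> (zmul (int (n - m)) g) \<le> \<tau>"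
      using diff[of "zmul (int n) g - c (zmul (int n) g)" "zmul (int m) g - c (zmul (int m) g)"]
        c(2)[of "zmul (int n) g"] c(2)[of "zmul (int m) g"] by simp
  qed
qed

text \<open>The group \<open>Q = (\<int>/N)\<^sup>\<Phi>\<close> maps to the given group by \<open>p n = (\<Sum>g\<in>\<Phi>. n g \<cdot> g)\<close>. As all \<open>N g\<close> are small, this is
nearly a homomorphism, although its coordinates wrap around modulo \<open>N\<close>. Let \<open>F\<close> be the pullback of a bump
function \<open>f\<close> at zero. Its mean is bounded below because finitely many translates of the bump cover the
group, and a quadruple as in \<open>bogolyubov\<close> would put \<open>x0\<close> close to zero. The resulting coefficient \<open>A F\<close> is
bounded away from zero, and a shift of \<open>F\<close> by \<open>x\<close> multiplies it by \<open>circle_exp (\<theta> x)\<close>. Hence \<open>\<theta>\<close> inherits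
approximate additivity and approximate continuity from \<open>f\<close>.\<close>

lemma approximate_character:
  assumes C: "finite C" "\<And>x. \<exists>c\<in>C. \<nu> (x - c) < 1/16"
    and \<Phi>: "finite \<Phi>" "uminus ` C \<subseteq> \<Phi>" "x0 \<in> \<Phi>" and x0: "\<nu> x0 \<ge> 1" and "\<epsilon> > 0"
  obtains \<theta> :: "'g \<Rightarrow> circle" where
    "\<And>x. x \<in> \<Phi> \<Longrightarrow> norm (circle_exp (\<theta> x) - 1) \<le> 256 * real (card C)^2 * \<nu> x + \<epsilon>"
    "\<And>x y. \<lbrakk>x \<in> \<Phi>; y \<in> \<Phi>; x + y \<in> \<Phi>\<rbrakk> \<Longrightarrow>
       norm (circle_exp (\<theta> x + \<theta> y) - circle_exp (\<theta> (x + y))) \<le> \<epsilon>"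
    "Re (circle_exp (\<theta> x0)) \<le> 0"
proof -
  define k where "k = real (card C)"
  have "C \<noteq> {}" using C(2) by blast
  then have k: "k \<ge> 1" using C(1) by (simp add: k_def card_gt_0_iff Suc_le_eq)
  define c where "c = 1 / (4 * k)"
  have c: "c > 0" using k by (simp add: c_def)
  \<comment> \<open>The slope 8 keeps four points of the support within total distance 1/2, which is less than \<open>\<nu> x0\<close>.\<close>
  define f where "f x = max 0 (1 - 8 * \<nu> x)" for x
  have f01: "0 \<le> f x" "f x \<le> 1" for x using nonneg[of x] by (auto simp: f_def)
  have f_lip: "\<bar>f x - f y\<bar> \<le> 8 * \<nu> (x - y)" for x y
  proof -
    have "\<nu> x \<le> \<nu> (x - y) + \<nu> y" using add[of "x - y" y] by simp
    moreover have "\<nu> y \<le> \<nu> (x - y) + \<nu> x" using diff[of x "x - y"] by simp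
    ultimately show ?thesis unfolding f_def by linarith
  qed
  have f_pos: "f x \<noteq> 0 \<Longrightarrow> \<nu> x < 1/8" for x by (auto simp: f_def)
  \<comment> \<open>The three bounds serve the mean of \<open>F\<close>, the wrap-around in quadruples, and the final error \<open>\<epsilon>\<close>.\<close>
  define \<tau> where "\<tau> = min (1 / (32 * k)) (min (1 / (4 * real (card \<Phi>) + 4)) (\<epsilon> * (c^2 / 2) / 24))"
  have \<tau>: "\<tau> > 0" using k c \<open>\<epsilon> > 0\<close> by (simp add: \<tau>_def)
  have "\<tau> \<le> 1 / (32 * k)" "\<tau> \<le> \<epsilon> * (c^2 / 2) / 24" by (simp_all add: \<tau>_def)
  then have \<tau>1: "8 * \<tau> \<le> 1 / (4 * k)" "24 * \<tau> \<le> \<epsilon> * (c^2 / 2)" by simp_all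
  have \<tau>2: "real (card \<Phi>) * \<tau> < 1/2"
  proof -
    have "real (card \<Phi>) * \<tau> \<le> real (card \<Phi>) * (1 / (4 * real (card \<Phi>) + 4))"
      by (intro mult_left_mono) (auto simp: \<tau>_def)
    also have "\<dots> < 1/2" by (simp add: field_simps)
    finally show ?thesis .
  qed
  obtain N :: nat where N: "N > 0" "\<And>g. g \<in> \<Phi> \<Longrightarrow> \<nu> (zmul (int N) g) \<le> \<tau>"
    using common_period[OF \<Phi>(1) \<tau>] by blast
  define Q where "Q = PiE \<Phi> (\<lambda>_. {..<N})"
  define p where "p n = (\<Sum>g\<in>\<Phi>. zmul (int (n g)) g)" for n :: "'g \<Rightarrow> nat"
  define F where "F n = f (p n)" for n
  define sh where "sh g n = n(g := (n g + 1) mod N)" for g and n :: "'g \<Rightarrow> nat"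
  have finQ: "finite Q" unfolding Q_def by (intro finite_PiE \<Phi>) auto
  have "Q \<noteq> {}" using N(1) by (auto simp: Q_def PiE_eq_empty_iff)
  then have cardQ: "card Q > 0" using finQ by (simp add: card_gt_0_iff)
  have sh_Q: "sh g n \<in> Q" if "g \<in> \<Phi>" "n \<in> Q" for g n
    using that N(1) unfolding Q_def sh_def by (auto simp: PiE_iff extensional_def)
  have sh_inj: "inj_on (sh g) Q" if "g \<in> \<Phi>" for g
  proof (rule inj_onI)
    fix m n assume mn: "m \<in> Q" "n \<in> Q" "sh g m = sh g n"
    have lt: "m g < N" "n g < N" using mn that by (auto simp: Q_def)
    have "(m g + 1) mod N = (n g + 1) mod N" using mn(3) by (metis fun_upd_same sh_def)
    then have "m g = n g" using lt by (metis Suc_eq_plus1 mod_Suc mod_less nat.inject nat.distinct(1))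
    moreover have "m h = n h" if "h \<noteq> g" for h using mn(3) that by (metis fun_upd_other sh_def)
    ultimately show "m = n" by (intro ext) metis
  qed
  have sh_bij: "bij_betw (sh g) Q Q" if "g \<in> \<Phi>" for g
    unfolding bij_betw_def using sh_inj[OF that] sh_Q[OF that] endo_inj_surj[OF finQ, of "sh g"]
    by blast
  have p_sh: "p (sh g n) = p n + g - (if n g + 1 = N then zmul (int N) g else 0)"
    if g: "g \<in> \<Phi>" and n: "n \<in> Q" for g n
  proof -
    have "p m = zmul (int (m g)) g + (\<Sum>h\<in>\<Phi> - {g}. zmul (int (m h)) h)" for m
      unfolding p_def using sum.remove[OF \<Phi>(1) g] by blast
    moreover have "(\<Sum>h\<in>\<Phi> - {g}. zmul (int (sh g n h)) h) = (\<Sum>h\<in>\<Phi> - {g}. zmul (int (n h)) h)"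
      by (intro sum.cong) (auto simp: sh_def)
    moreover have "zmul (int (sh g n g)) g = zmul (int (n g)) g + g - (if n g + 1 = N then zmul (int N) g else 0)"
    proof (cases "n g + 1 = N")
      case True
      then have "sh g n g = 0" by (simp add: sh_def)
      moreover have "zmul (int N) g = zmul (int (n g)) g + g" using zmul_add1[of "int (n g)" g] True by (metis of_nat_1 of_nat_add)
      ultimately show ?thesis using True by simp
    next
      case False
      moreover have "n g < N" using n g by (auto simp: Q_def)
      ultimately have "sh g n g = n g + 1" by (simp add: sh_def)
      then show ?thesis using False zmul_add1[of "int (n g)" g] by (simp add: add.commute)
    qed
    ultimately show ?thesis by (simp add: algebra_simps)
  qed
  have F_sh: "\<bar>F (sh g n) - f (p n + g)\<bar> \<le> 8 * \<tau>" if "g \<in> \<Phi>" "n \<in> Q" for g n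
  proof -
    have "\<nu> (p (sh g n) - (p n + g)) \<le> \<tau>"
      using N(2)[OF that(1)] \<tau> by (simp add: p_sh[OF that] minus zero)
    then show ?thesis unfolding F_def using f_lip[of "p (sh g n)" "p n + g"] by linarith
  qed
  have mean: "c * real (card Q) \<le> (\<Sum>n\<in>Q. F n)"
  proof -
    have "1/2 - 8 * \<tau> \<le> (\<Sum>a\<in>C. F (sh (- a) n))" if n: "n \<in> Q" for n
    proof -
      obtain a where a: "a \<in> C" "\<nu> (p n - a) < 1/16" using C(2) by blast
      then have "1/2 \<le> f (p n - a)" by (simp add: f_def)
      moreover have "\<bar>F (sh (- a) n) - f (p n + - a)\<bar> \<le> 8 * \<tau>"
        using a n \<Phi>(2) by (intro F_sh) auto
      ultimately have "1/2 - 8 * \<tau> \<le> F (sh (- a) n)" by simp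
      also have "\<dots> \<le> (\<Sum>a\<in>C. F (sh (- a) n))"
        by (rule member_le_sum) (use a C(1) f01 in \<open>auto simp: F_def\<close>)
      finally show ?thesis .
    qed
    then have "(\<Sum>n\<in>Q. 1/2 - 8 * \<tau>) \<le> (\<Sum>n\<in>Q. \<Sum>a\<in>C. F (sh (- a) n))" by (intro sum_mono)
    also have "\<dots> = (\<Sum>a\<in>C. \<Sum>n\<in>Q. F (sh (- a) n))" by (rule sum.swap)
    also have "\<dots> = (\<Sum>a\<in>C. \<Sum>n\<in>Q. F n)"
    proof (rule sum.cong[OF refl])
      fix a assume "a \<in> C"
      then have "- a \<in> \<Phi>" using \<Phi>(2) by auto
      from sum.reindex_bij_betw[OF sh_bij[OF this], of F]
      show "(\<Sum>n\<in>Q. F (sh (- a) n)) = (\<Sum>n\<in>Q. F n)" .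
    qed
    finally have "real (card Q) * (1/2 - 8 * \<tau>) \<le> k * (\<Sum>n\<in>Q. F n)" by (simp add: k_def)
    moreover have "real (card Q) * (1/4) \<le> real (card Q) * (1/2 - 8 * \<tau>)"
    proof (rule mult_left_mono)
      have "1 / (4 * k) \<le> 1/4" using k by (simp add: field_simps)
      then show "1/4 \<le> 1/2 - 8 * \<tau>" using \<tau>1(1) by linarith
    qed simp
    ultimately show ?thesis using k by (simp add: c_def field_simps)
  qed
  have quad: False
    if Q: "a \<in> Q" "b \<in> Q" "a' \<in> Q" "b' \<in> Q" and nz: "F a \<noteq> 0" "F b \<noteq> 0" "F a' \<noteq> 0" "F b' \<noteq> 0"
      and dvd: "\<And>g. g \<in> \<Phi> \<Longrightarrow> int N dvd int (a g) - int (b g) + (int (a' g) - int (b' g)) + (if g = x0 then 1 else 0)"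
    for a b a' b'
  proof -
    define v where "v g = int (a g) - int (b g) + (int (a' g) - int (b' g)) + (if g = x0 then 1 else 0)" for g
    have "(\<Sum>g\<in>\<Phi>. zmul (v g) g) = p a - p b + (p a' - p b') + (\<Sum>g\<in>\<Phi>. zmul (if g = x0 then 1 else 0) g)"
      unfolding v_def p_def by (simp add: zmul_distrib_left zmul_diff_left sum.distrib sum_subtractf)
    also have "(\<Sum>g\<in>\<Phi>. zmul (if g = x0 then 1 else 0) g) = (\<Sum>g\<in>\<Phi>. if g = x0 then x0 else 0)"
      by (rule sum.cong) auto
    also have "\<dots> = x0" using \<Phi> by simp
    finally have eq: "x0 = (\<Sum>g\<in>\<Phi>. zmul (v g) g) - (p a - p b + (p a' - p b'))" by simp
    have small: "\<nu> (zmul (v g) g) \<le> \<tau>" if g: "g \<in> \<Phi>" for g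
    proof -
      have lt: "a g < N" "b g < N" "a' g < N" "b' g < N" using Q g by (auto simp: Q_def)
      obtain w where w: "v g = int N * w" using dvd[OF g] by (auto simp: v_def dvd_def)
      have "int N * w < int N * 2" "int N * (-2) < int N * w" using lt unfolding w[symmetric] by (auto simp: v_def)
      then have "w < 2" "w > -2" using N(1) by (simp_all only: mult_less_cancel_left_pos of_nat_0_less_iff)
      \<comment> \<open>Each coordinate wraps around at most once.\<close>
      then have "w = -1 \<or> w = 0 \<or> w = 1" by linarith
      moreover have "zmul (v g) g = zmul w (zmul (int N) g)" unfolding w by (simp add: zmul_mult[symmetric] mult.commute)
      ultimately show ?thesis using N(2)[OF g] \<tau> by (auto simp: zero minus zmul_minus_left)
    qed
    have "\<nu> (\<Sum>g\<in>\<Phi>. zmul (v g) g) \<le> (\<Sum>g\<in>\<Phi>. \<tau>)"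
      by (rule order_trans[OF sum]) (intro sum_mono small)
    then have "\<nu> (\<Sum>g\<in>\<Phi>. zmul (v g) g) < 1/2" using \<tau>2 by simp
    moreover have "\<nu> (p a - p b + (p a' - p b')) \<le> 1/2"
      using add[of "p a - p b" "p a' - p b'"] diff[of "p a" "p b"] diff[of "p a'" "p b'"]
        nz[unfolded F_def, THEN f_pos] by linarith
    ultimately have "\<nu> x0 < 1" unfolding eq
      using diff[of "\<Sum>g\<in>\<Phi>. zmul (v g) g" "p a - p b + (p a' - p b')"] by linarith
    then show False using x0 by simp
  qed
  have F01: "0 \<le> F n \<and> F n \<le> 1" for n using f01 by (simp add: F_def)
  obtain j where j: "j \<in> Q"
    "c^2 / 2 \<le> norm ((\<Sum>n\<in>Q. of_real (F n) * cnj (cyc_char \<Phi> N j (\<lambda>g. int (n g)))) / of_nat (card Q))"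
    "Re (cis (2 * pi * real (j x0) / real N)) < 0"
    using bogolyubov[OF \<Phi>(1) N(1) \<Phi>(3), of F c, folded Q_def] F01 c mean quad by blast
  define \<psi> where "\<psi> n = cyc_char \<Phi> N j (\<lambda>g. int (n g))" for n
  define A where "A h = (\<Sum>n\<in>Q. of_real (h n) * cnj (\<psi> n)) / of_nat (card Q)" for h :: "('g \<Rightarrow> nat) \<Rightarrow> real"
  have A_diff: "norm (A h - A h') \<le> e" if "\<And>n. n \<in> Q \<Longrightarrow> \<bar>h n - h' n\<bar> \<le> e" for h h' e
  proof -
    have eq: "A h - A h' = (\<Sum>n\<in>Q. of_real (h n - h' n) * cnj (\<psi> n)) / of_nat (card Q)"
      by (simp add: A_def diff_divide_distrib[symmetric] sum_subtractf[symmetric] left_diff_distrib)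
    have bd: "norm (\<Sum>n\<in>Q. of_real (h n - h' n) * cnj (\<psi> n)) \<le> (\<Sum>n\<in>Q. e)"
      using that by (intro order_trans[OF norm_sum] sum_mono)
        (auto simp: norm_mult \<psi>_def simp del: of_real_diff)
    show ?thesis unfolding eq using bd cardQ
      by (simp add: norm_divide divide_le_eq mult.commute del: of_real_diff)
  qed
  define \<theta> where "\<theta> g = to_circle (real (j g) / real N)" for g
  have \<theta>: "circle_exp (\<theta> g) = cis (2 * pi * real (j g) / real N)" for g
    by (simp add: \<theta>_def circle_exp_to_circle)
  have \<psi>_sh: "\<psi> (sh g n) = circle_exp (\<theta> g) * \<psi> n" if g: "g \<in> \<Phi>" and n: "n \<in> Q" for g n
  proof -
    have lt: "n g < N" using g n by (auto simp: Q_def)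
    define w where "w = (if n g + 1 = N then int N else 0)"
    have "int (sh g n h) = int (n h) + (if h = g then 1 - w else 0)" for h
      using lt by (auto simp: sh_def w_def)
    then have "\<psi> (sh g n) = \<psi> n * cyc_char \<Phi> N j (\<lambda>h. if h = g then 1 - w else 0)"
      by (simp add: \<psi>_def cyc_char_add)
    also have "cyc_char \<Phi> N j (\<lambda>h. if h = g then 1 - w else 0) = cis (2 * pi * (real (j g) * of_int (1 - w)) / real N)"
      by (rule cyc_char_unit[OF \<Phi>(1) g])
    also have "2 * pi * (real (j g) * of_int (1 - w)) / real N
        = 2 * pi * real (j g) / real N - 2 * pi * of_int (if w = 0 then 0 else int (j g))"
      using N(1) by (auto simp: w_def field_simps)
    finally show ?thesis unfolding \<theta> cis_divide[symmetric] by simp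
  qed
  have A_sh: "A (\<lambda>n. h (sh g n)) = circle_exp (\<theta> g) * A h" if g: "g \<in> \<Phi>" for g h
  proof -
    have "(\<Sum>n\<in>Q. of_real (h (sh g n)) * cnj (\<psi> (sh g n))) = (\<Sum>n\<in>Q. of_real (h n) * cnj (\<psi> n))"
      using sum.reindex_bij_betw[OF sh_bij[OF g], of "\<lambda>n. of_real (h n) * cnj (\<psi> n)"] .
    moreover have "(\<Sum>n\<in>Q. of_real (h (sh g n)) * cnj (\<psi> (sh g n)))
        = cnj (circle_exp (\<theta> g)) * (\<Sum>n\<in>Q. of_real (h (sh g n)) * cnj (\<psi> n))"
      by (simp add: sum_distrib_left \<psi>_sh[OF g] mult_ac)
    ultimately have "A h = cnj (circle_exp (\<theta> g)) * A (\<lambda>n. h (sh g n))"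
      by (simp add: A_def)
    then have "circle_exp (\<theta> g) * A h = (circle_exp (\<theta> g) * cnj (circle_exp (\<theta> g))) * A (\<lambda>n. h (sh g n))"
      by (simp add: mult.assoc)
    then show ?thesis using complex_norm_square[of "circle_exp (\<theta> g)"] by simp
  qed
  have AF: "c^2 / 2 \<le> norm (A F)" using j(2) by (simp add: A_def \<psi>_def)
  \<comment> \<open>With the Lipschitz constant 8 of \<open>f\<close> this accounts for the factor 256.\<close>
  have c2: "c^2 / 2 = 1 / (32 * k^2)" using k by (simp add: c_def power2_eq_square)
  show ?thesis
  proof
    show "Re (circle_exp (\<theta> x0)) \<le> 0" using j(3) by (simp add: \<theta>)
  next
    fix x assume x: "x \<in> \<Phi>"
    have "norm (A (\<lambda>n. F (sh x n)) - A F) \<le> 8 * \<tau> + 8 * \<nu> x"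
    proof (rule A_diff)
      fix n assume "n \<in> Q"
      then show "\<bar>F (sh x n) - F n\<bar> \<le> 8 * \<tau> + 8 * \<nu> x"
        using F_sh[OF x, of n] f_lip[of "p n + x" "p n"] by (simp add: F_def)
    qed
    also have "A (\<lambda>n. F (sh x n)) - A F = (circle_exp (\<theta> x) - 1) * A F"
      by (simp add: A_sh[OF x] algebra_simps)
    finally have "norm (circle_exp (\<theta> x) - 1) * norm (A F) \<le> 8 * \<tau> + 8 * \<nu> x"
      by (simp add: norm_mult)
    then have "norm (circle_exp (\<theta> x) - 1) * (c^2 / 2) \<le> 8 * \<tau> + 8 * \<nu> x"
      using AF by (meson mult_left_mono norm_ge_zero order_trans)
    also have "\<dots> \<le> \<epsilon> * (c^2 / 2) + 8 * \<nu> x" using \<tau>1(2) \<tau> by linarith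
    also have "\<dots> = (256 * k^2 * \<nu> x + \<epsilon>) * (c^2 / 2)" using k unfolding c2 by (simp add: field_simps)
    finally show "norm (circle_exp (\<theta> x) - 1) \<le> 256 * real (card C)^2 * \<nu> x + \<epsilon>"
      using c by (simp add: k_def)
  next
    fix x y assume x: "x \<in> \<Phi>" and y: "y \<in> \<Phi>" and xy: "x + y \<in> \<Phi>"
    have "norm (A (\<lambda>n. F (sh x (sh y n))) - A (\<lambda>n. F (sh (x + y) n))) \<le> 24 * \<tau>"
    proof (rule A_diff)
      fix n assume n: "n \<in> Q"
      have "\<nu> (p (sh x (sh y n)) - p (sh (x + y) n)) \<le> 3 * \<tau>"
      proof -
        define u where "u g m = (if m g + 1 = N then zmul (int N) g else 0)" for g and m :: "'g \<Rightarrow> nat"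
        have u: "\<nu> (u g m) \<le> \<tau>" if "g \<in> \<Phi>" for g m
          using N(2)[OF that] \<tau> by (auto simp: u_def zero)
        have eq: "p (sh x (sh y n)) - p (sh (x + y) n) = u (x + y) n - (u x (sh y n) + u y n)"
          unfolding u_def by (simp add: p_sh[OF x sh_Q[OF y n]] p_sh[OF y n] p_sh[OF xy n] algebra_simps)
        show ?thesis unfolding eq
          using diff[of "u (x + y) n" "u x (sh y n) + u y n"] add[of "u x (sh y n)" "u y n"]
            u[OF xy, of n] u[OF x, of "sh y n"] u[OF y, of n] by linarith
      qed
      then show "\<bar>F (sh x (sh y n)) - F (sh (x + y) n)\<bar> \<le> 24 * \<tau>"
        unfolding F_def using f_lip[of "p (sh x (sh y n))" "p (sh (x + y) n)"] by linarith
    qed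
    also have "A (\<lambda>n. F (sh x (sh y n))) = circle_exp (\<theta> x + \<theta> y) * A F"
      using A_sh[OF y, of "\<lambda>n. F (sh x n)"] A_sh[OF x, of F] by (simp add: circle_exp_add mult_ac)
    also have "circle_exp (\<theta> x + \<theta> y) * A F - A (\<lambda>n. F (sh (x + y) n))
        = (circle_exp (\<theta> x + \<theta> y) - circle_exp (\<theta> (x + y))) * A F"
      by (simp add: A_sh[OF xy, of F] left_diff_distrib)
    finally have "norm (circle_exp (\<theta> x + \<theta> y) - circle_exp (\<theta> (x + y))) * norm (A F) \<le> 24 * \<tau>"
      by (simp add: norm_mult)
    then have "norm (circle_exp (\<theta> x + \<theta> y) - circle_exp (\<theta> (x + y))) * (c^2 / 2) \<le> 24 * \<tau>"
      using AF by (meson mult_left_mono norm_ge_zero order_trans)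
    also have "\<dots> \<le> \<epsilon> * (c^2 / 2)" by (rule \<tau>1(2))
    finally show "norm (circle_exp (\<theta> x + \<theta> y) - circle_exp (\<theta> (x + y))) \<le> \<epsilon>"
      using c by simp
  qed
qed

text \<open>The conditions on approximate characters are closed and directed, so Tychonoff's theorem yields a map
satisfying all of them at once; the errors \<open>\<epsilon>\<close> then disappear.\<close>

theorem separating_character:
  assumes "\<nu> x0 \<ge> 1"
  obtains \<psi> :: "'g \<Rightarrow> circle" and K where
    "additive_on UNIV \<psi>" "\<psi> x0 \<noteq> 0" "\<And>x. norm (circle_exp (\<psi> x) - 1) \<le> K * \<nu> x"
proof -
  obtain C where C: "finite C" "\<And>x. \<exists>c\<in>C. \<nu> (x - c) < 1/16"
    using totally_bounded[of "1/16"] by auto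
  define K where "K = 256 * real (card C)^2"
  define A where "A \<Phi> \<epsilon> = {\<theta> :: 'g \<Rightarrow> circle. (\<forall>x\<in>\<Phi>. norm (circle_exp (\<theta> x) - 1) \<le> K * \<nu> x + \<epsilon>)
    \<and> (\<forall>x\<in>\<Phi>. \<forall>y\<in>\<Phi>. x + y \<in> \<Phi> \<longrightarrow> norm (circle_exp (\<theta> x + \<theta> y) - circle_exp (\<theta> (x + y))) \<le> \<epsilon>)
    \<and> Re (circle_exp (\<theta> x0)) \<le> 0}" for \<Phi> \<epsilon>
  define I where "I = {(\<Phi> :: 'g set, \<epsilon> :: real). finite \<Phi> \<and> \<epsilon> > 0}"
  have ce: "continuous_on UNIV (\<lambda>\<theta> :: 'g \<Rightarrow> circle. circle_exp (h \<theta>))"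
    if "continuous_on UNIV h" for h
    using continuous_on_compose2[OF continuous_on_circle_exp that] by auto
  have closed: "closed (A \<Phi> \<epsilon>)" for \<Phi> \<epsilon>
    unfolding A_def Ball_def
    by (intro closed_Collect_conj closed_Collect_all closed_Collect_imp open_Collect_const closed_Collect_le
        continuous_intros ce continuous_on_product_coordinates)
  have mono: "A \<Phi>' \<epsilon>' \<subseteq> A \<Phi> \<epsilon>" if "\<Phi> \<subseteq> \<Phi>'" "\<epsilon>' \<le> \<epsilon>" for \<Phi> \<Phi>' \<epsilon> \<epsilon>'
  proof
    fix \<theta> assume \<theta>: "\<theta> \<in> A \<Phi>' \<epsilon>'"
    have "norm (circle_exp (\<theta> x) - 1) \<le> K * \<nu> x + \<epsilon>" if "x \<in> \<Phi>" for x
    proof -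
      have "norm (circle_exp (\<theta> x) - 1) \<le> K * \<nu> x + \<epsilon>'"
        using \<theta> that \<open>\<Phi> \<subseteq> \<Phi>'\<close> by (auto simp: A_def)
      then show ?thesis using \<open>\<epsilon>' \<le> \<epsilon>\<close> by linarith
    qed
    moreover have "norm (circle_exp (\<theta> x + \<theta> y) - circle_exp (\<theta> (x + y))) \<le> \<epsilon>"
      if "x \<in> \<Phi>" "y \<in> \<Phi>" "x + y \<in> \<Phi>" for x y
    proof -
      have "norm (circle_exp (\<theta> x + \<theta> y) - circle_exp (\<theta> (x + y))) \<le> \<epsilon>'"
        using \<theta> subsetD[OF \<open>\<Phi> \<subseteq> \<Phi>'\<close> that(1)] subsetD[OF \<open>\<Phi> \<subseteq> \<Phi>'\<close> that(2)]
          subsetD[OF \<open>\<Phi> \<subseteq> \<Phi>'\<close> that(3)] unfolding A_def by blast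
      then show ?thesis using \<open>\<epsilon>' \<le> \<epsilon>\<close> by linarith
    qed
    ultimately show "\<theta> \<in> A \<Phi> \<epsilon>" using \<theta> by (auto simp: A_def)
  qed
  have "UNIV \<inter> (\<Inter>i\<in>I. A (fst i) (snd i)) \<noteq> {}"
  proof (rule compact_imp_fip_image[OF compact_fun_circle])
    show "closed (A (fst i) (snd i))" for i by (rule closed)
    show "UNIV \<inter> (\<Inter>i\<in>I'. A (fst i) (snd i)) \<noteq> {}" if I': "finite I'" "I' \<subseteq> I" for I'
    proof -
      define \<Phi> where "\<Phi> = (\<Union>i\<in>I'. fst i) \<union> uminus ` C \<union> {x0}"
      define \<epsilon> where "\<epsilon> = Min (insert 1 (snd ` I'))"
      have "finite \<Phi>" "uminus ` C \<subseteq> \<Phi>" "x0 \<in> \<Phi>" using I' C(1) by (auto simp: \<Phi>_def I_def)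
      moreover have "\<epsilon> > 0" using I' by (auto simp: \<epsilon>_def I_def)
      ultimately have "\<exists>\<theta>. \<theta> \<in> A \<Phi> \<epsilon>"
        by (rule approximate_character[OF C _ _ _ assms]) (auto simp: A_def K_def)
      then obtain \<theta> where \<theta>: "\<theta> \<in> A \<Phi> \<epsilon>" by blast
      have *: "\<theta> \<in> A (fst i) (snd i)" if "i \<in> I'" for i
      proof (rule subsetD[OF mono \<theta>])
        show "fst i \<subseteq> \<Phi>" using that by (auto simp: \<Phi>_def)
        show "\<epsilon> \<le> snd i" unfolding \<epsilon>_def using that I'(1) by (intro Min_le) auto
      qed
      then have "\<theta> \<in> UNIV \<inter> (\<Inter>i\<in>I'. A (fst i) (snd i))" using * by blast
      then show ?thesis by blast
    qed
  qed
  then obtain \<psi> where "\<forall>i\<in>I. \<psi> \<in> A (fst i) (snd i)" by blast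
  then have \<psi>: "\<psi> \<in> A \<Phi> \<epsilon>" if "finite \<Phi>" "\<epsilon> > 0" for \<Phi> \<epsilon>
    using bspec[of I _ "(\<Phi>, \<epsilon>)"] that unfolding I_def by simp
  show ?thesis
  proof
    have "norm (circle_exp (\<psi> x + \<psi> y) - circle_exp (\<psi> (x + y))) \<le> 0 + \<epsilon>" if "\<epsilon> > 0" for x y \<epsilon>
      using \<psi>[of "{x, y, x + y}" \<epsilon>] that by (auto simp: A_def)
    then have "norm (circle_exp (\<psi> x + \<psi> y) - circle_exp (\<psi> (x + y))) \<le> 0" for x y
      by (rule field_le_epsilon)
    then show "additive_on UNIV \<psi>" by (auto simp: additive_on_def circle_exp_inj)
    show "\<psi> x0 \<noteq> 0" using \<psi>[of "{}" 1] by (auto simp: A_def)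
    have "norm (circle_exp (\<psi> x) - 1) \<le> K * \<nu> x + \<epsilon>" if "\<epsilon> > 0" for x \<epsilon>
      using \<psi>[of "{x}" \<epsilon>] that by (auto simp: A_def)
    then show "norm (circle_exp (\<psi> x) - 1) \<le> K * \<nu> x" for x by (rule field_le_epsilon)
  qed
qed

end

section \<open>Continuous characters of compact groups\<close>

definition characters :: "('a::topological_ab_group_add \<Rightarrow> circle) set" where
  "characters = {h. continuous_on UNIV h \<and> additive_on UNIV h}"

lemma group_nhd_half:
  fixes W :: "'a::topological_ab_group_add set"
  assumes "open W" "x \<in> W"
  obtains V where "open V" "0 \<in> V" "\<And>u v. u \<in> V \<Longrightarrow> v \<in> V \<Longrightarrow> x + u - v \<in> W"
proof -
  have "((\<lambda>p. x + fst p - snd p) \<longlongrightarrow> x + 0 - 0) (nhds 0 \<times>\<^sub>F nhds 0)"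
    by (intro tendsto_intros filterlim_fst filterlim_snd)
  then have "\<forall>\<^sub>F p in nhds 0 \<times>\<^sub>F nhds 0. x + fst p - snd p \<in> W"
    by (rule topological_tendstoD) (use assms in auto)
  then obtain P R where PR: "\<forall>\<^sub>F u in nhds 0. P u" "\<forall>\<^sub>F v in nhds 0. R v"
    "\<And>u v. P u \<Longrightarrow> R v \<Longrightarrow> x + u - v \<in> W"
    by (auto simp: eventually_prod_filter)
  then have "\<forall>\<^sub>F u in nhds 0. P u \<and> R u" by (simp add: eventually_conj)
  then obtain V where "open V" "0 \<in> V" "\<forall>u\<in>V. P u \<and> R u" unfolding eventually_nhds by blast
  with PR(3) show ?thesis by (intro that[of V]) auto
qed

lemma continuous_translation: "continuous_on S (\<lambda>x. a + x :: 'a::topological_ab_group_add)"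
  by (intro continuous_intros)

lemma open_translate_vimage:
  "open W \<Longrightarrow> open {x. (a :: 'a::topological_ab_group_add) + x \<in> W}"
  using open_vimage[OF _ continuous_translation[of UNIV a]] by (simp add: vimage_def)

lemma open_translate_minus_vimage:
  "open W \<Longrightarrow> open {x. x - (a :: 'a::topological_ab_group_add) \<in> W}"
  using open_translate_vimage[of W "- a"] by simp

text \<open>Points need not be closed, so normality comes from the regularity of topological groups together with the Lindelof property.\<close>

lemma compact_group_normal:
  assumes "compact (UNIV :: 'a::topological_ab_group_add set)"
  shows "normal_space (euclidean :: 'a topology)"
proof (rule regular_Lindelof_imp_normal_space)
  show "Lindelof_space (euclidean :: 'a topology)"
    using assms by (intro compact_imp_Lindelof_space) (simp add: compact_space_def)
  show "regular_space (euclidean :: 'a topology)"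
    unfolding regular_space_def
  proof (intro allI impI)
    fix S and a :: 'a
    assume "closedin euclidean S \<and> a \<in> topspace euclidean - S"
    then have S: "open (- S)" "a \<in> - S" by auto
    obtain V where V: "open V" "0 \<in> V" "\<And>u v. u \<in> V \<Longrightarrow> v \<in> V \<Longrightarrow> a + u - v \<in> - S"
      using group_nhd_half[OF S] by blast
    have "open {x. x - a \<in> V}" by (rule open_translate_minus_vimage[OF V(1)])
    moreover have "open (\<Union>s\<in>S. {x. x - s \<in> V})" by (intro open_UN ballI open_translate_minus_vimage V(1))
    moreover have "S \<subseteq> (\<Union>s\<in>S. {x. x - s \<in> V})" using V(2) by auto
    moreover have "disjnt {x. x - a \<in> V} (\<Union>s\<in>S. {x. x - s \<in> V})"
    proof -
      have False if "x - a \<in> V" "s \<in> S" "x - s \<in> V" for x s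
        using V(3)[OF that(1,3)] that(2) by simp
      then show ?thesis by (auto simp: disjnt_def)
    qed
    ultimately show "\<exists>U V. openin euclidean U \<and> openin euclidean V \<and> a \<in> U \<and> S \<subseteq> V \<and> disjnt U V"
      using V(2) by (intro exI[of _ "{x. x - a \<in> V}"] exI[of _ "\<Union>s\<in>S. {x. x - s \<in> V}"]) auto
  qed
qed

lemma finite_translates_cover:
  fixes V :: "'a::topological_ab_group_add \<Rightarrow> 'a set"
  assumes "compact (UNIV :: 'a set)" and V: "\<And>x. open (V x)" "\<And>x. 0 \<in> V x"
  shows "\<exists>C. finite C \<and> (\<forall>y. \<exists>x\<in>C. y - x \<in> V x)"
proof -
  obtain C where "finite C" "UNIV \<subseteq> (\<Union>x\<in>C. {y. y - x \<in> V x})"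
  proof (rule compactE_image[OF assms(1), of UNIV "\<lambda>x. {y. y - x \<in> V x}"])
    show "open {y. y - x \<in> V x}" for x by (rule open_translate_minus_vimage[OF V(1)])
    show "UNIV \<subseteq> (\<Union>x. {y. y - x \<in> V x})"
    proof
      fix y :: 'a show "y \<in> (\<Union>x. {y. y - x \<in> V x})" by (rule UN_I[of y]) (simp_all add: V)
    qed
  qed blast
  then show ?thesis by (intro exI[of _ C]) auto
qed

lemma uniformly_continuous_compact_group:
  fixes f :: "'a::topological_ab_group_add \<Rightarrow> real"
  assumes "compact (UNIV :: 'a set)" "continuous_on UNIV f" "\<epsilon> > 0"
  obtains U where "open U" "0 \<in> U" "\<And>x u. u \<in> U \<Longrightarrow> \<bar>f (x + u) - f x\<bar> \<le> \<epsilon>"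
proof -
  have "\<exists>V. open V \<and> 0 \<in> V \<and> (\<forall>u\<in>V. \<forall>v\<in>V. \<bar>f (x + u + v) - f x\<bar> < \<epsilon> / 2)" for x
  proof -
    have "open (f -` ball (f x) (\<epsilon> / 2))" using assms(2) by (intro open_vimage) auto
    then have "open {w. x + w \<in> f -` ball (f x) (\<epsilon> / 2)}" by (rule open_translate_vimage)
    moreover have "0 \<in> {w. x + w \<in> f -` ball (f x) (\<epsilon> / 2)}" using assms(3) by simp
    ultimately obtain V where V: "open V" "0 \<in> V"
      "\<And>u v. u \<in> V \<Longrightarrow> v \<in> V \<Longrightarrow> 0 + u - v \<in> {w. x + w \<in> f -` ball (f x) (\<epsilon> / 2)}"
      using group_nhd_half by blast
    have "continuous_on UNIV (uminus :: 'a \<Rightarrow> 'a)" by (intro continuous_intros)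
    then have "open (uminus -` V)" using V(1) by (intro open_vimage) auto
    moreover have "\<bar>f (x + u + v) - f x\<bar> < \<epsilon> / 2" if "u \<in> V \<inter> uminus -` V" "v \<in> V \<inter> uminus -` V" for u v
      using V(3)[of u "- v"] that by (simp add: dist_real_def add.assoc abs_minus_commute)
    ultimately show ?thesis using V by (intro exI[of _ "V \<inter> uminus -` V"]) auto
  qed
  then obtain V where V: "\<And>x. open (V x)" "\<And>x. 0 \<in> V x"
    "\<And>x u v. u \<in> V x \<Longrightarrow> v \<in> V x \<Longrightarrow> \<bar>f (x + u + v) - f x\<bar> < \<epsilon> / 2"
    by metis
  obtain C where C: "finite C" "\<forall>y. \<exists>x\<in>C. y - x \<in> V x"
    using finite_translates_cover[of V, OF assms(1) V(1,2)] by blast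
  show ?thesis
  proof
    show "open (\<Inter>x\<in>C. V x)" using C V by auto
    show "0 \<in> (\<Inter>x\<in>C. V x)" using V by auto
    fix y u assume u: "u \<in> (\<Inter>x\<in>C. V x)"
    obtain x where x: "x \<in> C" "y - x \<in> V x" using C(2) by blast
    have "\<bar>f (x + (y - x) + u) - f x\<bar> < \<epsilon> / 2" "\<bar>f (x + (y - x) + 0) - f x\<bar> < \<epsilon> / 2"
      using u x V(2) by (intro V(3); auto)+
    then have "\<bar>f (y + u) - f x\<bar> < \<epsilon> / 2" "\<bar>f y - f x\<bar> < \<epsilon> / 2" by simp_all
    then show "\<bar>f (y + u) - f y\<bar> \<le> \<epsilon>" by linarith
  qed
qed

text \<open>A Urysohn function \<open>f\<close> separating \<open>x\<close> from \<open>y\<close> gives the translation invariant seminorm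
\<open>\<nu> u = (SUP z. \<bar>f (z + u) - f z\<bar>)\<close>. It is continuous at zero, because \<open>f\<close> is uniformly continuous, hence totally
bounded, and \<open>\<nu> (y - x) \<ge> 1\<close>. A character dominated by \<open>\<nu>\<close> is continuous.\<close>

theorem characters_separate:
  fixes U :: "'a::topological_ab_group_add set"
  assumes compact: "compact (UNIV :: 'a set)" and U: "open U" "x \<in> U" "y \<notin> U"
  obtains \<psi> where "\<psi> \<in> characters" "\<psi> x \<noteq> \<psi> y"
proof -
  obtain V where V: "open V" "0 \<in> V" "\<And>u v. u \<in> V \<Longrightarrow> v \<in> V \<Longrightarrow> x + u - v \<in> U"
    using group_nhd_half[OF U(1,2)] by blast
  define T where "T = - {z. z - x \<in> V}"
  have "open {z. z - x \<in> V}" by (rule open_translate_minus_vimage[OF V(1)])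
  then have T: "closed T" by (simp add: T_def closed_def)
  have xT: "closure {x} \<inter> T = {}"
  proof -
    have "z - x \<in> V" if z: "z \<in> closure {x}" for z
    proof -
      have "open ((\<lambda>w. z - w) -` V)" using V(1) by (intro open_vimage continuous_intros) auto
      moreover have "z \<in> (\<lambda>w. z - w) -` V" using V(2) by simp
      ultimately have "(\<lambda>w. z - w) -` V \<inter> {x} \<noteq> {}"
        using z open_Int_closure_eq_empty[of "(\<lambda>w. z - w) -` V" "{x}"] by blast
      then show ?thesis by auto
    qed
    then show ?thesis by (auto simp: T_def)
  qed
  obtain f where f: "continuous_map euclidean (top_of_set {0..1::real}) f" "f ` closure {x} \<subseteq> {1}" "f ` T \<subseteq> {0}"
  proof (rule Urysohn_lemma[OF compact_group_normal[OF compact], of T "closure {x}" 0 1])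
    show "closedin euclidean T" "closedin euclidean (closure {x})" using T by auto
    show "disjnt T (closure {x})" using xT by (auto simp: disjnt_def)
  qed auto
  have cont: "continuous_on UNIV f" and f01: "f z \<in> {0..1}" for z
    using f(1) by (auto simp: continuous_map_in_subtopology)
  have fx: "f x = 1" using f(2) closure_subset[of "{x}"] by auto
  have fy: "f y = 0"
  proof -
    have "y \<in> T" using V(3)[of "y - x" 0] V(2) U(3) by (auto simp: T_def)
    then show ?thesis using f(3) by auto
  qed
  define \<nu> where "\<nu> u = (SUP z. \<bar>f (z + u) - f z\<bar>)" for u
  have bdd: "bdd_above (range (\<lambda>z. \<bar>f (z + u) - f z\<bar>))" for u
  proof (rule bdd_aboveI2)
    fix z show "\<bar>f (z + u) - f z\<bar> \<le> 1" using f01[of "z + u"] f01[of z] by auto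
  qed
  have ub: "\<bar>f (z + u) - f z\<bar> \<le> \<nu> u" for z u
    unfolding \<nu>_def by (rule cSUP_upper[OF UNIV_I bdd])
  have lub: "\<nu> u \<le> e" if "\<And>z. \<bar>f (z + u) - f z\<bar> \<le> e" for u e
    unfolding \<nu>_def using that by (intro cSUP_least) auto
  have small: "\<exists>W. open W \<and> 0 \<in> W \<and> (\<forall>u\<in>W. \<nu> u \<le> \<epsilon>)" if "\<epsilon> > 0" for \<epsilon>
    using uniformly_continuous_compact_group[OF compact cont that] lub by metis
  interpret tb_seminorm \<nu>
  proof
    show "\<nu> 0 = 0" by (simp add: \<nu>_def)
    show "\<nu> (- u) = \<nu> u" for u
    proof (rule antisym)
      show "\<nu> (- u) \<le> \<nu> u"
      proof (rule lub)
        fix z show "\<bar>f (z + - u) - f z\<bar> \<le> \<nu> u" using ub[of "z - u" u] by (simp add: abs_minus_commute)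
      qed
      show "\<nu> u \<le> \<nu> (- u)"
      proof (rule lub)
        fix z show "\<bar>f (z + u) - f z\<bar> \<le> \<nu> (- u)" using ub[of "z + u" "- u"] by (simp add: abs_minus_commute)
      qed
    qed
    show "\<nu> (u + v) \<le> \<nu> u + \<nu> v" for u v
    proof (rule lub)
      fix z show "\<bar>f (z + (u + v)) - f z\<bar> \<le> \<nu> u + \<nu> v"
        using ub[of "z + u" v] ub[of z u] by (simp add: add.assoc)
    qed
    fix \<epsilon> :: real assume "\<epsilon> > 0"
    then obtain W where W: "open W" "0 \<in> W" "\<forall>u\<in>W. \<nu> u \<le> \<epsilon> / 2" using small[of "\<epsilon> / 2"] by auto
    obtain C where C: "finite C" "\<forall>z. \<exists>c\<in>C. z - c \<in> W"
      using finite_translates_cover[of "\<lambda>_. W", OF compact W(1,2)] by blast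
    have "\<exists>c\<in>C. \<nu> (z - c) < \<epsilon>" for z
    proof -
      obtain c where "c \<in> C" "z - c \<in> W" using C(2) by blast
      then have "\<nu> (z - c) \<le> \<epsilon> / 2" using W(3) by blast
      then show ?thesis using \<open>c \<in> C\<close> \<open>\<epsilon> > 0\<close> by (intro bexI[of _ c]) auto
    qed
    then show "\<exists>C. finite C \<and> (\<forall>z. \<exists>c\<in>C. \<nu> (z - c) < \<epsilon>)" using C(1) by blast
  qed
  have "\<nu> (y - x) \<ge> 1" using ub[of x "y - x"] fx fy by simp
  then obtain \<psi> K where \<psi>: "additive_on UNIV \<psi>" "\<psi> (y - x) \<noteq> 0"
    "\<And>z. norm (circle_exp (\<psi> z) - 1) \<le> K * \<nu> z"
    using separating_character by blast
  have "\<psi> \<in> characters"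
  proof -
    have "\<exists>W. open W \<and> 0 \<in> W \<and> (\<forall>u\<in>W. dist (\<psi> u) 0 < e)" if e: "e > 0" for e
    proof -
      obtain d where d: "d > 0" "\<And>t. norm (circle_exp t - 1) < d \<Longrightarrow> dist t 0 < e"
        using circle_exp_near_1[OF e] by blast
      have "d / (2 * (\<bar>K\<bar> + 1)) > 0" using d(1) by simp
      then obtain W where W: "open W" "0 \<in> W" "\<forall>u\<in>W. \<nu> u \<le> d / (2 * (\<bar>K\<bar> + 1))" using small by blast
      have "dist (\<psi> u) 0 < e" if "u \<in> W" for u
      proof (rule d(2))
        have "norm (circle_exp (\<psi> u) - 1) \<le> K * \<nu> u" by (rule \<psi>(3))
        also have "\<dots> \<le> (\<bar>K\<bar> + 1) * \<nu> u" by (intro mult_right_mono nonneg) auto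
        also have "\<dots> \<le> (\<bar>K\<bar> + 1) * (d / (2 * (\<bar>K\<bar> + 1)))" using W(3) that by (intro mult_left_mono) auto
        also have "\<dots> = d / 2" by (simp add: field_simps)
        also have "\<dots> < d" using d(1) by simp
        finally show "norm (circle_exp (\<psi> u) - 1) < d" .
      qed
      then show ?thesis using W by blast
    qed
    note near = this
    have "continuous_on UNIV \<psi>"
      unfolding continuous_on_open_vimage[OF open_UNIV]
    proof (intro allI impI)
      fix B :: "circle set" assume B: "open B"
      have "\<exists>T. open T \<and> z \<in> T \<and> T \<subseteq> \<psi> -` B" if z: "\<psi> z \<in> B" for z
      proof -
        obtain e where e: "e > 0" "\<And>t. dist t (\<psi> z) < e \<Longrightarrow> t \<in> B"
          using B z by (auto simp: open_dist)
        obtain W where W: "open W" "0 \<in> W" "\<forall>u\<in>W. dist (\<psi> u) 0 < e" using near[OF e(1)] by blast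
        have "\<psi> w \<in> B" if "w - z \<in> W" for w
        proof (rule e(2))
          have "\<psi> w - \<psi> z = \<psi> (w - z)" by (rule additive_on_diff[symmetric, OF \<psi>(1)]) auto
          then show "dist (\<psi> w) (\<psi> z) < e" using W(3) that by (auto simp: dist_circle_def)
        qed
        then show ?thesis using open_translate_minus_vimage[OF W(1), of z] W(2)
          by (intro exI[of _ "{w. w - z \<in> W}"]) auto
      qed
      then show "open (\<psi> -` B \<inter> UNIV)" by (subst open_subopen) auto
    qed
    then show ?thesis using \<psi>(1) by (simp add: characters_def)
  qed
  moreover have "\<psi> x \<noteq> \<psi> y" using \<psi>(2) additive_on_diff[OF \<psi>(1), of y x] by auto
  ultimately show ?thesis by (rule that)
qed

text \<open>Compactness turns separation of points into the statement that the characters induce the topology.\<close>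

lemma characters_initial_topology:
  fixes U :: "'a::topological_ab_group_add set"
  assumes compact: "compact (UNIV :: 'a set)" and U: "open U" "x \<in> U"
  obtains F e where "finite F" "F \<subseteq> characters" "e > 0"
    "\<And>y. (\<And>\<psi>. \<psi> \<in> F \<Longrightarrow> dist (\<psi> y) (\<psi> x) < e) \<Longrightarrow> y \<in> U"
proof -
  have "\<exists>\<psi>\<in>characters. \<psi> x \<noteq> \<psi> y" if "y \<in> - U" for y
    using characters_separate[OF compact U, of y] that by auto
  then obtain \<psi> where \<psi>: "\<And>y. y \<in> - U \<Longrightarrow> \<psi> y \<in> characters" "\<And>y. y \<in> - U \<Longrightarrow> \<psi> y x \<noteq> \<psi> y y"
    by metis
  define e where "e y = dist (\<psi> y y) (\<psi> y x) / 2" for y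
  have e: "e y > 0" if "y \<in> - U" for y using \<psi>(2)[OF that] by (auto simp: e_def)
  have "compact (- U)" using compact_Int_closed[OF compact, of "- U"] U(1) by (simp add: closed_def)
  moreover have "open {z. e y < dist (\<psi> y z) (\<psi> y x)}" if "y \<in> - U" for y
    using \<psi>(1)[OF that] by (intro open_Collect_less continuous_intros) (auto simp: characters_def)
  moreover have "- U \<subseteq> (\<Union>y\<in>- U. {z. e y < dist (\<psi> y z) (\<psi> y x)})"
  proof
    fix y assume "y \<in> - U"
    then show "y \<in> (\<Union>y\<in>- U. {z. e y < dist (\<psi> y z) (\<psi> y x)})"
      using e[of y] by (intro UN_I[of y]) (auto simp: e_def)
  qed
  ultimately obtain C where C: "C \<subseteq> - U" "finite C" "- U \<subseteq> (\<Union>y\<in>C. {z. e y < dist (\<psi> y z) (\<psi> y x)})"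
    by (rule compactE_image)
  show ?thesis
  proof
    show "finite (\<psi> ` C)" "\<psi> ` C \<subseteq> characters" using C \<psi> by auto
    show "Min (insert 1 (e ` C)) > 0" using C e by auto
    fix y assume *: "\<And>\<phi>. \<phi> \<in> \<psi> ` C \<Longrightarrow> dist (\<phi> y) (\<phi> x) < Min (insert 1 (e ` C))"
    show "y \<in> U"
    proof (rule ccontr)
      assume "y \<notin> U"
      then obtain c where c: "c \<in> C" "e c < dist (\<psi> c y) (\<psi> c x)" using C(3) by blast
      then have "Min (insert 1 (e ` C)) \<le> e c" using C(2) by (intro Min_le) auto
      then show False using c *[of "\<psi> c"] by auto
    qed
  qed
qed

section \<open>Kronecker approximation by characters\<close>

text \<open>In place of an invariant integral: averaging operators, among which \<open>mean_killing_homs\<close> finds one that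
nearly annihilates finitely many given homomorphisms.\<close>

definition mean_on :: "'a set \<Rightarrow> (('a \<Rightarrow> complex) \<Rightarrow> complex) \<Rightarrow> bool" where
  "mean_on D M \<longleftrightarrow> (\<forall>u v. M (\<lambda>d. u d + v d) = M u + M v) \<and> (\<forall>c u. M (\<lambda>d. c * u d) = c * M u)
     \<and> M (\<lambda>_. 1) = 1 \<and> (\<forall>u B. (\<forall>d\<in>D. norm (u d) \<le> B) \<longrightarrow> norm (M u) \<le> B)"

lemma mean_onD:
  assumes "mean_on D M"
  shows "M (\<lambda>d. u d + v d) = M u + M v" "M (\<lambda>d. c * u d) = c * M u" "M (\<lambda>_. 1) = 1"
    "(\<And>d. d \<in> D \<Longrightarrow> norm (u d) \<le> B) \<Longrightarrow> norm (M u) \<le> B"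
  using assms unfolding mean_on_def by simp_all

lemma mean_on_cong:
  assumes M: "mean_on D M" and "\<And>d. d \<in> D \<Longrightarrow> u d = v d"
  shows "M u = M v"
proof -
  have "norm (M (\<lambda>d. u d + (-1) * v d)) \<le> 0" by (rule mean_onD(4)[OF M]) (simp add: assms(2))
  then show ?thesis unfolding mean_onD(1)[OF M] mean_onD(2)[OF M] by simp
qed

lemma mean_on_sum:
  assumes M: "mean_on D M" and "finite I"
  shows "M (\<lambda>d. \<Sum>i\<in>I. u i d) = (\<Sum>i\<in>I. M (u i))"
  using assms(2)
proof (induction I)
  case empty
  show ?case using mean_onD(2)[OF M, of 0 "\<lambda>_. 0"] by simp
qed (simp add: mean_onD(1)[OF M])

text \<open>Averaging over the multiples \<open>k g\<close> with \<open>k < L\<close> multiplies the mean of \<open>circle_exp \<circ> f\<close> by a geometric sum,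
which is small if \<open>f g \<noteq> 0\<close>, and does not increase the other means. So the nonzero homomorphisms can be treated one after
the other.\<close>

lemma mean_killing_homs:
  fixes D :: "'a::ab_group_add set"
  assumes D: "add_subgroup D" and "finite X" "\<eta> > 0"
    and X: "\<And>f. f \<in> X \<Longrightarrow> additive_on D f" "\<And>f. f \<in> X \<Longrightarrow> \<exists>d\<in>D. f d \<noteq> (0 :: circle)"
  shows "\<exists>M. mean_on D M \<and> (\<forall>f\<in>X. norm (M (\<lambda>d. circle_exp (f d))) \<le> \<eta>)"
  using assms(2) X
proof (induction X)
  case empty
  show ?case by (rule exI[of _ "\<lambda>u. u 0"]) (auto simp: mean_on_def add_subgroupD[OF D])
next
  case (insert f X)
  then obtain M where M: "mean_on D M"
    and MX: "\<And>f. f \<in> X \<Longrightarrow> norm (M (\<lambda>d. circle_exp (f d))) \<le> \<eta>" by auto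
  note Madd = mean_onD(1)[OF M] and Mmult = mean_onD(2)[OF M] and M1 = mean_onD(3)[OF M]
    and Mb = mean_onD(4)[OF M] and Mcong = mean_on_cong[OF M]
  obtain g where g: "g \<in> D" "f g \<noteq> 0" using insert.prems(2) by blast
  define z where "z = circle_exp (f g)"
  have z: "z \<noteq> 1" "norm z = 1" using g by (auto simp: z_def circle_exp_eq_1_iff)
  define L where "L = nat \<lceil>2 / (norm (1 - z) * \<eta>)\<rceil> + 1"
  have L: "L > 0" "2 / (norm (1 - z) * \<eta>) \<le> real L" unfolding L_def by linarith+
  define T where "T u = (\<Sum>k<L. M (\<lambda>d. u (d + zmul (int k) g))) / of_nat L" for u
  have T_hom: "T (\<lambda>d. circle_exp (p d)) = (\<Sum>k<L. circle_exp (p g) ^ k) / of_nat L * M (\<lambda>d. circle_exp (p d))"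
    if p: "additive_on D p" for p
  proof -
    have "M (\<lambda>d. circle_exp (p (d + zmul (int k) g))) = circle_exp (p g) ^ k * M (\<lambda>d. circle_exp (p d))" for k
      unfolding Mmult[symmetric]
    proof (rule Mcong)
      fix d assume "d \<in> D"
      then have "p (d + zmul (int k) g) = p d + zmul (int k) (p g)"
        using additive_onD[OF p] additive_on_zmul[OF p D] g add_subgroup_zmul[OF D] by metis
      then show "circle_exp (p (d + zmul (int k) g)) = circle_exp (p g) ^ k * circle_exp (p d)"
        by (simp add: circle_exp_add circle_exp_zmul_nat)
    qed
    then show ?thesis by (simp add: T_def sum_distrib_right)
  qed
  show ?case
    unfolding mean_on_def
  proof (intro exI[of _ T] conjI allI impI ballI)
    fix u v :: "'a \<Rightarrow> complex" and c :: complex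
    show "T (\<lambda>d. u d + v d) = T u + T v" by (simp add: T_def Madd sum.distrib add_divide_distrib)
    show "T (\<lambda>d. c * u d) = c * T u" by (simp add: T_def Mmult sum_distrib_left)
    show "T (\<lambda>_. 1) = 1" using L by (simp add: T_def M1)
  next
    fix u :: "'a \<Rightarrow> complex" and B :: real assume u: "\<forall>d\<in>D. norm (u d) \<le> B"
    have "norm (\<Sum>k<L. M (\<lambda>d. u (d + zmul (int k) g))) \<le> (\<Sum>k<L. B)"
      using u g by (intro order_trans[OF norm_sum] sum_mono Mb) (auto intro!: add_subgroupD(2)[OF D] add_subgroup_zmul[OF D])
    then show "norm (T u) \<le> B" using L by (simp add: T_def norm_divide divide_le_eq mult.commute)
  next
    fix p assume p: "p \<in> insert f X"
    show "norm (T (\<lambda>d. circle_exp (p d))) \<le> \<eta>"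
    proof (cases "p = f")
      case True
      have "(\<Sum>k<L. z ^ k) = (1 - z ^ L) / (1 - z)" using z by (simp add: sum_gp_strict)
      then have "norm (\<Sum>k<L. z ^ k) \<le> 2 / norm (1 - z)"
        using norm_triangle_ineq4[of 1 "z ^ L"] z by (simp add: norm_divide norm_power divide_right_mono)
      also have "\<dots> \<le> \<eta> * real L"
        using L(2) z \<open>\<eta> > 0\<close> by (simp add: field_simps)
      finally have "norm ((\<Sum>k<L. z ^ k) / of_nat L) \<le> \<eta>" using L by (simp add: norm_divide divide_le_eq)
      moreover have "norm (M (\<lambda>d. circle_exp (f d))) \<le> 1" by (rule Mb) simp
      ultimately have "norm ((\<Sum>k<L. z ^ k) / of_nat L) * norm (M (\<lambda>d. circle_exp (f d))) \<le> \<eta> * 1"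
        using \<open>\<eta> > 0\<close> by (intro mult_mono) auto
      then show ?thesis unfolding True T_hom[OF insert.prems(1)[OF insertI1]]
        by (simp only: z_def norm_mult mult_1_right)
    next
      case False
      then have "p \<in> X" using p by simp
      have "norm (\<Sum>k<L. circle_exp (p g) ^ k) \<le> (\<Sum>k<L. 1)"
        by (intro order_trans[OF norm_sum] sum_mono) (simp add: norm_power)
      then have "norm ((\<Sum>k<L. circle_exp (p g) ^ k) / of_nat L) \<le> 1"
        using L by (simp add: norm_divide divide_le_eq)
      then have "norm ((\<Sum>k<L. circle_exp (p g) ^ k) / of_nat L) * norm (M (\<lambda>d. circle_exp (p d))) \<le> 1 * \<eta>"
        using MX[OF \<open>p \<in> X\<close>] by (intro mult_mono) auto
      then show ?thesis unfolding T_hom[OF insert.prems(1)[OF p]] by (simp only: norm_mult mult_1_left)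
    qed
  qed
qed

lemma poly_times_geometric_tendsto_0:
  assumes "0 < \<rho>" "\<rho> < (1 :: real)"
  shows "(\<lambda>N. (real N + 1) ^ r * \<rho> ^ N) \<longlonglongrightarrow> 0"
proof -
  define a where "a = - ln \<rho>"
  have a: "a > 0" using assms by (simp add: a_def)
  have "filterlim (\<lambda>N. a * (real N + 1)) at_top sequentially"
    using filterlim_tendsto_add_at_top[OF tendsto_const filterlim_real_sequentially, of 1]
    by (intro filterlim_tendsto_pos_mult_at_top[OF tendsto_const a]) (simp add: add.commute)
  then have "(\<lambda>N. (a * (real N + 1)) ^ r / exp (a * (real N + 1))) \<longlonglongrightarrow> 0"
    by (rule filterlim_compose[OF tendsto_power_div_exp_0])
  then have "(\<lambda>N. (exp a / a ^ r) * ((a * (real N + 1)) ^ r / exp (a * (real N + 1)))) \<longlonglongrightarrow> (exp a / a ^ r) * 0"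
    by (intro tendsto_intros)
  moreover have "(exp a / a ^ r) * ((a * (real N + 1)) ^ r / exp (a * (real N + 1))) = (real N + 1) ^ r * \<rho> ^ N" for N
  proof -
    have p: "\<rho> ^ N = inverse (exp (a * real N))"
      using assms by (simp add: a_def exp_minus[symmetric] exp_of_nat2_mult)
    have e: "exp (a * (real N + 1)) = exp a * exp (a * real N)"
      by (simp add: distrib_left exp_add mult.commute)
    show ?thesis unfolding p e power_mult_distrib using a by (simp add: field_simps)
  qed
  ultimately show ?thesis by simp
qed

text \<open>If every \<open>d\<close> misses the target in some coordinate, then the product \<open>S\<close> of the \<open>N\<close>-th powers of
\<open>(1 + circle_exp (f \<gamma> d - h \<gamma>)) / 2\<close> is exponentially small in \<open>N\<close> on all of \<open>D\<close>. On the other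
hand \<open>\<bar>S\<bar>\<^sup>2\<close> expands into characters with nonnegative coefficients. Those that are trivial on \<open>D\<close> take the
value 1 after the shift by \<open>h\<close>, by the hypothesis on relations, and the mean makes the others
negligible. So the mean of \<open>\<bar>S\<bar>\<^sup>2\<close> is at least the diagonal part, which
decays only polynomially.\<close>

theorem kronecker:
  fixes f :: "'i \<Rightarrow> 'a::ab_group_add \<Rightarrow> circle"
  assumes D: "add_subgroup D" and F: "finite F" and f: "\<And>\<gamma>. \<gamma> \<in> F \<Longrightarrow> additive_on D (f \<gamma>)"
    and rel: "\<And>n. (\<And>d. d \<in> D \<Longrightarrow> (\<Sum>\<gamma>\<in>F. zmul (n \<gamma>) (f \<gamma> d)) = 0) \<Longrightarrow> (\<Sum>\<gamma>\<in>F. zmul (n \<gamma>) (h \<gamma>)) = 0"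
    and \<epsilon>: "\<epsilon> > 0"
  shows "\<exists>d\<in>D. \<forall>\<gamma>\<in>F. dist (f \<gamma> d) (h \<gamma>) < \<epsilon>"
proof (rule ccontr)
  assume contra: "\<not> ?thesis"
  obtain \<delta> where \<delta>: "\<delta> > 0" "\<And>t. norm (circle_exp t - 1) < \<delta> \<Longrightarrow> dist t 0 < \<epsilon>"
    using circle_exp_near_1[OF \<epsilon>] by blast
  define \<rho> where "\<rho> = max (1/2) (1 - \<delta>\<^sup>2 / 4)"
  have \<rho>: "0 < \<rho>" "\<rho> < 1" using \<delta>(1) by (auto simp: \<rho>_def)
  have norm_half: "(norm ((1 + circle_exp t) / 2))\<^sup>2 = 1 - (norm (circle_exp t - 1))\<^sup>2 / 4" for t
  proof -
    have "(Re (circle_exp t))\<^sup>2 + (Im (circle_exp t))\<^sup>2 = 1"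
      using norm_circle_exp[of t] cmod_power2[of "circle_exp t"] by simp
    then have "(norm (1 + circle_exp t))\<^sup>2 = 2 + 2 * Re (circle_exp t)"
      "(norm (circle_exp t - 1))\<^sup>2 = 2 - 2 * Re (circle_exp t)"
      by (simp_all add: cmod_power2 power2_sum power2_diff)
    then show ?thesis by (simp add: norm_divide power_divide field_simps)
  qed
  define r where "r = card F"
  have key: "1 / 2 \<le> (real N + 1) ^ r * \<rho> ^ N" for N
  proof -
    define Q where "Q = PiE F (\<lambda>_. {..N})"
    have finQ: "finite Q" unfolding Q_def by (intro finite_PiE F) auto
    have cardQ: "real (card Q) = (real N + 1) ^ r" by (simp add: Q_def card_PiE F r_def add.commute)
    define w where "w n = (\<Prod>\<gamma>\<in>F. real (N choose n \<gamma>) / 2 ^ N)" for n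
    have w0: "w n \<ge> 0" for n unfolding w_def by (intro prod_nonneg) auto
    define S where "S d = (\<Prod>\<gamma>\<in>F. ((1 + circle_exp (f \<gamma> d - h \<gamma>)) / 2) ^ N)" for d
    define E where "E v d = circle_exp (\<Sum>\<gamma>\<in>F. zmul (v \<gamma>) (f \<gamma> d - h \<gamma>))" for v :: "'i \<Rightarrow> int" and d
    have binom: "((1 + z) / 2) ^ N = (\<Sum>k\<le>N. of_real (real (N choose k) / 2 ^ N) * z ^ k)" for z :: complex
    proof -
      have "(1 + z) ^ N = (\<Sum>k\<le>N. of_nat (N choose k) * z ^ k)"
        by (subst add.commute, subst binomial_ring) simp
      then show ?thesis by (simp add: power_divide sum_divide_distrib)
    qed
    have S_sum: "S d = (\<Sum>n\<in>Q. of_real (w n) * E (\<lambda>\<gamma>. int (n \<gamma>)) d)" for d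
    proof -
      have "S d = (\<Prod>\<gamma>\<in>F. \<Sum>k\<le>N. of_real (real (N choose k) / 2 ^ N) * circle_exp (f \<gamma> d - h \<gamma>) ^ k)"
        unfolding S_def binom ..
      also have "\<dots> = (\<Sum>n\<in>Q. \<Prod>\<gamma>\<in>F. of_real (real (N choose n \<gamma>) / 2 ^ N) * circle_exp (f \<gamma> d - h \<gamma>) ^ n \<gamma>)"
        unfolding Q_def by (rule prod_sum_PiE) (use F in auto)
      finally show ?thesis
        by (simp only: w_def E_def prod.distrib circle_exp_sum circle_exp_zmul_nat of_real_prod)
    qed
    have w_sum: "(\<Sum>n\<in>Q. w n) = 1"
    proof -
      have "(\<Prod>\<gamma>\<in>F. \<Sum>k\<le>N. real (N choose k) / 2 ^ N) = (\<Sum>n\<in>Q. w n)"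
        unfolding Q_def w_def by (rule prod_sum_PiE) (use F in auto)
      moreover have "(\<Sum>k\<le>N. real (N choose k) / 2 ^ N) = 1"
        using choose_row_sum[of N] by (simp add: sum_divide_distrib[symmetric] of_nat_sum[symmetric] del: of_nat_sum)
      ultimately show ?thesis by simp
    qed
    \<comment> \<open>Cauchy-Schwarz, as the weights \<open>w\<close> have sum 1.\<close>
    have w_sq: "1 \<le> (\<Sum>n\<in>Q. (w n)\<^sup>2) * (real N + 1) ^ r"
      using sum_squared_le_sum_of_squares[of w Q] finQ w_sum by (simp add: cardQ)
    have E_diff: "E u d * cnj (E v d) = E (\<lambda>\<gamma>. u \<gamma> - v \<gamma>) d" for u v d
      by (simp add: E_def circle_exp_diff[symmetric] sum_subtractf[symmetric] zmul_diff_left)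
    \<comment> \<open>Half of the diagonal part, so that half of it survives the error of the mean.\<close>
    define \<eta> where "\<eta> = 1 / (2 * (real N + 1) ^ r)"
    have \<eta>: "\<eta> > 0" by (simp add: \<eta>_def)
    define \<Theta> where "\<Theta> v d = (\<Sum>\<gamma>\<in>F. zmul (v \<gamma>) (f \<gamma> d))" for v d
    define X where "X = {\<Theta> (\<lambda>\<gamma>. int (m \<gamma>) - int (n \<gamma>)) | m n. m \<in> Q \<and> n \<in> Q \<and>
        (\<exists>d\<in>D. \<Theta> (\<lambda>\<gamma>. int (m \<gamma>) - int (n \<gamma>)) d \<noteq> 0)}"
    have "finite X"
    proof (rule finite_subset)
      show "X \<subseteq> (\<lambda>(m, n). \<Theta> (\<lambda>\<gamma>. int (m \<gamma>) - int (n \<gamma>))) ` (Q \<times> Q)" by (auto simp: X_def)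
    qed (use finQ in auto)
    moreover have "additive_on D (\<Theta> v)" for v
      unfolding additive_on_def \<Theta>_def
      by (intro ballI) (simp add: additive_onD[OF f] zmul_distrib_right sum.distrib)
    then have "additive_on D u" if "u \<in> X" for u using that by (auto simp: X_def)
    moreover have "\<exists>d\<in>D. u d \<noteq> 0" if "u \<in> X" for u using that by (auto simp: X_def)
    ultimately obtain M where M: "mean_on D M"
      and MX: "\<And>u. u \<in> X \<Longrightarrow> norm (M (\<lambda>d. circle_exp (u d))) \<le> \<eta>"
      using mean_killing_homs[OF D _ \<eta>, of X] by auto
    note Mmult = mean_onD(2)[OF M] and M1 = mean_onD(3)[OF M]
      and Mb = mean_onD(4)[OF M] and Mcong = mean_on_cong[OF M]
    define \<Delta> where "\<Delta> p \<gamma> = int (fst p \<gamma>) - int (snd p \<gamma>)" for p :: "('i \<Rightarrow> nat) \<times> ('i \<Rightarrow> nat)" and \<gamma>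
    have sq: "of_real ((norm (S d))\<^sup>2) = (\<Sum>p\<in>Q\<times>Q. of_real (w (fst p) * w (snd p)) * E (\<Delta> p) d)" for d
    proof -
      have "of_real ((norm (S d))\<^sup>2) = S d * cnj (S d)" by (simp only: complex_norm_square)
      also have "\<dots> = (\<Sum>m\<in>Q. \<Sum>n\<in>Q. of_real (w m * w n) * E (\<Delta> (m, n)) d)"
        unfolding S_sum by (simp add: sum_product \<Delta>_def[abs_def] E_diff[symmetric] mult_ac)
      also have "\<dots> = (\<Sum>p\<in>Q\<times>Q. of_real (w (fst p) * w (snd p)) * E (\<Delta> p) d)"
        unfolding sum.cartesian_product by (rule sum.cong) auto
      finally show ?thesis .
    qed
    have ME: "Re (M (E (\<Delta> p))) \<ge> (if fst p = snd p then 1 else 0) - \<eta>" if p: "p \<in> Q \<times> Q" for p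
    proof (cases "\<exists>d\<in>D. \<Theta> (\<Delta> p) d \<noteq> 0")
      case True
      then have "\<Theta> (\<Delta> p) \<in> X" using p unfolding X_def \<Delta>_def[abs_def] by (intro CollectI exI[of _ "fst p"] exI[of _ "snd p"]) auto
      moreover have "E (\<Delta> p) d = circle_exp (- (\<Sum>\<gamma>\<in>F. zmul (\<Delta> p \<gamma>) (h \<gamma>))) * circle_exp (\<Theta> (\<Delta> p) d)" for d
        by (simp add: E_def \<Theta>_def zmul_diff_right sum_subtractf circle_exp_add[symmetric])
      then have "E (\<Delta> p) = (\<lambda>d. circle_exp (- (\<Sum>\<gamma>\<in>F. zmul (\<Delta> p \<gamma>) (h \<gamma>))) * circle_exp (\<Theta> (\<Delta> p) d))" by (rule ext)
      ultimately have "norm (M (E (\<Delta> p))) \<le> \<eta>" using MX by (simp add: Mmult norm_mult)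
      then have "Re (M (E (\<Delta> p))) \<ge> - \<eta>" using abs_Re_le_cmod[of "M (E (\<Delta> p))"] by linarith
      moreover have "fst p \<noteq> snd p"
      proof
        assume "fst p = snd p"
        then have "\<Theta> (\<Delta> p) d = 0" for d by (simp add: \<Theta>_def \<Delta>_def)
        then show False using True by simp
      qed
      ultimately show ?thesis by simp
    next
      case False
      then have "(\<Sum>\<gamma>\<in>F. zmul (\<Delta> p \<gamma>) (h \<gamma>)) = 0" using rel[of "\<Delta> p"] by (auto simp: \<Theta>_def)
      then have "E (\<Delta> p) d = 1" if "d \<in> D" for d
        using False that by (simp add: E_def \<Theta>_def zmul_diff_right sum_subtractf)
      then have "M (E (\<Delta> p)) = M (\<lambda>_. 1)" by (rule Mcong)
      then have "M (E (\<Delta> p)) = 1" by (simp only: M1)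
      then show ?thesis using \<eta> by simp
    qed
    have "M (\<lambda>d. of_real ((norm (S d))\<^sup>2)) = (\<Sum>p\<in>Q\<times>Q. of_real (w (fst p) * w (snd p)) * M (E (\<Delta> p)))"
      unfolding sq by (subst mean_on_sum[OF M]) (simp_all add: finQ Mmult)
    then have "Re (M (\<lambda>d. of_real ((norm (S d))\<^sup>2))) = (\<Sum>p\<in>Q\<times>Q. (w (fst p) * w (snd p)) * Re (M (E (\<Delta> p))))"
      by (simp add: Re_sum)
    also have "\<dots> \<ge> (\<Sum>p\<in>Q\<times>Q. (w (fst p) * w (snd p)) * ((if fst p = snd p then 1 else 0) - \<eta>))"
      by (intro sum_mono mult_left_mono ME mult_nonneg_nonneg w0)
    also have "(\<Sum>p\<in>Q\<times>Q. (w (fst p) * w (snd p)) * ((if fst p = snd p then 1 else 0) - \<eta>))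
        = (\<Sum>m\<in>Q. \<Sum>n\<in>Q. (w m * w n) * ((if m = n then 1 else 0) - \<eta>))"
      unfolding sum.cartesian_product by (rule sum.cong) auto
    also have "\<dots> = (\<Sum>m\<in>Q. \<Sum>n\<in>Q. (if m = n then w m * w n else 0)) - \<eta> * (\<Sum>m\<in>Q. \<Sum>n\<in>Q. w m * w n)"
      unfolding sum_distrib_left sum_subtractf[symmetric] by (intro sum.cong refl) (auto simp: algebra_simps)
    also have "\<dots> = (\<Sum>n\<in>Q. (w n)\<^sup>2) - \<eta>"
    proof -
      have "(\<Sum>m\<in>Q. \<Sum>n\<in>Q. w m * w n) = 1" using w_sum by (simp add: sum_product[symmetric])
      moreover have "(\<Sum>m\<in>Q. \<Sum>n\<in>Q. (if m = n then w m * w n else 0)) = (\<Sum>n\<in>Q. (w n)\<^sup>2)"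
        by (intro sum.cong refl) (simp add: finQ power2_eq_square)
      ultimately show ?thesis by simp
    qed
    finally have lower: "(\<Sum>n\<in>Q. (w n)\<^sup>2) - \<eta> \<le> Re (M (\<lambda>d. of_real ((norm (S d))\<^sup>2)))" .
    have "norm (M (\<lambda>d. of_real ((norm (S d))\<^sup>2))) \<le> \<rho> ^ N"
    proof (rule Mb)
      fix d assume "d \<in> D"
      then obtain \<gamma> where \<gamma>: "\<gamma> \<in> F" "\<not> dist (f \<gamma> d) (h \<gamma>) < \<epsilon>" using contra by blast
      then have "\<not> norm (circle_exp (f \<gamma> d - h \<gamma>) - 1) < \<delta>"
        using \<delta>(2)[of "f \<gamma> d - h \<gamma>"] by (auto simp: dist_circle_def)
      then have "\<delta>\<^sup>2 \<le> (norm (circle_exp (f \<gamma> d - h \<gamma>) - 1))\<^sup>2" using \<delta>(1) by (intro power_mono) auto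
      then have le\<rho>: "(norm ((1 + circle_exp (f \<gamma> d - h \<gamma>)) / 2))\<^sup>2 \<le> \<rho>"
        unfolding norm_half \<rho>_def by linarith
      have le1: "(norm ((1 + circle_exp t) / 2))\<^sup>2 \<le> 1" for t unfolding norm_half by simp
      have "(norm (S d))\<^sup>2 = (\<Prod>\<gamma>\<in>F. ((norm ((1 + circle_exp (f \<gamma> d - h \<gamma>)) / 2))\<^sup>2) ^ N)"
        unfolding S_def by (simp add: prod_norm[symmetric] norm_power prod_power_distrib power_mult[symmetric] mult.commute)
      also have "\<dots> = ((norm ((1 + circle_exp (f \<gamma> d - h \<gamma>)) / 2))\<^sup>2) ^ N
          * (\<Prod>\<gamma>\<in>F - {\<gamma>}. ((norm ((1 + circle_exp (f \<gamma> d - h \<gamma>)) / 2))\<^sup>2) ^ N)"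
        by (rule prod.remove[OF F \<gamma>(1)])
      also have "\<dots> \<le> \<rho> ^ N * 1"
        using le\<rho> le1 \<rho>(1) by (intro mult_mono power_mono prod_le_1 prod_nonneg) (auto intro!: power_le_one order_trans[OF norm_triangle_ineq])
      finally show "norm (complex_of_real ((norm (S d))\<^sup>2)) \<le> \<rho> ^ N" by (simp add: norm_power)
    qed
    then have "(\<Sum>n\<in>Q. (w n)\<^sup>2) - \<eta> \<le> \<rho> ^ N"
      using lower abs_Re_le_cmod[of "M (\<lambda>d. of_real ((norm (S d))\<^sup>2))"] by linarith
    then have "((\<Sum>n\<in>Q. (w n)\<^sup>2) - \<eta>) * (real N + 1) ^ r \<le> \<rho> ^ N * (real N + 1) ^ r"
      by (intro mult_right_mono) auto
    moreover have "\<eta> * (real N + 1) ^ r = 1 / 2" by (simp add: \<eta>_def)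
    ultimately have "(\<Sum>n\<in>Q. (w n)\<^sup>2) * (real N + 1) ^ r - 1 / 2 \<le> \<rho> ^ N * (real N + 1) ^ r"
      by (simp only: left_diff_distrib)
    then show ?thesis using w_sq by (simp only: mult.commute[of "\<rho> ^ N"])
  qed
  have "1 / 2 \<le> (0 :: real)"
    by (rule LIMSEQ_le_const[OF poly_times_geometric_tendsto_0[OF \<rho>, of r]]) (use key in auto)
  then show False by simp
qed

section \<open>Duality for compact groups\<close>

lemma add_subgroup_characters: "add_subgroup characters"
  unfolding add_subgroup_def characters_def additive_on_def
  by (auto simp: fun_eq_iff algebra_simps plus_fun_def zero_fun_def fun_Compl_def intro!: continuous_intros)

lemma characters_additive: "\<psi> \<in> characters \<Longrightarrow> additive_on UNIV \<psi>"
  by (simp add: characters_def)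

lemma characters_continuous: "\<psi> \<in> characters \<Longrightarrow> continuous_on S \<psi>"
  by (auto simp: characters_def intro: continuous_on_subset)

text \<open>Finitely many values are approximated by \<open>kronecker\<close>: a relation between characters is an equation in the
character group, hence preserved by \<open>h\<close>. Compactness of the group makes all approximations exact at once.\<close>

theorem evaluation_surjective:
  fixes h :: "('a::topological_ab_group_add \<Rightarrow> circle) \<Rightarrow> circle"
  assumes compact: "compact (UNIV :: 'a set)" and h: "additive_on UNIV h"
  obtains g :: 'a where "\<And>\<psi>. \<psi> \<in> characters \<Longrightarrow> \<psi> g = h \<psi>"
proof -
  define A where "A p = {g. dist (fst p g) (h (fst p)) \<le> snd p}" for p :: "('a \<Rightarrow> circle) \<times> real"
  define I where "I = (characters :: ('a \<Rightarrow> circle) set) \<times> {0 :: real<..}"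
  have "UNIV \<inter> (\<Inter>p\<in>I. A p) \<noteq> {}"
  proof (rule compact_imp_fip_image[OF compact])
    show "closed (A p)" if "p \<in> I" for p
      using that unfolding A_def I_def
      by (intro closed_Collect_le continuous_intros) (auto intro: characters_continuous)
    fix I' assume I': "finite I'" "I' \<subseteq> I"
    define \<epsilon> where "\<epsilon> = Min (insert 1 (snd ` I'))"
    have \<epsilon>: "\<epsilon> > 0" using I' by (auto simp: \<epsilon>_def I_def)
    have "\<exists>g\<in>UNIV. \<forall>\<psi>\<in>fst ` I'. dist (id \<psi> g) (h \<psi>) < \<epsilon>"
    proof (rule kronecker)
      show "additive_on UNIV (id \<psi>)" if "\<psi> \<in> fst ` I'" for \<psi>
        using that I'(2) by (auto simp: I_def intro: characters_additive)
      fix n :: "('a \<Rightarrow> circle) \<Rightarrow> int"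
      assume "\<And>g. g \<in> UNIV \<Longrightarrow> (\<Sum>\<psi>\<in>fst ` I'. zmul (n \<psi>) (id \<psi> g)) = 0"
      then have "(\<Sum>\<psi>\<in>fst ` I'. zmul (n \<psi>) \<psi>) = 0"
        by (intro ext) (simp add: sum_fun_apply zmul_fun_apply)
      then have "0 = h (\<Sum>\<psi>\<in>fst ` I'. zmul (n \<psi>) \<psi>)" using additive_on_zero[OF h] by simp
      also have "\<dots> = (\<Sum>\<psi>\<in>fst ` I'. zmul (n \<psi>) (h \<psi>))"
        by (simp add: additive_on_sum[OF h] additive_on_zmul[OF h])
      finally show "(\<Sum>\<psi>\<in>fst ` I'. zmul (n \<psi>) (h \<psi>)) = 0" by simp
    qed (use I' \<epsilon> in auto)
    then obtain g where g: "\<And>\<psi>. \<psi> \<in> fst ` I' \<Longrightarrow> dist (\<psi> g) (h \<psi>) < \<epsilon>" by auto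
    have "g \<in> A p" if "p \<in> I'" for p
    proof -
      have "\<epsilon> \<le> snd p" unfolding \<epsilon>_def using that I'(1) by (intro Min_le) auto
      then show ?thesis using g[of "fst p"] that by (auto simp: A_def)
    qed
    then show "UNIV \<inter> (\<Inter>p\<in>I'. A p) \<noteq> {}" by blast
  qed
  then obtain g where g: "\<And>p. p \<in> I \<Longrightarrow> g \<in> A p" by blast
  show ?thesis
  proof
    fix \<psi> :: "'a \<Rightarrow> circle" assume \<psi>: "\<psi> \<in> characters"
    have "dist (\<psi> g) (h \<psi>) \<le> 0 + e" if "e > 0" for e
      using g[of "(\<psi>, e)"] \<psi> that by (auto simp: A_def I_def)
    then have "dist (\<psi> g) (h \<psi>) \<le> 0" by (rule field_le_epsilon)
    then show "\<psi> g = h \<psi>" by simp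
  qed
qed

text \<open>The values at \<open>x\<close> of finitely many characters are approximated on \<open>D\<close> by \<open>kronecker\<close>: a relation between them
that holds on \<open>D\<close> is a character that vanishes on \<open>D\<close>, hence holds at \<open>x\<close>.\<close>

theorem dense_if_separates_characters:
  fixes D :: "'a::topological_ab_group_add set"
  assumes compact: "compact (UNIV :: 'a set)" and D: "add_subgroup D"
    and sep: "\<And>\<psi>. \<psi> \<in> characters \<Longrightarrow> (\<And>d. d \<in> D \<Longrightarrow> \<psi> d = 0) \<Longrightarrow> \<psi> = 0"
  shows "closure D = UNIV"
proof (rule ccontr)
  assume "closure D \<noteq> UNIV"
  then obtain x where x: "x \<notin> closure D" by blast
  have "open (- closure D)" "x \<in> - closure D" using x by auto
  then obtain F e where F: "finite F" "F \<subseteq> characters" "e > 0"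
    "\<And>y. (\<And>\<psi>. \<psi> \<in> F \<Longrightarrow> dist (\<psi> y) (\<psi> x) < e) \<Longrightarrow> y \<in> - closure D"
    using characters_initial_topology[OF compact] by metis
  have "\<exists>d\<in>D. \<forall>\<psi>\<in>F. dist (id \<psi> d) (\<psi> x) < e"
  proof (rule kronecker[OF D F(1) _ _ F(3)])
    show "additive_on D (id \<psi>)" if "\<psi> \<in> F" for \<psi>
      using characters_additive that F(2) by (auto simp: additive_on_def)
    fix n :: "('a \<Rightarrow> circle) \<Rightarrow> int"
    assume *: "\<And>d. d \<in> D \<Longrightarrow> (\<Sum>\<psi>\<in>F. zmul (n \<psi>) (id \<psi> d)) = 0"
    have "(\<Sum>\<psi>\<in>F. zmul (n \<psi>) \<psi>) = 0"
    proof (rule sep)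
      show "(\<Sum>\<psi>\<in>F. zmul (n \<psi>) \<psi>) \<in> characters"
        using F(2) by (intro add_subgroup_sum add_subgroup_zmul add_subgroup_characters) auto
      show "(\<Sum>\<psi>\<in>F. zmul (n \<psi>) \<psi>) d = 0" if "d \<in> D" for d
        using *[OF that] by (simp add: sum_fun_apply zmul_fun_apply)
    qed
    then have "(\<Sum>\<psi>\<in>F. zmul (n \<psi>) \<psi>) x = 0" by simp
    then show "(\<Sum>\<psi>\<in>F. zmul (n \<psi>) (\<psi> x)) = 0" by (simp add: sum_fun_apply zmul_fun_apply)
  qed
  then obtain d where "d \<in> D" "\<And>\<psi>. \<psi> \<in> F \<Longrightarrow> dist (\<psi> d) (\<psi> x) < e" by auto
  then show False using F(4)[of d] closure_subset by auto
qed

section \<open>Extension of homomorphisms into the circle\<close>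

text \<open>Partial homomorphisms into the circle as subgroups of a product. Chains of them have unions as
upper bounds, and a homomorphism on a generated subgroup can be given by values on generators.\<close>

definition hom_graph :: "('g::ab_group_add \<times> circle) set \<Rightarrow> bool" where
  "hom_graph R \<longleftrightarrow> add_subgroup R \<and> (\<forall>c. (0, c) \<in> R \<longrightarrow> c = 0)"

lemma zmul_prod: "zmul n (x, y) = (zmul n x, zmul n y)"
  by (induction n rule: int_induct[where k = 0]) (simp_all add: zmul_add1 zmul_sub1 zero_prod_def)

lemma hom_graph_unique:
  assumes "hom_graph R" "(x, c) \<in> R" "(x, d) \<in> R" shows "c = d"
  using add_subgroupD(4)[of R "(x, c)" "(x, d)"] assms by (auto simp: hom_graph_def)

lemma divide_circle:
  fixes s :: circle
  assumes "k \<ge> (2 :: nat)"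
  obtains c where "c \<noteq> 0" "zmul (int k) c = s"
proof -
  define c where "c = to_circle (rep_circle s / real k)"
  define d where "d = to_circle (1 / real k)"
  have "zmul (int k) c = s" "zmul (int k) d = 0"
    using assms to_circle_eq_0_iff[of 1] by (simp_all add: c_def d_def zmul_to_circle)
  moreover have "d \<noteq> 0"
  proof
    assume "d = 0"
    then obtain j where "1 / real k = of_int j" by (auto simp: d_def to_circle_eq_0_iff elim: Ints_cases)
    moreover have "0 < 1 / real k" "1 / real k < 1" using assms by auto
    ultimately have "0 < real_of_int j" "real_of_int j < 1" by simp_all
    then show False by simp
  qed
  ultimately show ?thesis using that[of c] that[of "c + d"] by (cases "c = 0") (auto simp: zmul_distrib_right)
qed

text \<open>Let \<open>K\<close> be the least positive integer with \<open>K x\<close> in the domain. A value \<open>c\<close> at \<open>x\<close> is admissible iff \<open>K c\<close> is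
the prescribed value at \<open>K x\<close>. As \<open>K \<ge> 2\<close>, this leaves a choice, and one choice is nonzero.\<close>

lemma hom_graph_value:
  assumes R: "hom_graph R" and x: "x \<notin> Domain R"
  obtains c where "c \<noteq> 0" "\<And>k r. (zmul k x, r) \<in> R \<Longrightarrow> r = zmul k c"
proof (cases "\<exists>k::nat. k > 0 \<and> zmul (int k) x \<in> Domain R")
  case False
  have sub: "add_subgroup R" using R by (simp add: hom_graph_def)
  have "k = 0" if "(zmul k x, r) \<in> R" for k r
  proof (rule ccontr)
    assume "k \<noteq> 0"
    have "(zmul (- k) x, - r) \<in> R" using add_subgroupD(3)[OF sub that] by (simp add: zmul_minus_left)
    then have "zmul \<bar>k\<bar> x \<in> Domain R" using that by (auto simp: abs_if)
    then have "zmul (int (nat \<bar>k\<bar>)) x \<in> Domain R" by simp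
    moreover have "nat \<bar>k\<bar> > 0" using \<open>k \<noteq> 0\<close> by simp
    ultimately show False using False by blast
  qed
  note k = this
  obtain c :: circle where c: "c \<noteq> 0"    by (rule divide_circle[OF order_refl, of 0])
  show ?thesis
  proof (rule that[OF c])
    fix k r assume kr: "(zmul k x, r) \<in> R"
    then have "k = 0" by (rule k)
    then show "r = zmul k c" using kr R by (simp add: hom_graph_def)
  qed
next
  case True
  have sub: "add_subgroup R" using R by (simp add: hom_graph_def)
  define K where "K = (LEAST k::nat. k > 0 \<and> zmul (int k) x \<in> Domain R)"
  have K: "K > 0" "zmul (int K) x \<in> Domain R"
    using LeastI_ex[OF True] by (simp_all add: K_def)
  have least: "\<not> (k > 0 \<and> zmul (int k) x \<in> Domain R)" if "k < K" for k
    using not_less_Least[OF that[unfolded K_def]] .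
  obtain s where s: "(zmul (int K) x, s) \<in> R" using K(2) by blast
  have "K \<noteq> 1" using K(2) x by auto
  then have "K \<ge> 2" using K(1) by simp
  then obtain c where c: "c \<noteq> 0" "zmul (int K) c = s" by (rule divide_circle)
  show ?thesis
  proof (rule that[OF c(1)])
    fix k r assume kr: "(zmul k x, r) \<in> R"
    define q where "q = k div int K"
    define m where "m = nat (k mod int K)"
    have m: "int m = k mod int K" "m < K" using K(1) by (simp_all add: m_def nat_less_iff)
    have k: "k = q * int K + int m" using m(1) by (simp add: q_def)
    have qs: "(zmul (q * int K) x, zmul q s) \<in> R"
      using add_subgroup_zmul[OF sub s, of q] by (simp add: zmul_prod zmul_mult)
    then have "(zmul (int m) x, r - zmul q s) \<in> R"
      using add_subgroupD(4)[OF sub kr qs] unfolding k by (simp add: zmul_diff_left zmul_distrib_left)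
    then have "zmul (int m) x \<in> Domain R" by (rule DomainI)
    then have "m = 0" using least[OF m(2)] by simp
    then have "k = q * int K" using k by simp
    then have "r = zmul q s" using hom_graph_unique[OF R kr] qs by simp
    then show "r = zmul k c" using c(2) \<open>k = q * int K\<close> by (simp add: zmul_mult)
  qed
qed

lemma hom_graph_extend:
  assumes R: "hom_graph R" and x: "x \<notin> Domain R"
  obtains c where "c \<noteq> 0" "hom_graph (gen (insert (x, c) R))"
proof -
  obtain c where c: "c \<noteq> 0" "\<And>k r. (zmul k x, r) \<in> R \<Longrightarrow> r = zmul k c"
    using hom_graph_value[OF R x] by blast
  have sub: "add_subgroup R" using R by (simp add: hom_graph_def)
  define R' where "R' = {p + zmul k (x, c) | p k. p \<in> R}"
  have "add_subgroup R'"
    unfolding add_subgroup_def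
  proof (intro conjI ballI)
    show "0 \<in> R'" unfolding R'_def using add_subgroupD(1)[OF sub]
      by (intro CollectI exI[of _ 0]) simp
    fix u assume "u \<in> R'"
    then obtain p k where p: "p \<in> R" "u = p + zmul k (x, c)" by (auto simp: R'_def)
    then show "- u \<in> R'" unfolding R'_def using add_subgroupD(3)[OF sub p(1)]
      by (intro CollectI exI[of _ "- p"] exI[of _ "- k"]) (simp add: zmul_minus_left)
    fix v assume "v \<in> R'"
    then obtain q j where q: "q \<in> R" "v = q + zmul j (x, c)" by (auto simp: R'_def)
    then show "u + v \<in> R'" unfolding R'_def using p add_subgroupD(2)[OF sub p(1) q(1)]
      by (intro CollectI exI[of _ "p + q"] exI[of _ "k + j"]) (simp add: zmul_distrib_left)
  qed
  moreover have "insert (x, c) R \<subseteq> R'"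
  proof
    fix u assume "u \<in> insert (x, c) R"
    then consider "u = (x, c)" | "u \<in> R" by blast
    then show "u \<in> R'"
      unfolding R'_def using add_subgroupD(1)[OF sub]
      by cases (intro CollectI exI[of _ 0] exI[of _ 1], simp, intro CollectI exI[of _ u] exI[of _ 0], simp)
  qed
  ultimately have "gen (insert (x, c) R) \<subseteq> R'" by (rule gen_minimal)
  moreover have "d = 0" if d: "(0, d) \<in> R'" for d
  proof -
    obtain p k where p: "p \<in> R" "(0, d) = p + zmul k (x, c)" using d unfolding R'_def by blast
    obtain y r where "p = (y, r)" by (cases p)
    with p have "(y, r) \<in> R" "y + zmul k x = 0" "d = r + zmul k c" by (simp_all add: zmul_prod)
    then have "(zmul (- k) x, r) \<in> R" by (metis eq_neg_iff_add_eq_0 zmul_minus_left)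
    then show ?thesis using c(2) \<open>d = r + zmul k c\<close> by (fastforce simp: zmul_minus_left)
  qed
  ultimately show ?thesis using c(1) by (intro that[of c]) (auto simp: hom_graph_def add_subgroup_gen)
qed

text \<open>A maximal partial homomorphism is total by \<open>hom_graph_extend\<close>, because the circle is divisible.\<close>

theorem hom_graph_extends:
  fixes R :: "('g::ab_group_add \<times> circle) set"
  assumes R: "hom_graph R"
  obtains h where "additive_on UNIV h" "\<And>x c. (x, c) \<in> R \<Longrightarrow> h x = c"
proof -
  define \<A> where "\<A> = {R'. R \<subseteq> R' \<and> hom_graph R'}"
  have "\<exists>M\<in>\<A>. \<forall>X\<in>\<A>. M \<subseteq> X \<longrightarrow> X = M"
  proof (rule subset_Zorn_nonempty)
    show "\<A> \<noteq> {}" using R by (auto simp: \<A>_def)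
    fix \<C> assume C: "\<C> \<noteq> {}" "subset.chain \<A> \<C>"
    have CA: "\<And>X. X \<in> \<C> \<Longrightarrow> R \<subseteq> X \<and> hom_graph X" using C(2) by (auto simp: subset.chain_def \<A>_def)
    have two: "\<exists>Z\<in>\<C>. u \<in> Z \<and> v \<in> Z" if "u \<in> \<Union>\<C>" "v \<in> \<Union>\<C>" for u v
    proof -
      obtain X Y where XY: "X \<in> \<C>" "Y \<in> \<C>" "u \<in> X" "v \<in> Y" using \<open>u \<in> \<Union>\<C>\<close> \<open>v \<in> \<Union>\<C>\<close> by blast
      then have "X \<subseteq> Y \<or> Y \<subseteq> X" using C(2) unfolding subset_chain_def by blast
      then show ?thesis using XY by blast
    qed
    have "add_subgroup (\<Union>\<C>)"
      unfolding add_subgroup_def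
    proof (intro conjI ballI)
      have CS: "add_subgroup X" if "X \<in> \<C>" for X using CA[OF that] by (simp add: hom_graph_def)
      obtain X where "X \<in> \<C>" using C(1) by blast
      then show "0 \<in> \<Union>\<C>" using add_subgroupD(1)[OF CS] by blast
      fix u assume u: "u \<in> \<Union>\<C>"
      then obtain Y where "Y \<in> \<C>" "u \<in> Y" by blast
      then show "- u \<in> \<Union>\<C>" using add_subgroupD(3)[OF CS] by blast
      fix v assume "v \<in> \<Union>\<C>"
      then obtain Z where "Z \<in> \<C>" "u \<in> Z" "v \<in> Z" using two[OF u] by blast
      then show "u + v \<in> \<Union>\<C>" using add_subgroupD(2)[OF CS] by blast
    qed
    then show "\<Union>\<C> \<in> \<A>" using CA C(1) by (auto simp: \<A>_def hom_graph_def)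
  qed
  then obtain M where M\<A>: "M \<in> \<A>" and max: "\<forall>X\<in>\<A>. M \<subseteq> X \<longrightarrow> X = M" by blast
  then have M: "R \<subseteq> M" "hom_graph M" by (simp_all add: \<A>_def)
  have sub: "add_subgroup M" using M(2) by (simp add: hom_graph_def)
  have "x \<in> Domain M" for x
  proof (rule ccontr)
    assume x: "x \<notin> Domain M"
    then obtain c where "hom_graph (gen (insert (x, c) M))" using hom_graph_extend[OF M(2)] by blast
    moreover have "insert (x, c) M \<subseteq> gen (insert (x, c) M)" by (auto intro: gen_incl)
    ultimately have "gen (insert (x, c) M) \<in> \<A>" "M \<subseteq> gen (insert (x, c) M)"
      using M(1) by (auto simp: \<A>_def)
    then have "gen (insert (x, c) M) = M" using max by blast
    then show False using x gen_incl[of "(x, c)" "insert (x, c) M"] by auto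
  qed
  then have "\<forall>x. \<exists>c. (x, c) \<in> M" by (simp add: Domain_iff)
  then obtain h where h: "\<And>x. (x, h x) \<in> M" by metis
  show ?thesis
  proof
    show "additive_on UNIV h"
      unfolding additive_on_def
    proof (intro ballI)
      fix x y
      have "(x + y, h x + h y) \<in> M" using add_subgroupD(2)[OF sub h h, of x y] by simp
      then show "h (x + y) = h x + h y" using hom_graph_unique[OF M(2) h] by blast
    qed
    show "h x = c" if "(x, c) \<in> R" for x c
      using hom_graph_unique[OF M(2) h, of x c] that M(1) by blast
  qed
qed

corollary hom_graph_extends_nonzero:
  fixes R :: "('g::ab_group_add \<times> circle) set"
  assumes R: "hom_graph R" and x: "x \<notin> Domain R"
  obtains h where "additive_on UNIV h" "\<And>x c. (x, c) \<in> R \<Longrightarrow> h x = c" "h x \<noteq> 0"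
proof -
  obtain c where c: "c \<noteq> 0" "hom_graph (gen (insert (x, c) R))" using hom_graph_extend[OF R x] by blast
  obtain h where h: "additive_on UNIV h" "\<And>y d. (y, d) \<in> gen (insert (x, c) R) \<Longrightarrow> h y = d"
    using hom_graph_extends[OF c(2)] by blast
  show ?thesis
  proof (rule that[OF h(1)])
    show "h x \<noteq> 0" using h(2)[OF gen_incl, of x c] c(1) by simp
    show "h y = d" if "(y, d) \<in> R" for y d using h(2)[OF gen_incl] that by simp
  qed
qed

section \<open>Independence modulo m and ranks\<close>

text \<open>For \<open>m = 0\<close> this is linear independence over the integers, for a prime \<open>m\<close> and elements of order \<open>m\<close> it is linear
independence over the field with \<open>m\<close> elements. Treating both at once avoids two versions of the construction of \<open>D\<close>.\<close>

definition indep :: "int \<Rightarrow> ('i \<Rightarrow> 'g::ab_group_add) \<Rightarrow> 'i set \<Rightarrow> bool" where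
  "indep m v S \<longleftrightarrow> (\<forall>F n. finite F \<longrightarrow> F \<subseteq> S \<longrightarrow> (\<Sum>s\<in>F. zmul (n s) (v s)) = 0 \<longrightarrow> (\<forall>s\<in>F. m dvd n s))"

lemma indepD:
  "indep m v S \<Longrightarrow> finite F \<Longrightarrow> F \<subseteq> S \<Longrightarrow> (\<Sum>s\<in>F. zmul (n s) (v s)) = 0 \<Longrightarrow> s \<in> F \<Longrightarrow> m dvd n s"
  unfolding indep_def by blast

text \<open>A dependence that arises by adding \<open>y\<close> to \<open>S\<close> has a coefficient at \<open>y\<close> that \<open>m\<close> does not divide. Otherwise the
term of \<open>y\<close> vanishes, and a dependence within \<open>S\<close> remains.\<close>

lemma maximal_indep:
  fixes v :: "'i \<Rightarrow> 'g::ab_group_add"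
  assumes m: "\<not> m dvd 1" and tors: "\<And>y. y \<in> Y \<Longrightarrow> zmul m (v y) = 0"
  obtains S where "S \<subseteq> Y" "indep m v S" "\<And>y. y \<in> Y \<Longrightarrow> \<exists>k. \<not> m dvd k \<and> zmul k (v y) \<in> gen (v ` S)"
proof -
  define \<A> where "\<A> = {S. S \<subseteq> Y \<and> indep m v S}"
  have "\<exists>M\<in>\<A>. \<forall>X\<in>\<A>. M \<subseteq> X \<longrightarrow> X = M"
  proof (rule subset_Zorn_nonempty)
    have "{} \<in> \<A>" by (auto simp: \<A>_def indep_def)
    then show "\<A> \<noteq> {}" by blast
    fix \<C> assume C: "\<C> \<noteq> {}" "subset.chain \<A> \<C>"
    then have CA: "X \<subseteq> Y" "indep m v X" if "X \<in> \<C>" for X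
      using that by (auto simp: subset.chain_def \<A>_def)
    have "indep m v (\<Union>\<C>)"
      unfolding indep_def
    proof (intro allI impI)
      fix F n assume F: "finite F" "F \<subseteq> \<Union>\<C>" and sum: "(\<Sum>s\<in>F. zmul (n s) (v s)) = 0"
      obtain X where "X \<in> \<C>" "F \<subseteq> X" using finite_subset_Union_chain[OF F C] by blast
      then show "\<forall>s\<in>F. m dvd n s" using indepD[OF CA(2) F(1) _ sum] by blast
    qed
    then show "\<Union>\<C> \<in> \<A>" using CA(1) by (auto simp: \<A>_def)
  qed
  then obtain S where S\<A>: "S \<in> \<A>" and max: "\<forall>X\<in>\<A>. S \<subseteq> X \<longrightarrow> X = S" by blast
  then have S: "S \<subseteq> Y" "indep m v S" by (simp_all add: \<A>_def)
  have "\<exists>k. \<not> m dvd k \<and> zmul k (v y) \<in> gen (v ` S)" if y: "y \<in> Y" for y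
  proof (cases "y \<in> S")
    case True
    then show ?thesis using m by (intro exI[of _ 1]) (auto intro: gen_incl)
  next
    case False
    then have "insert y S \<notin> \<A>" using max by blast
    then have "\<not> indep m v (insert y S)" using S(1) y by (simp add: \<A>_def)
    then obtain F n s where F: "finite F" "F \<subseteq> insert y S" "(\<Sum>s\<in>F. zmul (n s) (v s)) = 0" "s \<in> F" "\<not> m dvd n s"
      unfolding indep_def by blast
    have yF: "y \<in> F" using indepD[OF S(2) F(1) _ F(3,4)] F(2,5) by blast
    have split: "zmul (n y) (v y) + (\<Sum>s\<in>F - {y}. zmul (n s) (v s)) = 0"
      using F(3) sum.remove[OF F(1) yF, of "\<lambda>s. zmul (n s) (v s)"] by simp
    have FS: "F - {y} \<subseteq> S" "finite (F - {y})" using F(1,2) by auto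
    have "\<not> m dvd n y"
    proof
      assume dvd: "m dvd n y"
      then have "zmul (n y) (v y) = 0" by (rule zmul_dvd_eq_0[OF tors[OF y]])
      then have "(\<Sum>s\<in>F - {y}. zmul (n s) (v s)) = 0" using split by simp
      then have "s \<noteq> y \<Longrightarrow> m dvd n s" using indepD[OF S(2) FS(2,1)] F(4) by blast
      then show False using F(5) dvd by blast
    qed
    moreover have "zmul (n y) (v y) = - (\<Sum>s\<in>F - {y}. zmul (n s) (v s))"
      using split by (simp add: eq_neg_iff_add_eq_0)
    moreover have "(\<Sum>s\<in>F - {y}. zmul (n s) (v s)) \<in> gen (v ` S)"
      unfolding gen_family using FS by blast
    ultimately show ?thesis using add_subgroupD(3)[OF add_subgroup_gen] by metis
  qed
  then show ?thesis using S that by blast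
qed

lemma not_card_of_ordLeqD: "\<not> |A| \<le>o |B| \<Longrightarrow> |B| <o |A|"
  by (simp add: not_ordLeq_iff_ordLess card_of_Well_order)

lemma finite_card_ordLess: "finite A \<Longrightarrow> infinite C \<Longrightarrow> |A| <o |C|"
  using finite_ordLess_infinite[OF card_of_Well_order card_of_Well_order] by (simp add: Field_card_of)

lemma card_of_lists_infinite:
  assumes "infinite A" shows "|lists A| \<le>o |A|"
proof -
  have "|{l \<in> lists A. length l = n}| \<le>o |A|" for n
  proof (induction n)
    case 0
    have "|{l \<in> lists A. length l = 0}| \<le>o |{[] :: 'a list}|" by (rule card_of_mono1) auto
    also have "|{[] :: 'a list}| \<le>o |A|"
      using assms by (intro ordLess_imp_ordLeq finite_card_ordLess) auto
    finally show ?case .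
  next
    case (Suc n)
    have eq: "{l \<in> lists A. length l = Suc n} = (\<lambda>(x, l). x # l) ` (A \<times> {l \<in> lists A. length l = n})"
      by (auto simp: length_Suc_conv image_iff)
    have "|{l \<in> lists A. length l = Suc n}| \<le>o |A \<times> {l \<in> lists A. length l = n}|"
      unfolding eq by (rule card_of_image)
    also have "|A \<times> {l \<in> lists A. length l = n}| \<le>o |A|"
      by (rule card_of_Sigma_ordLeq_infinite[OF assms]) (simp_all add: Suc card_of_mono1)
    finally show ?case .
  qed
  moreover have "|UNIV :: nat set| \<le>o |A|" using assms infinite_iff_card_of_nat by blast
  ultimately have "|\<Union>n. {l \<in> lists A. length l = n}| \<le>o |A|"
    by (intro card_of_UNION_ordLeq_infinite assms) auto
  moreover have "(\<Union>n. {l \<in> lists A. length l = n}) = lists A" by auto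
  ultimately show ?thesis by simp
qed

lemma card_of_Times_ordLess:
  assumes C: "infinite C" and "|A| <o |C|" "|B| <o |C|"
  shows "|A \<times> B| <o |C|"
proof (cases "finite (A <+> B)")
  case True
  then have "finite (A \<times> B)" by auto
  then show ?thesis using C by (intro finite_card_ordLess)
next
  case False
  have sum: "|A <+> B| <o |C|" by (rule card_of_Plus_ordLess_infinite[OF C assms(2,3)])
  have "|A \<times> B| \<le>o |(A <+> B) \<times> (A <+> B)|"
    using card_of_Plus1 card_of_Plus2 card_of_Times_mono1 card_of_Times_mono2 ordLeq_transitive by metis
  also have "|(A <+> B) \<times> (A <+> B)| =o |A <+> B|" by (rule card_of_Times_same_infinite[OF False])
  finally have "|A \<times> B| \<le>o |A <+> B|" .
  then show ?thesis using sum by (rule ordLeq_ordLess_trans)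
qed

lemma countable_card_ordLess:
  fixes A :: "'a set"
  assumes "|UNIV :: nat set| <o |C|" "countable A"
  shows "|A| <o |C|"
proof -
  obtain f :: "'a \<Rightarrow> nat" where "inj_on f A" using assms(2) by (auto simp: countable_def)
  then have "|A| \<le>o |UNIV :: nat set|" using card_of_ordLeq[of A "UNIV :: nat set"] by blast
  then show ?thesis using assms(1) by (rule ordLeq_ordLess_trans)
qed

lemma card_lists_ordLess:
  assumes C: "|UNIV :: nat set| <o |C|" and B: "|B| <o |C|"
  shows "|lists B| <o |C|"
proof (cases "finite B")
  case True
  then show ?thesis by (intro countable_card_ordLess[OF C] countable_lists countable_finite)
next
  case False
  then show ?thesis using B card_of_lists_infinite ordLeq_ordLess_trans by blast
qed

lemma card_gen_ordLess:
  assumes C: "|UNIV :: nat set| <o |C|" and S: "|S| <o |C|"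
  shows "|gen S| <o |C|"
proof -
  have "infinite C"
    using C infinite_iff_card_of_nat ordLess_imp_ordLeq by blast
  then have "|(UNIV :: int set) \<times> S| <o |C|"
    by (intro card_of_Times_ordLess S countable_card_ordLess[OF C]) auto
  then have "|lists ((UNIV :: int set) \<times> S)| <o |C|" by (rule card_lists_ordLess[OF C])
  then show ?thesis unfolding gen_def using card_of_image ordLeq_ordLess_trans by blast
qed

text \<open>All fibres of multiplication by \<open>n\<close> are translates of subsets of the kernel.\<close>

lemma card_of_zmul_image_kernel:
  fixes \<Gamma> :: "'g::ab_group_add set"
  assumes \<Gamma>: "add_subgroup \<Gamma>" and "X \<subseteq> \<Gamma>"
  shows "|X| \<le>o |zmul n ` X \<times> {x \<in> \<Gamma>. zmul n x = 0}|"
proof -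
  define r where "r y = (SOME x. x \<in> X \<and> zmul n x = y)" for y
  have r: "r (zmul n x) \<in> X" "zmul n (r (zmul n x)) = zmul n x" if "x \<in> X" for x
    using someI[of "\<lambda>z. z \<in> X \<and> zmul n z = zmul n x" x] that by (simp_all add: r_def)
  define f where "f x = (zmul n x, x - r (zmul n x))" for x
  have "inj_on f X" by (rule inj_onI) (auto simp: f_def)
  moreover have "f ` X \<subseteq> zmul n ` X \<times> {x \<in> \<Gamma>. zmul n x = 0}"
    using r assms(2) by (auto simp: f_def zmul_diff_right intro!: add_subgroupD(4)[OF \<Gamma>])
  ultimately show ?thesis using card_of_ordLeq by blast
qed

lemma zmul_coprime_eq_0:
  assumes "zmul m x = 0" "zmul k x = 0" "coprime m k" shows "x = 0"
proof -
  obtain u v where "u * m + v * k = 1" using bezout_int[of m k] assms(3) by auto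
  then have "x = zmul (u * m + v * k) x" by simp
  also have "\<dots> = 0" using assms by (simp only: zmul_distrib_left zmul_mult) simp
  finally show ?thesis .
qed

text \<open>Let \<open>I0\<close> be maximal independent over the integers. If it is too small, the subgroup generated by it is small as
well, and \<open>\<Gamma>\<close> is the countable union of the sets of elements with \<open>n x\<close> in it. By the hypothesis on countable covers
one of these sets is large, hence so is some torsion subgroup \<open>T n\<close>. The least such \<open>n\<close> is a
prime \<open>p\<close>, and a basis of \<open>T p\<close> over the field with \<open>p\<close> elements is large too.\<close>

theorem large_indep:
  fixes \<Gamma> :: "'g::ab_group_add set" and Y :: "'y set"
  assumes \<Gamma>: "add_subgroup \<Gamma>" and le: "|Y| \<le>o |\<Gamma>|" and nat: "|UNIV :: nat set| <o |Y|"
    and cof: "\<And>A :: nat \<Rightarrow> 'y set. Y \<subseteq> (\<Union>n. A n) \<Longrightarrow> \<exists>n. |Y| \<le>o |A n|"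
  obtains m I where "m = 0 \<or> prime m" "I \<subseteq> \<Gamma>" "indep m (\<lambda>x. x) I" "\<And>x. x \<in> I \<Longrightarrow> zmul m x = 0" "|Y| \<le>o |I|"
proof -
  have inf: "infinite Y" using nat infinite_iff_card_of_nat ordLess_imp_ordLeq by blast
  define T where "T n = {x \<in> \<Gamma>. zmul (int n) x = 0}" for n
  have step: "|Y| \<le>o |T n|" if "X \<subseteq> \<Gamma>" "|Y| \<le>o |X|" "|zmul (int n) ` X| <o |Y|" for X n
  proof (rule ccontr)
    assume "\<not> ?thesis"
    then have "|T n| <o |Y|" by (rule not_card_of_ordLeqD)
    then have "|zmul (int n) ` X \<times> T n| <o |Y|" using that(3) by (intro card_of_Times_ordLess inf)
    moreover have "|X| \<le>o |zmul (int n) ` X \<times> T n|"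
      unfolding T_def by (rule card_of_zmul_image_kernel[OF \<Gamma> that(1)])
    ultimately have "|X| <o |Y|" by (meson ordLeq_ordLess_trans)
    then show False using that(2) not_ordLess_ordLeq by blast
  qed
  obtain I0 where I0: "I0 \<subseteq> \<Gamma>" "indep 0 (\<lambda>x. x) I0"
    "\<And>y. y \<in> \<Gamma> \<Longrightarrow> \<exists>k. \<not> 0 dvd k \<and> zmul k y \<in> gen ((\<lambda>x. x) ` I0)"
    by (rule maximal_indep[of 0 \<Gamma> "\<lambda>x. x"]) simp_all
  show ?thesis
  proof (cases "|Y| \<le>o |I0|")
    case True
    then show ?thesis using I0 by (intro that[of 0 I0]) auto
  next
    case False
    then have "|I0| <o |Y|" by (rule not_card_of_ordLeqD)
    then have gen0: "|gen I0| <o |Y|" by (rule card_gen_ordLess[OF nat])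
    obtain \<iota> where \<iota>: "inj_on \<iota> Y" "\<iota> ` Y \<subseteq> \<Gamma>" using le card_of_ordLeq[of Y \<Gamma>] by blast
    define A where "A n = {y \<in> Y. zmul (int (Suc n)) (\<iota> y) \<in> gen I0}" for n
    have "Y \<subseteq> (\<Union>n. A n)"
    proof
      fix y assume y: "y \<in> Y"
      then obtain k where k: "k \<noteq> 0" "zmul k (\<iota> y) \<in> gen I0"        using I0(3)[of "\<iota> y"] subsetD[OF \<iota>(2) imageI[OF y]] by auto
      have "zmul \<bar>k\<bar> (\<iota> y) \<in> gen I0"
        using k(2) add_subgroupD(3)[OF add_subgroup_gen k(2)] by (auto simp: abs_if zmul_minus_left)
      moreover have "int (Suc (nat \<bar>k\<bar> - 1)) = \<bar>k\<bar>" using k(1) by simp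
      ultimately have "y \<in> A (nat \<bar>k\<bar> - 1)" using y unfolding A_def by simp
      then show "y \<in> (\<Union>n. A n)" by blast
    qed
    then obtain n0 where n0: "|Y| \<le>o |A n0|" using cof by blast
    define X where "X = \<iota> ` A n0"
    have "A n0 \<subseteq> Y" by (auto simp: A_def)
    then have "|A n0| \<le>o |X|" unfolding X_def
      using \<iota>(1) by (intro card_of_ordLeq[THEN iffD1] exI[of _ \<iota>]) (auto intro: inj_on_subset)
    then have YX: "|Y| \<le>o |X|" using n0 ordLeq_transitive by blast
    have "zmul (int (Suc n0)) ` X \<subseteq> gen I0" by (auto simp: X_def A_def)
    then have "|zmul (int (Suc n0)) ` X| <o |Y|"
      using gen0 card_of_mono1 ordLeq_ordLess_trans by blast
    moreover have "X \<subseteq> \<Gamma>" using \<iota>(2) by (auto simp: X_def A_def)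
    ultimately have ex: "\<exists>n. n > 0 \<and> |Y| \<le>o |T n|" using step[OF _ YX] by blast
    define p where "p = (LEAST n. n > 0 \<and> |Y| \<le>o |T n| )"
    have p: "p > 0" "|Y| \<le>o |T p|" using LeastI_ex[OF ex] by (simp_all add: p_def)
    have small: "|T n| <o |Y|" if "0 < n" "n < p" for n
      using not_less_Least[OF that(2)[unfolded p_def]] that(1) by (intro not_card_of_ordLeqD) blast
    have T_sub: "T n \<subseteq> \<Gamma>" for n by (auto simp: T_def)
    have "p \<noteq> 1"
    proof
      assume "p = 1"
      then have "T p \<subseteq> {0}" by (auto simp: T_def)
      then have "finite (T p)" by (rule finite_subset) simp
      then show False using p(2) inf card_of_ordLeq_infinite by blast
    qed
    have "prime p"
      unfolding prime_nat_iff
    proof (intro conjI allI impI)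
      show "1 < p" using p(1) \<open>p \<noteq> 1\<close> by simp
      fix a assume "a dvd p"
      then obtain b where ab: "p = a * b" by (auto simp: dvd_def)
      show "a = 1 \<or> a = p"
      proof (rule ccontr)
        assume "\<not> ?thesis"
        then have lt: "0 < a" "a < p" "0 < b" "b < p" using ab p(1) by (auto intro: ccontr)
        have "zmul (int a) ` T p \<subseteq> T b"
          using ab by (auto simp: T_def zmul_mult[symmetric] mult.commute add_subgroup_zmul[OF \<Gamma>])
        then have "|zmul (int a) ` T p| <o |Y|"
          using small[OF lt(3,4)] card_of_mono1 ordLeq_ordLess_trans by blast
        then have "|Y| \<le>o |T a|" by (rule step[OF T_sub p(2)])
        then show False using small[OF lt(1,2)] not_ordLess_ordLeq by blast
      qed
    qed
    obtain I where I: "I \<subseteq> T p" "indep (int p) (\<lambda>x. x) I"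
      "\<And>y. y \<in> T p \<Longrightarrow> \<exists>k. \<not> int p dvd k \<and> zmul k y \<in> gen ((\<lambda>x. x) ` I)"
    proof (rule maximal_indep[of "int p" "T p" "\<lambda>x. x"])
      show "\<not> int p dvd 1" using \<open>p \<noteq> 1\<close> by simp
      show "zmul (int p) y = 0" if "y \<in> T p" for y using that by (simp add: T_def)
    qed (rule that)
    have "|Y| \<le>o |I|"
    proof (rule ccontr)
      assume "\<not> ?thesis"
      then have "|I| <o |Y|" by (rule not_card_of_ordLeqD)
      then have "|gen I| <o |Y|" by (rule card_gen_ordLess[OF nat])
      then have lt: "|(UNIV :: int set) \<times> gen I| <o |Y|"
        by (rule card_of_Times_ordLess[OF inf countable_card_ordLess[OF nat], rotated]) simp
      obtain k where k: "\<And>y. y \<in> T p \<Longrightarrow> \<not> int p dvd k y" "\<And>y. y \<in> T p \<Longrightarrow> zmul (k y) y \<in> gen I"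
        using I(3) unfolding image_ident by metis
      \<comment> \<open>Multiplication by an integer prime to \<open>p\<close> is injective on \<open>T p\<close>.\<close>
      have "inj_on (\<lambda>y. (k y, zmul (k y) y)) (T p)"
      proof (rule inj_onI)
        fix x y assume xy: "x \<in> T p" "y \<in> T p" "(k x, zmul (k x) x) = (k y, zmul (k y) y)"
        have eq: "k x = k y" "zmul (k x) x = zmul (k y) y" using xy(3) unfolding prod.inject by blast+
        have "zmul (int p) (x - y) = 0" using xy(1,2) by (simp add: T_def zmul_diff_right)
        moreover have "zmul (k x) (x - y) = 0" using eq by (simp add: zmul_diff_right)
        moreover have "coprime (int p) (k x)" using k(1)[OF xy(1)] \<open>prime p\<close> by (intro prime_imp_coprime) auto
        ultimately have "x - y = 0" by (rule zmul_coprime_eq_0)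
        then show "x = y" by simp
      qed
      moreover have "(\<lambda>y. (k y, zmul (k y) y)) ` T p \<subseteq> UNIV \<times> gen I" using k(2) by auto
      ultimately have "|T p| \<le>o |(UNIV :: int set) \<times> gen I|" using card_of_ordLeq by blast
      then have "|T p| <o |Y|" using lt ordLeq_ordLess_trans by blast
      then show False using p(2) not_ordLess_ordLeq by blast
    qed
    then show ?thesis using I \<open>prime p\<close> by (intro that[of "int p" I]) (auto simp: T_def)
  qed
qed

section \<open>Null sets of the circle\<close>

lemma haar_null_subset: "haar_null A \<Longrightarrow> B \<subseteq> A \<Longrightarrow> haar_null B"
  unfolding haar_null_def by (rule null_sets_completion_subset[OF image_mono])

lemma haar_null_UN:
  fixes A :: "'i::countable \<Rightarrow> circle set"
  assumes "\<And>i. haar_null (A i)" shows "haar_null (\<Union>i. A i)"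
  using assms unfolding haar_null_def image_UN by (intro null_sets_UN) auto

lemma haar_null_countable: "countable A \<Longrightarrow> haar_null A"
  unfolding haar_null_def by (intro null_sets_completionI countable_imp_null_set_lborel) auto

abbreviation period :: "real set" where "period \<equiv> {-1/2<..1/2}"

lemma haar_null_if_real_null:
  assumes "{r \<in> period. to_circle r \<in> A} \<in> null_sets lborel"
  shows "haar_null A"
proof -
  have "rep_circle ` A \<subseteq> {r \<in> period. to_circle r \<in> A}" using rep_circle by auto
  then show ?thesis unfolding haar_null_def
    using null_sets_completion_subset null_sets_completionI[OF assms] by blast
qed

lemma set_integrable_bounded_period:
  fixes g :: "real \<Rightarrow> complex"
  assumes "g \<in> borel_measurable borel" "\<And>r. norm (g r) \<le> B" "J \<in> sets borel" "emeasure lborel J < \<infinity>"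
  shows "set_integrable lborel J g"
  unfolding set_integrable_def using assms
  by (intro integrableI_bounded_set[where A = J and B = B]) (auto simp: indicator_def)

lemma integral_period_shift:
  fixes g :: "real \<Rightarrow> complex"
  assumes g: "g \<in> borel_measurable borel" "\<And>r. norm (g r) \<le> B" and per: "\<And>r. g (r + 1) = g r"
    and s: "0 \<le> s" "s \<le> 1"
  shows "(LINT r:period|lborel. g (r + s)) = (LINT r:period|lborel. g r)"
proof -
  have int: "set_integrable lborel {a<..b} g" for a b
    by (rule set_integrable_bounded_period[OF g]) (cases "a \<le> b"; simp)+
  have shift: "(LINT r:{a<..b}|lborel. g (r + t)) = (LINT r:{a + t<..b + t}|lborel. g r)" for a b t
  proof -
    have "(LINT r:{a + t<..b + t}|lborel. g r) = (LINT r|lborel. indicator {a + t<..b + t} (t + 1 * r) *\<^sub>R g (t + 1 * r))"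
      unfolding set_lebesgue_integral_def by (subst lborel_integral_real_affine[of 1 _ t]) auto
    also have "\<dots> = (LINT r:{a<..b}|lborel. g (r + t))"
      unfolding set_lebesgue_integral_def
      by (intro Bochner_Integration.integral_cong) (auto simp: indicator_def add.commute)
    finally show ?thesis by simp
  qed
  have un: "(LINT r:{a<..c}|lborel. g r) = (LINT r:{a<..b}|lborel. g r) + (LINT r:{b<..c}|lborel. g r)"
    if "a \<le> b" "b \<le> c" for a b c
  proof -
    have "{a<..c} = {a<..b} \<union> {b<..c}" using that by auto
    then show ?thesis using int by (simp add: set_integral_Un)
  qed
  have "(LINT r:period|lborel. g (r + s)) = (LINT r:{-1/2+s<..1/2+s}|lborel. g r)"
    by (rule shift)
  also have "\<dots> = (LINT r:{-1/2+s<..1/2}|lborel. g r) + (LINT r:{1/2<..1/2+s}|lborel. g r)"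
    using s by (intro un) auto
  also have "(LINT r:{1/2<..1/2+s}|lborel. g r) = (LINT r:{-1/2<..-1/2+s}|lborel. g r)"
    using shift[of "-1/2" "-1/2 + s" 1] by (simp add: per add.commute)
  also have "(LINT r:{-1/2+s<..1/2}|lborel. g r) + (LINT r:{-1/2<..-1/2+s}|lborel. g r) = (LINT r:period|lborel. g r)"
    using un[of "-1/2" "-1/2 + s" "1/2"] s by simp
  finally show ?thesis .
qed

text \<open>The representatives in \<open>(-1/2, 1/2]\<close> are replaced by nonnegative ones to match \<open>integral_period_shift\<close>.\<close>

lemma to_circle_surj:
  obtains s where "0 \<le> s" "s \<le> 1" "to_circle s = t"
proof (cases "0 \<le> rep_circle t")
  case True
  then show ?thesis using rep_circle_bounds[of t] by (intro that[of "rep_circle t"]) auto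
next
  case False
  then show ?thesis using rep_circle_bounds[of t] to_circle_add_int[of "rep_circle t" 1]
    by (intro that[of "rep_circle t + 1"]) auto
qed

section \<open>Sequences of functions that converge almost nowhere\<close>

text \<open>Cut off outside \<open>\<A>\<close>, so that equality of evaluations is equality on \<open>\<A>\<close>.\<close>

definition ev :: "(circle \<Rightarrow> circle) set \<Rightarrow> circle \<Rightarrow> (circle \<Rightarrow> circle) \<Rightarrow> circle" where
  "ev \<A> y a = (if a \<in> \<A> then a y else 0)"

text \<open>Countably many coordinates map \<open>K\<close> to a compact metrizable space, where sequences have convergent subsequences.\<close>

lemma compact_sequence:
  fixes f :: "'i \<Rightarrow> 'a::topological_space \<Rightarrow> circle"
  assumes K: "compact K" and "countable S" and f: "\<And>s. s \<in> S \<Longrightarrow> continuous_on K (f s)"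
    and x: "\<And>j. x j \<in> K"
  shows "\<exists>z\<in>K. \<exists>u :: nat \<Rightarrow> nat. strict_mono u \<and> (\<forall>s\<in>S. (\<lambda>j. f s (x (u j))) \<longlonglongrightarrow> f s z)"
proof (cases "S = {}")
  case True
  then show ?thesis using x by (intro bexI[of _ "x 0"] exI[of _ id]) (auto simp: strict_mono_def)
next
  case False
  define \<Phi> where "\<Phi> g i = f (from_nat_into S i) g" for g and i :: nat
  have "continuous_on K \<Phi>"
    unfolding \<Phi>_def[abs_def] using from_nat_into[OF False] f
    by (intro continuous_on_coordinatewise_then_product) blast
  then have "compact (\<Phi> ` K)" using K by (rule compact_continuous_image)
  then have "seq_compact (\<Phi> ` K)" by (rule compact_imp_seq_compact)
  moreover have "\<forall>j. \<Phi> (x j) \<in> \<Phi> ` K" using x by blast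
  ultimately obtain l u where u: "l \<in> \<Phi> ` K" "strict_mono (u :: nat \<Rightarrow> nat)" "((\<lambda>j. \<Phi> (x j)) \<circ> u) \<longlonglongrightarrow> l"
    unfolding seq_compact_def by meson
  then obtain z where z: "z \<in> K" "l = \<Phi> z" by blast
  show ?thesis
  proof (intro bexI[OF _ z(1)] exI[of _ u] conjI u(2) ballI)
    fix s assume "s \<in> S"
    then obtain i where i: "s = from_nat_into S i" using from_nat_into_surj[OF assms(2)] by metis
    have "(\<lambda>j. ((\<lambda>j. \<Phi> (x j)) \<circ> u) j i) \<longlonglongrightarrow> l i"
      by (rule continuous_on_tendsto_compose[OF continuous_on_product_coordinates u(3)]) auto
    then show "(\<lambda>j. f s (x (u j))) \<longlonglongrightarrow> f s z" by (simp add: \<Phi>_def i z(2))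
  qed
qed

lemma convergent_subsequence:
  fixes b :: "nat \<Rightarrow> 'i \<Rightarrow> circle"
  assumes "countable S"
  obtains r where "strict_mono (r :: nat \<Rightarrow> nat)" "\<And>s. s \<in> S \<Longrightarrow> convergent (\<lambda>j. b (r j) s)"
proof -
  have "\<exists>z\<in>UNIV. \<exists>r :: nat \<Rightarrow> nat. strict_mono r \<and> (\<forall>s\<in>S. (\<lambda>j. b (r j) s) \<longlonglongrightarrow> z s)"
    by (rule compact_sequence[where f = "\<lambda>s x. x s", OF compact_fun_circle assms])
       (auto intro: continuous_on_product_coordinates)
  then show ?thesis using that unfolding convergent_def by blast
qed

text \<open>The shift property says that the composition of \<open>a\<close> with \<open>circle_exp\<close> is an eigenfunction of a rotation
with an eigenvalue different from 1, so that its integral vanishes.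
The torsion
conditions make the elements of \<open>\<A>\<close> possible values of a homomorphism on characters of order \<open>m\<close>.\<close>

locale circle_functions =
  fixes m :: int and \<A> :: "(circle \<Rightarrow> circle) set"
  assumes subgroup: "add_subgroup \<A>" and countable: "countable \<A>" and infinite: "infinite \<A>"
    and measurable: "a \<in> \<A> \<Longrightarrow> (\<lambda>r. circle_exp (a (to_circle r))) \<in> borel_measurable borel"
    and torsion: "a \<in> \<A> \<Longrightarrow> zmul m a = 0"
    and no_other_torsion: "a \<in> \<A> \<Longrightarrow> zmul k a = 0 \<Longrightarrow> \<not> m dvd k \<Longrightarrow> a = 0"
    and shift: "a \<in> \<A> \<Longrightarrow> a \<noteq> 0 \<Longrightarrow> \<exists>t c. c \<noteq> 0 \<and> (\<forall>y. a (y + t) = a y + c)"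
begin

lemma integral_nonzero:
  assumes a: "a \<in> \<A>" "a \<noteq> 0"
  shows "(LINT r:period|lborel. circle_exp (a (to_circle r))) = 0"
proof -
  obtain t c where c: "c \<noteq> 0" "\<And>y. a (y + t) = a y + c" using shift[OF a] by blast
  obtain s where s: "0 \<le> s" "s \<le> 1" "to_circle s = t" by (rule to_circle_surj)
  define g where "g r = circle_exp (a (to_circle r))" for r
  have "(LINT r:period|lborel. g (r + s)) = (LINT r:period|lborel. g r)"
  proof (rule integral_period_shift[where B = 1])
    show "g \<in> borel_measurable borel" using measurable[OF a(1)] by (simp add: g_def[abs_def])
    show "g (r + 1) = g r" for r using to_circle_add_int[of r 1] by (simp add: g_def)
  qed (auto simp: g_def s)
  moreover have "g (r + s) = circle_exp c * g r" for r
    by (simp add: g_def to_circle_add s c circle_exp_add)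
  ultimately have "circle_exp c * (LINT r:period|lborel. g r) = (LINT r:period|lborel. g r)"
    by simp
  then have "(circle_exp c - 1) * (LINT r:period|lborel. g r) = 0" by (simp add: left_diff_distrib)
  then show ?thesis using c(1) by (simp add: g_def circle_exp_eq_1_iff)
qed

text \<open>Put \<open>u j = b j - b 0\<close>. The functions \<open>E (u j)\<close> are orthonormal, so the sum \<open>S\<close> of \<open>n\<close> of them has
squared norm \<open>n\<close>, while \<open>\<bar>S\<bar> \<ge> n / 2\<close> on the set in question. Hence its measure is at most \<open>4 / n\<close>.\<close>

lemma close_to_start_null:
  assumes b: "range b \<subseteq> \<A>" "inj (b :: nat \<Rightarrow> circle \<Rightarrow> circle)"
  shows "haar_null {y. \<forall>j. Re (circle_exp (b j y - b 0 y)) \<ge> 1/2}"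
proof (rule haar_null_if_real_null)
  define E where "E a r = circle_exp (a (to_circle r))" for a :: "circle \<Rightarrow> circle" and r
  define u where "u j = b j - b 0" for j
  have b\<A>: "b j \<in> \<A>" for j using b(1) by auto
  have u: "u j \<in> \<A>" for j unfolding u_def by (intro add_subgroupD(4)[OF subgroup] b\<A>)
  have uu: "u j - u k \<in> \<A>" for j k by (intro add_subgroupD(4)[OF subgroup] u)
  have E_meas [measurable]: "E a \<in> borel_measurable borel" if "a \<in> \<A>" for a
    using measurable[OF that] by (simp add: E_def[abs_def])
  have E_int: "set_integrable lborel period (E a)" if "a \<in> \<A>" for a
    by (rule set_integrable_bounded_period[OF E_meas[OF that], of 1]) (auto simp: E_def)
  define B where "B = {r \<in> period. \<forall>j. Re (E (u j) r) \<ge> 1/2}"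
  have B_eq: "{r \<in> period. to_circle r \<in> {y. \<forall>j. Re (circle_exp (b j y - b 0 y)) \<ge> 1/2}} = B"
    by (simp add: B_def E_def u_def)
  have B_set: "B \<in> sets lborel"
  proof -
    have "{r. Re (E (u j) r) \<ge> 1/2} \<in> sets borel" for j
    proof -
      have "(\<lambda>r. Re (E (u j) r)) \<in> borel_measurable borel" using E_meas[OF u[of j]] by measurable
      then show ?thesis using borel_measurable_le[of "\<lambda>_. 1/2" borel "\<lambda>r. Re (E (u j) r)"] by simp
    qed
    then have "period \<inter> (\<Inter>j. {r. Re (E (u j) r) \<ge> 1/2}) \<in> sets borel"
      by (intro sets.Int sets.countable_INT'') auto
    moreover have "B = period \<inter> (\<Inter>j. {r. Re (E (u j) r) \<ge> 1/2})" by (auto simp: B_def)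
    ultimately show ?thesis by simp
  qed
  have B_fin: "emeasure lborel B \<le> 1"
  proof -
    have "emeasure lborel B \<le> emeasure lborel period" by (intro emeasure_mono) (auto simp: B_def)
    then show ?thesis by simp
  qed
  have bound: "measure lborel B * (real n / 4) \<le> 1" if n: "n > 0" for n :: nat
  proof -
    define S where "S r = (\<Sum>j<n. E (u j) r)" for r
    have sq: "complex_of_real ((norm (S r))\<^sup>2) = (\<Sum>j<n. \<Sum>k<n. E (u j - u k) r)" for r
    proof -
      have "complex_of_real ((norm (S r))\<^sup>2) = S r * cnj (S r)" by (simp only: complex_norm_square)
      then show ?thesis by (simp add: S_def sum_product E_def circle_exp_diff)
    qed
    have int: "(LINT r:period|lborel. E (u j - u k) r) = (if j = k then 1 else 0)" for j k
    proof (cases "j = k")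
      case True
      then have "E (u j - u k) = (\<lambda>_. 1)" by (auto simp: E_def)
      then show ?thesis using True by (simp add: set_lebesgue_integral_def)
    next
      case False
      then have "u j - u k \<noteq> 0" using b(2) by (auto simp: u_def dest: injD)
      then show ?thesis using integral_nonzero[OF uu] False by (simp add: E_def[abs_def])
    qed
    have "(LINT r:period|lborel. complex_of_real ((norm (S r))\<^sup>2)) = (\<Sum>j<n. \<Sum>k<n. LINT r:period|lborel. E (u j - u k) r)"
      unfolding sq using E_int[OF uu] unfolding set_integrable_def
      by (simp only: set_lebesgue_integral_def scaleR_sum_right Bochner_Integration.integral_sum
          Bochner_Integration.integrable_sum)
    also have "\<dots> = of_nat n" by (simp only: int) simp
    finally have "(LINT r:period|lborel. complex_of_real ((norm (S r))\<^sup>2)) = of_nat n" .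
    moreover have "(LINT r:period|lborel. complex_of_real ((norm (S r))\<^sup>2)) = of_real (LINT r:period|lborel. (norm (S r))\<^sup>2)"
      by (rule set_integral_complex_of_real)
    ultimately have S_int: "(LINT r:period|lborel. (norm (S r))\<^sup>2) = real n"
      by (metis of_real_eq_iff of_real_of_nat_eq)
    have "(LINT r:B|lborel. (real n / 2)\<^sup>2) \<le> (LINT r:period|lborel. (norm (S r))\<^sup>2)"
      unfolding set_lebesgue_integral_def
    proof (rule integral_mono')
      have "S \<in> borel_measurable borel" unfolding S_def[abs_def] using E_meas[OF u] by measurable
      then have "set_integrable lborel period (\<lambda>r. complex_of_real ((norm (S r))\<^sup>2))"
      proof (intro set_integrable_bounded_period[where B = "(real n)\<^sup>2"])
        show "norm (complex_of_real ((norm (S r))\<^sup>2)) \<le> (real n)\<^sup>2" for r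
        proof -
          have "norm (S r) \<le> (\<Sum>j<n. 1)"
            unfolding S_def by (intro order_trans[OF norm_sum] sum_mono) (simp add: E_def)
          then show ?thesis by (simp add: norm_power power_mono)
        qed
      qed auto
      then have "integrable lborel (\<lambda>r. Re (indicator period r *\<^sub>R complex_of_real ((norm (S r))\<^sup>2)))"
        unfolding set_integrable_def by (rule integrable_Re)
      then show "integrable lborel (\<lambda>r. indicator period r *\<^sub>R (norm (S r))\<^sup>2)" by simp
      fix r :: real
      show "0 \<le> indicator period r *\<^sub>R (norm (S r))\<^sup>2" by simp
      show "indicator B r *\<^sub>R (real n / 2)\<^sup>2 \<le> indicator period r *\<^sub>R (norm (S r))\<^sup>2"
      proof (cases "r \<in> B")
        case True
        then have "(\<Sum>j<n. 1/2) \<le> (\<Sum>j<n. Re (E (u j) r))" by (intro sum_mono) (auto simp: B_def)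
        then have "real n / 2 \<le> Re (S r)" by (simp add: S_def)
        then have "real n / 2 \<le> norm (S r)" using complex_Re_le_cmod[of "S r"] by linarith
        then have "(real n / 2)\<^sup>2 \<le> (norm (S r))\<^sup>2" by (intro power_mono) auto
        then show ?thesis using True by (simp add: B_def)
      qed simp
    qed
    also have "(LINT r:B|lborel. (real n / 2)\<^sup>2) = measure lborel B * (real n / 2)\<^sup>2"
      using B_set B_fin by (simp add: set_lebesgue_integral_def order_le_less_trans)
    finally have "measure lborel B * (real n / 2)\<^sup>2 \<le> real n" unfolding S_int .
    then have "real n * (measure lborel B * (real n / 4)) \<le> real n * 1" by (simp add: power2_eq_square field_simps)
    then show ?thesis using n by (simp only: mult_le_cancel_left_pos of_nat_0_less_iff)
  qed
  have "measure lborel B = 0"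
  proof (rule ccontr)
    assume "measure lborel B \<noteq> 0"
    then have pos: "measure lborel B > 0" by (simp add: less_le)
    obtain n :: nat where "4 / measure lborel B < real n" using reals_Archimedean2 by blast
    moreover from this have "n > 0" using pos by (cases n) (auto simp: field_simps not_less)
    ultimately show False using bound[of n] pos by (simp add: field_simps)
  qed
  moreover have "emeasure lborel B \<noteq> \<infinity>" using B_fin by (auto simp: top_unique)
  ultimately have "emeasure lborel B = 0" by (simp add: measure_def enn2real_eq_0_iff)
  then show "{r \<in> period. to_circle r \<in> {y. \<forall>j. Re (circle_exp (b j y - b 0 y)) \<ge> 1/2}} \<in> null_sets lborel"
    unfolding B_eq using B_set by (auto simp: null_sets_def)
qed

text \<open>A convergent sequence is eventually close to one of its terms.\<close>

lemma convergent_null: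
  assumes b: "range b \<subseteq> \<A>" "inj (b :: nat \<Rightarrow> circle \<Rightarrow> circle)"
  shows "haar_null {y. convergent (\<lambda>j. b j y)}"
proof (rule haar_null_subset)
  show "haar_null (\<Union>N. {y. \<forall>j. Re (circle_exp (b (N + j) y - b (N + 0) y)) \<ge> 1/2})"
  proof (rule haar_null_UN)
    fix N
    have "range (\<lambda>j. b (N + j)) \<subseteq> \<A>" "inj (\<lambda>j. b (N + j))"
      using b by (auto intro!: injI dest: injD)
    then show "haar_null {y. \<forall>j. Re (circle_exp (b (N + j) y - b (N + 0) y)) \<ge> 1/2}"
      by (rule close_to_start_null)
  qed
  show "{y. convergent (\<lambda>j. b j y)} \<subseteq> (\<Union>N. {y. \<forall>j. Re (circle_exp (b (N + j) y - b (N + 0) y)) \<ge> 1/2})"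
  proof
    fix y assume "y \<in> {y. convergent (\<lambda>j. b j y)}"
    then have "Cauchy (\<lambda>j. b j y)" by (auto simp: convergent_def intro: LIMSEQ_imp_Cauchy)
    \<comment> \<open>The bound \<open>2 * pi / 20 < 1/2\<close> gives real part at least \<open>1/2\<close>.\<close>
    then obtain N where N: "\<And>i j. i \<ge> N \<Longrightarrow> j \<ge> N \<Longrightarrow> dist (b i y) (b j y) < 1/20"
      unfolding Cauchy_def by (metis zero_less_divide_1_iff zero_less_numeral)
    have "Re (circle_exp (b (N + j) y - b (N + 0) y)) \<ge> 1/2" for j
    proof -
      have "norm (circle_exp (b (N + j) y - b (N + 0) y) - 1) \<le> 2 * pi * dist (b (N + j) y) (b (N + 0) y)"
        using dist_circle_exp_le[of "b (N + j) y" "b (N + 0) y"] by (simp only: dist_norm norm_circle_exp_diff)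
      also have "\<dots> \<le> 2 * 4 * (1/20)"
        using N[of "N + j" "N + 0"] pi_less_4 by (intro mult_mono) auto
      finally have "norm (1 - circle_exp (b (N + j) y - b (N + 0) y)) \<le> 1/2" by (simp add: norm_minus_commute)
      then show ?thesis
        using complex_Re_le_cmod[of "1 - circle_exp (b (N + j) y - b (N + 0) y)"] by simp
    qed
    then show "y \<in> (\<Union>N. {y. \<forall>j. Re (circle_exp (b (N + j) y - b (N + 0) y)) \<ge> 1/2})" by blast
  qed
qed

text \<open>Convergence on \<open>S\<close> passes to the generated subgroup, so that at each \<open>y\<close> some multiple \<open>k (b j y)\<close> converges. The functions \<open>k (b j)\<close> are again
distinct, and countably many null sets do not cover \<open>Y\<close>.\<close>

lemma not_all_convergent:
  assumes Y: "\<not> haar_null Y"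
    and S: "\<And>y. y \<in> Y \<Longrightarrow> \<exists>k. \<not> m dvd k \<and> zmul k (ev \<A> y) \<in> gen (ev \<A> ` S)"
    and b: "range b \<subseteq> \<A>" "inj (b :: nat \<Rightarrow> circle \<Rightarrow> circle)"
  shows "\<exists>s\<in>S. \<not> convergent (\<lambda>j. b j s)"
proof (rule ccontr)
  assume contra: "\<not> ?thesis"
  have b\<A>: "b j \<in> \<A>" for j using b(1) by auto
  define D where "D = {x :: (circle \<Rightarrow> circle) \<Rightarrow> circle. convergent (\<lambda>j. x (b j))}"
  have "add_subgroup D"
    unfolding add_subgroup_def D_def convergent_def
    by (auto intro: tendsto_const tendsto_add tendsto_minus)
  moreover have "ev \<A> ` S \<subseteq> D" using contra by (auto simp: D_def ev_def b\<A>)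
  ultimately have gen: "gen (ev \<A> ` S) \<subseteq> D" by (rule gen_minimal)
  define Z where "Z k = (if m dvd k then {} else {y. convergent (\<lambda>j. zmul k (b j) y)})" for k
  have "haar_null (Z k)" for k
  proof (cases "m dvd k")
    case True
    then show ?thesis by (simp add: Z_def haar_null_countable)
  next
    case False
    have "inj (\<lambda>j. zmul k (b j))"
    proof (rule injI)
      fix i j assume "zmul k (b i) = zmul k (b j)"
      then have "zmul k (b i - b j) = 0" by (simp add: zmul_diff_right)
      then have "b i - b j = 0"
        using no_other_torsion[OF add_subgroupD(4)[OF subgroup b\<A> b\<A>]] False by blast
      then show "i = j" using b(2) by (auto dest: injD)
    qed
    moreover have "range (\<lambda>j. zmul k (b j)) \<subseteq> \<A>" by (auto intro: add_subgroup_zmul[OF subgroup b\<A>])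
    ultimately show ?thesis using convergent_null False by (simp add: Z_def)
  qed
  then have "haar_null (\<Union>k. Z k)" by (rule haar_null_UN)
  moreover have "Y \<subseteq> (\<Union>k. Z k)"
  proof
    fix y assume "y \<in> Y"
    then obtain k where k: "\<not> m dvd k" "zmul k (ev \<A> y) \<in> D" using S gen by blast
    then have "y \<in> Z k" by (simp add: Z_def D_def zmul_fun_apply ev_def b\<A>)
    then show "y \<in> (\<Union>k. Z k)" by blast
  qed
  ultimately show False using Y haar_null_subset by blast
qed

text \<open>If \<open>S\<close> were countable, a diagonal subsequence of any sequence in \<open>\<A>\<close> would converge on \<open>S\<close>.\<close>

lemma uncountable_generators:
  assumes Y: "\<not> haar_null Y"
    and S: "\<And>y. y \<in> Y \<Longrightarrow> \<exists>k. \<not> m dvd k \<and> zmul k (ev \<A> y) \<in> gen (ev \<A> ` S)"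
  shows "uncountable S"
proof
  assume "countable S"
  obtain b :: "nat \<Rightarrow> circle \<Rightarrow> circle" where b: "inj b" "range b \<subseteq> \<A>"
    using infinite_countable_subset[OF infinite] by (elim exE conjE)
  obtain r where r: "strict_mono (r :: nat \<Rightarrow> nat)" "\<And>s. s \<in> S \<Longrightarrow> convergent (\<lambda>j. b (r j) s)"
    using convergent_subsequence[OF \<open>countable S\<close>, of b] by blast
  have "range (\<lambda>j. b (r j)) \<subseteq> \<A>" using b(2) by auto
  moreover have "inj (\<lambda>j. b (r j))"
    using inj_compose[OF b(1) strict_mono_imp_inj_on[OF r(1)]] by (simp add: comp_def)
  ultimately show False using not_all_convergent[OF Y S] r(2) by blast
qed

end

section \<open>Two groups of functions on the circle\<close>

lemma countable_gen: "countable X \<Longrightarrow> countable (gen X)"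
  unfolding gen_def by (intro countable_image countable_lists countable_SIGMA) auto

lemma measurable_gen:
  assumes "\<And>x. x \<in> X \<Longrightarrow> (\<lambda>r. circle_exp (x (to_circle r))) \<in> borel_measurable borel" and "a \<in> gen X"
  shows "(\<lambda>r. circle_exp (a (to_circle r))) \<in> borel_measurable borel"
proof -
  define D where "D = {a :: circle \<Rightarrow> circle. (\<lambda>r. circle_exp (a (to_circle r))) \<in> borel_measurable borel}"
  have cnj: "(\<lambda>r. cnj (f r)) \<in> borel_measurable borel" if "f \<in> borel_measurable borel" for f :: "real \<Rightarrow> complex"
    using measurable_compose[OF that, of cnj borel] borel_measurable_continuous_onI[OF continuous_on_cnj[OF continuous_on_id]]
    by simp
  have "add_subgroup D"
    unfolding add_subgroup_def D_def
    by (auto simp: circle_exp_add circle_exp_minus intro!: borel_measurable_times cnj)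
  then have "gen X \<subseteq> D" by (rule gen_minimal) (use assms(1) in \<open>auto simp: D_def\<close>)
  then show ?thesis using assms(2) by (auto simp: D_def)
qed

text \<open>Multiplication by \<open>n \<noteq> 0\<close> is shifted by \<open>n t\<close> under rotation by \<open>t\<close>.\<close>

lemma circle_functions_multiples: "circle_functions 0 (gen {\<lambda>y. y})"
proof -
  have gen: "gen {\<lambda>y :: circle. y} = range (\<lambda>n. zmul n (\<lambda>y. y))"
    by (rule gen_singleton)
  have nz: "\<exists>t :: circle. zmul n t \<noteq> 0" if "n \<noteq> 0" for n
  proof -
    have "(1/2 :: real) \<notin> \<int>" using Ints_cases[of "1/2 :: real"] by (auto elim!: Ints_cases)
    then have "zmul n (to_circle (1 / (2 * of_int n))) \<noteq> 0"
      using that by (simp add: zmul_to_circle to_circle_eq_0_iff)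
    then show ?thesis by blast
  qed
  have free: "zmul n (\<lambda>y :: circle. y) = 0 \<Longrightarrow> n = 0" for n
    using nz[of n] by (metis zero_fun_apply zmul_fun_apply)
  show ?thesis
  proof
    show "add_subgroup (gen {\<lambda>y :: circle. y})" by (rule add_subgroup_gen)
    show "countable (gen {\<lambda>y :: circle. y})" by (simp add: countable_gen)
    have "inj (\<lambda>n. zmul n (\<lambda>y :: circle. y))"
    proof (rule injI)
      fix k n assume "zmul k (\<lambda>y :: circle. y) = zmul n (\<lambda>y. y)"
      then have "zmul (k - n) (\<lambda>y :: circle. y) = 0" by (simp add: zmul_diff_left)
      then show "k = n" using free by fastforce
    qed
    then show "infinite (gen {\<lambda>y :: circle. y})"
      unfolding gen using finite_imageD infinite_UNIV_int by blast
    fix a :: "circle \<Rightarrow> circle" assume a: "a \<in> gen {\<lambda>y. y}"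
    then obtain n where n: "a = zmul n (\<lambda>y. y)" unfolding gen by blast
    show "(\<lambda>r. circle_exp (a (to_circle r))) \<in> borel_measurable borel"
      by (rule measurable_gen[OF _ a])
         (auto intro!: borel_measurable_continuous_onI continuous_on_compose2[OF continuous_on_circle_exp continuous_to_circle])
    show "zmul 0 a = 0" by simp
    show "a = 0" if "zmul k a = 0" "\<not> 0 dvd k" for k
      using free[of "k * n"] that by (simp add: n zmul_mult)
    show "\<exists>t c. c \<noteq> 0 \<and> (\<forall>y. a (y + t) = a y + c)" if "a \<noteq> 0"
    proof -
      have "n \<noteq> 0" using that n by auto
      then obtain t :: circle where "zmul n t \<noteq> 0" using nz by blast
      then show ?thesis by (intro exI[of _ t] exI[of _ "zmul n t"]) (simp add: n zmul_fun_apply zmul_distrib_right)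
    qed
  qed
qed

text \<open>The \<open>i\<close>-th digit in base \<open>p\<close>, as an element of order \<open>p\<close> of the circle; reduction modulo 1 discards the preceding digits.\<close>

definition digit :: "nat \<Rightarrow> nat \<Rightarrow> circle \<Rightarrow> circle" where
  "digit p i y = to_circle (of_int \<lfloor>real p ^ Suc i * rep_circle y\<rfloor> / real p)"

lemma digit_to_circle:
  assumes "p > 0"
  shows "digit p i (to_circle r) = to_circle (of_int \<lfloor>real p ^ Suc i * r\<rfloor> / real p)"
proof -
  define k where "k = \<lceil>r - 1/2\<rceil>"
  have "real p ^ Suc i * rep_circle (to_circle r) = real p ^ Suc i * r - of_int (int p ^ Suc i * k)"
    by (simp add: rep_to_circle k_def right_diff_distrib)
  then have fl: "\<lfloor>real p ^ Suc i * rep_circle (to_circle r)\<rfloor> = \<lfloor>real p ^ Suc i * r\<rfloor> - int p ^ Suc i * k"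
    by (simp only: floor_diff_of_int)
  have "of_int \<lfloor>real p ^ Suc i * rep_circle (to_circle r)\<rfloor> / real p
      - of_int \<lfloor>real p ^ Suc i * r\<rfloor> / real p = of_int (- (int p ^ i * k))"
    unfolding fl using assms by (simp add: field_simps)
  then show ?thesis unfolding digit_def by (rule to_circle_cong)
qed

lemma zmul_digit: "p > 0 \<Longrightarrow> zmul (int p) (digit p i) = 0"
  by (rule ext) (simp add: zmul_fun_apply digit_def zmul_to_circle to_circle_eq_0_iff)

text \<open>Adding a unit in place \<open>i\<close> may carry over to earlier places only.\<close>

lemma digit_shift:
  assumes "p > 0" "i \<le> j"
  shows "digit p j (y + to_circle (1 / real p ^ Suc i)) = digit p j y + (if i = j then to_circle (1 / real p) else 0)"
proof -
  define r where "r = rep_circle y"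
  have y: "y = to_circle r" by (simp add: r_def)
  obtain l where j: "j = i + l" using assms(2) by (auto simp: le_iff_add)
  have "real p ^ Suc j * (r + 1 / real p ^ Suc i) = real p ^ Suc j * r + of_int (int p ^ l)"
    using assms(1) by (simp add: j field_simps power_add)
  then have "\<lfloor>real p ^ Suc j * (r + 1 / real p ^ Suc i)\<rfloor> = \<lfloor>real p ^ Suc j * r\<rfloor> + int p ^ l"
    by (simp only: floor_add_int[symmetric])
  then have "digit p j (y + to_circle (1 / real p ^ Suc i)) = to_circle (of_int \<lfloor>real p ^ Suc j * r\<rfloor> / real p + real p ^ l / real p)"
    unfolding y to_circle_add[symmetric] digit_to_circle[OF assms(1)] by (simp add: add_divide_distrib)
  also have "\<dots> = digit p j y + to_circle (real p ^ l / real p)"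
    unfolding y to_circle_add digit_to_circle[OF assms(1)] ..
  also have "to_circle (real p ^ l / real p) = (if i = j then to_circle (1 / real p) else 0)"
  proof (cases l)
    case 0
    then show ?thesis by (simp add: j)
  next
    case (Suc l')
    then have "real p ^ l / real p = of_int (int p ^ l')" using assms(1) by simp
    then show ?thesis using Suc j by (simp add: to_circle_eq_0_iff)
  qed
  finally show ?thesis .
qed

lemma to_circle_inverse_nonzero:
  assumes "prime p" "\<not> int p dvd n"
  shows "zmul n (to_circle (1 / real p)) \<noteq> 0"
proof
  assume "zmul n (to_circle (1 / real p)) = 0"
  then obtain k where "of_int n / real p = of_int k"
    by (auto simp: zmul_to_circle to_circle_eq_0_iff elim: Ints_cases)
  then have "real_of_int n = of_int (k * int p)" using assms(1) prime_gt_0_nat by (simp add: field_simps)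
  then have "n = k * int p" by linarith
  then show False using assms(2) by simp
qed

text \<open>A rotation by a unit in the first place \<open>i\<close> whose coefficient is not divisible by \<open>p\<close> changes the digit
\<open>i\<close> by one. A carry affects only places where the coefficient annihilates the digit.\<close>

lemma circle_functions_digits:
  assumes p: "prime p"
  shows "circle_functions (int p) (gen (range (digit p)))"
proof
  have p0: "p > 0" using p by (rule prime_gt_0_nat)
  show "add_subgroup (gen (range (digit p)))" by (rule add_subgroup_gen)
  show "countable (gen (range (digit p)))" by (simp add: countable_gen)
  have ne: "digit p i \<noteq> digit p j" if "i < j" for i j
  proof
    assume eq: "digit p i = digit p j"
    have "\<not> int p dvd 1" using prime_gt_1_nat[OF p] by simp
    then show False
      using digit_shift[OF p0, of i i 0] digit_shift[OF p0, of i j 0] that to_circle_inverse_nonzero[OF p, of 1]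
      by (simp add: eq)
  qed
  have "inj (digit p)" by (rule injI) (metis ne linorder_neqE_nat)
  then have "infinite (range (digit p))" using finite_imageD infinite_UNIV_nat by blast
  then show "infinite (gen (range (digit p)))" by (meson finite_subset gen_incl subsetI)
  have tors: "zmul (int p) a = 0" if "a \<in> gen (range (digit p))" for a
  proof -
    have "add_subgroup {a :: circle \<Rightarrow> circle. zmul (int p) a = 0}"
      by (auto simp: add_subgroup_def zmul_distrib_right zmul_minus_right)
    then have "gen (range (digit p)) \<subseteq> {a. zmul (int p) a = 0}"
      by (rule gen_minimal) (auto simp: zmul_digit[OF p0])
    then show ?thesis using that by blast
  qed
  fix a assume a: "a \<in> gen (range (digit p))"
  show "zmul (int p) a = 0" by (rule tors[OF a])
  show "a = 0" if "zmul k a = 0" "\<not> int p dvd k" for k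
    using zmul_coprime_eq_0[OF tors[OF a] that(1)] that(2) p by (simp add: prime_imp_coprime)
  show "(\<lambda>r. circle_exp (a (to_circle r))) \<in> borel_measurable borel"
  proof (rule measurable_gen[OF _ a])
    fix x assume "x \<in> range (digit p)"
    then obtain i where x: "x = digit p i" by blast
    have "(\<lambda>r. circle_exp (x (to_circle r))) = (\<lambda>r. cis (2 * pi * (of_int \<lfloor>real p ^ Suc i * r\<rfloor> / real p)))"
      by (simp add: x digit_to_circle[OF p0] circle_exp_to_circle)
    moreover have "cis \<in> borel_measurable borel"
      by (intro borel_measurable_continuous_onI continuous_intros)
    ultimately show "(\<lambda>r. circle_exp (x (to_circle r))) \<in> borel_measurable borel" by simp
  qed
  show "\<exists>t c. c \<noteq> 0 \<and> (\<forall>y. a (y + t) = a y + c)" if "a \<noteq> 0"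
  proof -
    obtain F n where F: "finite F" "a = (\<Sum>i\<in>F. zmul (n i) (digit p i))"
      using a unfolding gen_family by blast
    define H where "H = {i \<in> F. \<not> int p dvd n i}"
    have finH: "finite H" using F(1) by (simp add: H_def)
    have aH: "a = (\<Sum>i\<in>H. zmul (n i) (digit p i))"
      unfolding F(2) using F(1) zmul_dvd_eq_0[OF zmul_digit[OF p0]]
      by (intro sum.mono_neutral_right) (auto simp: H_def)
    have "H \<noteq> {}" using that aH by auto
    define i where "i = Min H"
    have i: "i \<in> H" using finH \<open>H \<noteq> {}\<close> by (simp add: i_def)
    have le: "i \<le> j" if "j \<in> H" for j using finH that by (simp add: i_def)
    define t where "t = to_circle (1 / real p ^ Suc i)"
    define c where "c = zmul (n i) (to_circle (1 / real p))"
    have "a (y + t) = a y + c" for y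
    proof -
      have "a (y + t) = (\<Sum>j\<in>H. zmul (n j) (digit p j y) + zmul (n j) (if i = j then to_circle (1 / real p) else 0))"
        unfolding aH sum_fun_apply zmul_fun_apply t_def
        by (intro sum.cong refl) (simp only: digit_shift[OF p0 le] zmul_distrib_right)
      also have "\<dots> = a y + (\<Sum>j\<in>H. zmul (n j) (if i = j then to_circle (1 / real p) else 0))"
        by (simp only: aH sum_fun_apply zmul_fun_apply sum.distrib)
      also have "(\<Sum>j\<in>H. zmul (n j) (if i = j then to_circle (1 / real p) else 0)) = (\<Sum>j\<in>H. if i = j then c else 0)"
        by (rule sum.cong) (auto simp: c_def)
      also have "\<dots> = c" using finH i by simp
      finally show ?thesis .
    qed
    moreover have "c \<noteq> 0" unfolding c_def using i by (intro to_circle_inverse_nonzero[OF p]) (simp add: H_def)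
    ultimately show ?thesis by blast
  qed
qed

lemma circle_functions_exists:
  assumes "m = 0 \<or> prime m"
  obtains \<A> where "circle_functions m \<A>"
proof (cases "m = 0")
  case True
  then show ?thesis using that circle_functions_multiples by simp
next
  case False
  then have "prime m" using assms by simp
  then have "0 \<le> m" by (rule prime_ge_0_int)
  then obtain p where p: "m = int p" by (metis nonneg_int_cases)
  then have "prime p" using \<open>prime m\<close> by simp
  then show ?thesis using that[of "gen (range (digit p))"] circle_functions_digits by (simp add: p)
qed

section \<open>Cardinality of the character group\<close>

text \<open>A countable cover of \<open>Y\<close> has a member that is not null, hence of cardinality at least \<open>non(\<N>)\<close>.\<close>

lemma non_N_witness:
  obtains Y where "non_N = |Y|" "\<not> haar_null Y" "|UNIV :: nat set| <o |Y|"
    "\<And>A :: nat \<Rightarrow> circle set. Y \<subseteq> (\<Union>n. A n) \<Longrightarrow> \<exists>n. |Y| \<le>o |A n|"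
proof -
  obtain Y where Y: "\<not> haar_null Y" "non_N = |Y|"
    using least_card_attained[of "\<lambda>A. \<not> haar_null A", OF not_haar_null_UNIV] unfolding non_N_def by blast
  have large: "|Y| \<le>o |B|" if "\<not> haar_null B" for B
    using least_card_le[of "\<lambda>A. \<not> haar_null A", OF that] Y(2) unfolding non_N_def by simp
  show ?thesis
  proof (rule that[OF Y(2,1)])
    show "|UNIV :: nat set| <o |Y|"
    proof (rule not_card_of_ordLeqD)
      show "\<not> |Y| \<le>o |UNIV :: nat set|"
      proof
        assume "|Y| \<le>o |UNIV :: nat set|"
        then obtain f :: "circle \<Rightarrow> nat" where "inj_on f Y"
          using card_of_ordLeq[of Y "UNIV :: nat set"] by blast
        then have "countable Y" by (auto simp: countable_def)
        then show False using haar_null_countable Y(1) by blast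
      qed
    qed
    fix A :: "nat \<Rightarrow> circle set" assume sub: "Y \<subseteq> (\<Union>n. A n)"
    show "\<exists>n. |Y| \<le>o |A n|"
    proof (rule ccontr)
      assume "\<not> ?thesis"
      then have "haar_null (A n)" for n using large by blast
      then show False using haar_null_UN haar_null_subset[OF _ sub] Y(1) by blast
    qed
  qed
qed

text \<open>The characters induce the topology, so finitely many conditions \<open>dist (\<psi> y) c < 1 / (n + 1)\<close> with rational
\<open>c\<close> form a basis. There are no more of these than characters, up to countable factors.\<close>

lemma card_characters_ge:
  assumes compact: "compact (UNIV :: 'a::topological_ab_group_add set)"
    and nat: "|UNIV :: nat set| <o |Y|" and le: "|Y| \<le>o weight TYPE('a)"
  shows "|Y| \<le>o |characters :: ('a \<Rightarrow> circle) set|"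
proof (rule ccontr)
  assume "\<not> ?thesis"
  then have small: "|characters :: ('a \<Rightarrow> circle) set| <o |Y|" by (rule not_card_of_ordLeqD)
  have inf: "infinite Y" using nat infinite_iff_card_of_nat ordLess_imp_ordLeq by blast
  define X where "X = (characters :: ('a \<Rightarrow> circle) set) \<times> (to_circle ` \<rat> \<times> (UNIV :: nat set))"
  define N where "N l = {y. \<forall>(\<psi>, c, n) \<in> set l. dist (\<psi> y) c < 1 / (real n + 1)}"
    for l :: "(('a \<Rightarrow> circle) \<times> circle \<times> nat) list"
  have "countable (to_circle ` \<rat>)" by (intro countable_image countable_rat)
  then have "countable (to_circle ` \<rat> \<times> (UNIV :: nat set))" by (rule countable_SIGMA) simp
  then have "|X| <o |Y|"
    unfolding X_def by (rule card_of_Times_ordLess[OF inf small countable_card_ordLess[OF nat]])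
  then have "|lists X| <o |Y|" by (rule card_lists_ordLess[OF nat])
  then have "|N ` lists X| <o |Y|" using card_of_image ordLeq_ordLess_trans by blast
  moreover have "topological_basis (N ` lists X)"
  proof -
    have opn: "open B" if B: "B \<in> N ` lists X" for B
    proof -
      obtain l where l: "l \<in> lists X" "B = N l" using B by blast
      have "N l = (\<Inter>(\<psi>, c, n)\<in>set l. {y. dist (\<psi> y) c < 1 / (real n + 1)})" by (auto simp: N_def)
      moreover have "open {y. dist (\<psi> y) c < 1 / (real n + 1)}" if "(\<psi>, c, n) \<in> set l" for \<psi> c n
        using l(1) that by (intro open_Collect_less continuous_intros characters_continuous) (auto simp: X_def)
      ultimately show ?thesis unfolding l(2) by auto
    qed
    show ?thesis
    proof (rule topological_basis_iff[THEN iffD2])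
      show "open B" if "B \<in> N ` lists X" for B by (rule opn[OF that])
      show "\<forall>U. open U \<longrightarrow> (\<forall>x\<in>U. \<exists>B\<in>N ` lists X. x \<in> B \<and> B \<subseteq> U)"
      proof (intro allI impI ballI)
        fix U :: "'a set" and x assume U: "open U" "x \<in> U"
        obtain F e where F: "finite F" "F \<subseteq> characters" "e > 0"
          "\<And>y. (\<And>\<psi>. \<psi> \<in> F \<Longrightarrow> dist (\<psi> y) (\<psi> x) < e) \<Longrightarrow> y \<in> U"
          using characters_initial_topology[OF compact U] by metis
        obtain n where n: "1 / (real n + 1) < e / 2"
          using reals_Archimedean[of "e / 2"] F(3) by (auto simp: inverse_eq_divide add.commute)
        have "\<exists>c\<in>to_circle ` \<rat>. dist t c < 1 / (real n + 1)" for t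
        proof -
          obtain q where q: "q \<in> \<rat>" "rep_circle t < q" "q < rep_circle t + 1 / (real n + 1)"
            using Rats_dense_in_real[of "rep_circle t" "rep_circle t + 1 / (real n + 1)"] by auto
          then have "dist t (to_circle q) < 1 / (real n + 1)"
            using dist_to_circle_le[of "rep_circle t" q] by simp
          then show ?thesis using q(1) by blast
        qed
        then obtain c where c: "c t \<in> to_circle ` \<rat>" "dist t (c t) < 1 / (real n + 1)" for t by metis
        obtain fs where fs: "set fs = F" using finite_list[OF F(1)] by blast
        define l where "l = map (\<lambda>\<psi>. (\<psi>, c (\<psi> x), n)) fs"
        have "l \<in> lists X" using fs F(2) c(1) by (auto simp: l_def X_def)
        moreover have "x \<in> N l" using c(2) by (auto simp: N_def l_def)
        moreover have "N l \<subseteq> U"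
        proof
          fix y assume y: "y \<in> N l"
          show "y \<in> U"
          proof (rule F(4))
            fix \<psi> assume "\<psi> \<in> F"
            then have "dist (\<psi> y) (c (\<psi> x)) < 1 / (real n + 1)" using y fs by (auto simp: N_def l_def)
            then show "dist (\<psi> y) (\<psi> x) < e"
              using c(2)[of "\<psi> x"] dist_triangle2[of "\<psi> y" "\<psi> x" "c (\<psi> x)"] n by linarith
          qed
        qed
        ultimately show "\<exists>B\<in>N ` lists X. x \<in> B \<and> B \<subseteq> U" by blast
      qed
    qed
  qed
  then have "weight TYPE('a) \<le>o |N ` lists X|"
    unfolding weight_def by (rule least_card_le)
  ultimately have "|Y| <o |Y|"
    using le ordLeq_transitive ordLeq_ordLess_trans by blast
  then show False using ordLess_irreflexive by blast
qed

section \<open>A dense subgroup with small compact sets\<close>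

text \<open>Countably many coordinates \<open>S0\<close> separate the countable image of \<open>K\<close>. A subsequence that converges
on \<open>S0\<close> converges in every coordinate: cluster points in \<open>K\<close> agree on \<open>S0\<close>, hence on \<open>S\<close>.\<close>

lemma compact_sequence_convergent:
  fixes f :: "'i \<Rightarrow> 'a::topological_space \<Rightarrow> circle"
  assumes K: "compact K" and f: "\<And>s. s \<in> S \<Longrightarrow> continuous_on K (f s)"
    and x: "\<And>j. x j \<in> K"
    and count: "countable ((\<lambda>g. restrict (\<lambda>s. f s g) S) ` K)"
  shows "\<exists>r :: nat \<Rightarrow> nat. strict_mono r \<and> (\<forall>s\<in>S. convergent (\<lambda>j. f s (x (r j))))"
proof -
  define q where "q g = restrict (\<lambda>s. f s g) S" for g
  define P where "P = {(p, p') \<in> q ` K \<times> q ` K. p \<noteq> p'}"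
  define \<sigma> where "\<sigma> pp = (SOME s. s \<in> S \<and> fst pp s \<noteq> snd pp s)" for pp :: "('i \<Rightarrow> circle) \<times> ('i \<Rightarrow> circle)"
  have \<sigma>: "\<sigma> (q g, q g') \<in> S" "q g (\<sigma> (q g, q g')) \<noteq> q g' (\<sigma> (q g, q g'))" if neq: "q g \<noteq> q g'" for g g'
  proof -
    obtain s where "q g s \<noteq> q g' s" using neq by (auto simp: fun_eq_iff)
    moreover from this have "s \<in> S" by (auto simp: q_def restrict_def split: if_splits)
    ultimately have "\<exists>s. s \<in> S \<and> fst (q g, q g') s \<noteq> snd (q g, q g') s" by auto
    from someI_ex[OF this] show "\<sigma> (q g, q g') \<in> S" "q g (\<sigma> (q g, q g')) \<noteq> q g' (\<sigma> (q g, q g'))"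
      unfolding \<sigma>_def by simp_all
  qed
  define S0 where "S0 = \<sigma> ` P"
  have S0: "S0 \<subseteq> S" using \<sigma>(1) by (auto simp: S0_def P_def)
  have "countable (q ` K \<times> q ` K)" using count unfolding q_def[abs_def] by blast
  then have "countable P" by (rule countable_subset[rotated]) (auto simp: P_def)
  then have cS0: "countable S0" by (simp add: S0_def)
  have sep: "f s g = f s g'" if "g \<in> K" "g' \<in> K" "\<And>s. s \<in> S0 \<Longrightarrow> f s g = f s g'" "s \<in> S" for g g' s
  proof -
    have "q g = q g'"
    proof (rule ccontr)
      assume neq: "q g \<noteq> q g'"
      then have "(q g, q g') \<in> P" using that(1,2) by (auto simp: P_def)
      then have "\<sigma> (q g, q g') \<in> S0" unfolding S0_def by (rule imageI)
      then have "f (\<sigma> (q g, q g')) g = f (\<sigma> (q g, q g')) g'" by (rule that(3))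
      moreover have "q h t = f t h" if "t \<in> S" for h t using that by (simp add: q_def)
      ultimately show False using \<sigma>[OF neq] by metis
    qed
    then show ?thesis using that(4) by (metis q_def restrict_apply')
  qed
  have f0: "continuous_on K (f s)" if "s \<in> S0" for s using f S0 that by blast
  have "\<exists>z\<in>K. \<exists>r :: nat \<Rightarrow> nat. strict_mono r \<and> (\<forall>s\<in>S0. (\<lambda>j. f s (x (r j))) \<longlonglongrightarrow> f s z)"
    by (rule compact_sequence[where f = f and x = x, OF K cS0]; fact f0 x)
  then obtain z and r :: "nat \<Rightarrow> nat" where r: "z \<in> K" "strict_mono r"
    "\<forall>s\<in>S0. (\<lambda>j. f s (x (r j))) \<longlonglongrightarrow> f s z" by blast
  have "(\<lambda>j. f s (x (r j))) \<longlonglongrightarrow> f s z" if s: "s \<in> S" for s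
  proof (rule ccontr)
    assume "\<not> ?thesis"
    then obtain \<epsilon> where \<epsilon>: "\<epsilon> > 0" "\<forall>N. \<exists>n\<ge>N. \<not> dist (f s (x (r n))) (f s z) < \<epsilon>"
      unfolding lim_sequentially by blast
    then have "infinite {n. \<not> dist (f s (x (r n))) (f s z) < \<epsilon>}"
      unfolding infinite_nat_iff_unbounded_le by simp
    then obtain t :: "nat \<Rightarrow> nat" where t: "strict_mono t" "\<And>n. \<not> dist (f s (x (r (t n)))) (f s z) < \<epsilon>"
      using infinite_enumerate by blast
    have f1: "continuous_on K (f s')" if "s' \<in> insert s S0" for s' using f f0 s that by blast
    have "countable (insert s S0)" using cS0 by simp
    then have "\<exists>z'\<in>K. \<exists>u :: nat \<Rightarrow> nat. strict_mono u
        \<and> (\<forall>s'\<in>insert s S0. (\<lambda>j. f s' (x (r (t (u j))))) \<longlonglongrightarrow> f s' z')"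
    proof (rule compact_sequence[where f = f and x = "\<lambda>j. x (r (t j))", OF K])
      show "continuous_on K (f s')" if "s' \<in> insert s S0" for s' by (rule f1[OF that])
      show "x (r (t j)) \<in> K" for j by (rule x)
    qed
    then obtain z' and u :: "nat \<Rightarrow> nat" where u: "z' \<in> K" "strict_mono u"
      "\<forall>s'\<in>insert s S0. (\<lambda>j. f s' (x (r (t (u j))))) \<longlonglongrightarrow> f s' z'" by blast
    have "f s' z' = f s' z" if "s' \<in> S0" for s'
    proof (rule LIMSEQ_unique)
      show "(\<lambda>j. f s' (x (r (t (u j))))) \<longlonglongrightarrow> f s' z'" using u(3) that by blast
      show "(\<lambda>j. f s' (x (r (t (u j))))) \<longlonglongrightarrow> f s' z"
        using LIMSEQ_subseq_LIMSEQ[OF r(3)[rule_format, OF that] strict_mono_o[OF t(1) u(2)]]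
        by (simp add: comp_def)
    qed
    then have "f s z' = f s z" by (rule sep[OF u(1) r(1) _ s])
    then have "(\<lambda>j. f s (x (r (t (u j))))) \<longlonglongrightarrow> f s z" using u(3) by simp
    then obtain j where "dist (f s (x (r (t (u j))))) (f s z) < \<epsilon>"
      using \<epsilon>(1) unfolding lim_sequentially by blast
    then show False using t(2) by blast
  qed
  then show ?thesis using r(2) unfolding convergent_def by blast
qed

locale dense_construction =
  circle_functions m \<A> for m \<A> +
  fixes Y S :: "circle set" and \<gamma> :: "circle \<Rightarrow> 'a::topological_ab_group_add \<Rightarrow> circle"
  assumes compact: "compact (UNIV :: 'a set)"
    and Y: "\<not> haar_null Y"
    and S_indep: "indep m (ev \<A>) S"
    and S_max: "\<And>y. y \<in> Y \<Longrightarrow> \<exists>k. \<not> m dvd k \<and> zmul k (ev \<A> y) \<in> gen (ev \<A> ` S)"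
    and \<gamma>: "\<And>s. s \<in> S \<Longrightarrow> \<gamma> s \<in> characters" "\<And>s. s \<in> S \<Longrightarrow> zmul m (\<gamma> s) = 0"
    and \<gamma>_inj: "inj_on \<gamma> S" and \<gamma>_indep: "indep m \<gamma> S"
begin

definition D :: "'a set" where
  "D = {g. \<exists>a\<in>\<A>. \<forall>s\<in>S. \<gamma> s g = a s}"

lemma subgroup_D: "add_subgroup D"
proof -
  have add: "\<gamma> s (g + h) = \<gamma> s g + \<gamma> s h" if "s \<in> S" for s g h
    using additive_onD[OF characters_additive[OF \<gamma>(1)[OF that]]] by simp
  have min: "\<gamma> s (- g) = - \<gamma> s g" and zero: "\<gamma> s 0 = 0" if "s \<in> S" for s g
    using additive_on_minus[OF characters_additive[OF \<gamma>(1)[OF that]]]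
      additive_on_zero[OF characters_additive[OF \<gamma>(1)[OF that]]] by simp_all
  show ?thesis
    unfolding add_subgroup_def
  proof (intro conjI ballI)
    show "0 \<in> D" unfolding D_def using zero add_subgroupD(1)[OF subgroup]
      by (intro CollectI bexI[of _ 0]) simp_all
    fix g assume "g \<in> D"
    then obtain a where a: "a \<in> \<A>" "\<forall>s\<in>S. \<gamma> s g = a s" by (auto simp: D_def)
    then show "- g \<in> D" unfolding D_def using min add_subgroupD(3)[OF subgroup a(1)]
      by (intro CollectI bexI[of _ "- a"]) simp_all
    fix h assume "h \<in> D"
    then obtain b where b: "b \<in> \<A>" "\<forall>s\<in>S. \<gamma> s h = b s" by (auto simp: D_def)
    then show "g + h \<in> D" unfolding D_def using add a add_subgroupD(2)[OF subgroup a(1) b(1)]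
      by (intro CollectI bexI[of _ "a + b"]) simp_all
  qed
qed

text \<open>A character \<open>\<psi>\<close> outside the subgroup generated by the \<open>\<gamma> s\<close> is detected by a homomorphism which vanishes on that
subgroup. For a nonzero \<open>\<psi>\<close> in the subgroup, independence of \<open>S\<close> gives an \<open>a\<close> on which the corresponding
combination of evaluations is nonzero, and \<open>\<gamma> s \<mapsto> a s\<close> defines a homomorphism by independence of the \<open>\<gamma> s\<close>.
Both homomorphisms are evaluations at elements of \<open>D\<close>.\<close>

lemma separates:
  assumes \<psi>: "\<psi> \<in> characters" and zero: "\<And>d. d \<in> D \<Longrightarrow> \<psi> d = 0"
  shows "\<psi> = 0"
proof (rule ccontr)
  assume nz: "\<psi> \<noteq> 0"
  have "\<psi> \<in> gen (\<gamma> ` S)"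
  proof (rule ccontr)
    assume out: "\<psi> \<notin> gen (\<gamma> ` S)"
    define R where "R = gen (\<gamma> ` S) \<times> {0 :: circle}"
    have "hom_graph R"
      unfolding hom_graph_def add_subgroup_def R_def using add_subgroup_gen[of "\<gamma> ` S"]
      by (auto simp: zero_prod_def add_subgroup_def)
    moreover have "\<psi> \<notin> Domain R" using out by (auto simp: R_def)
    ultimately obtain h where h: "additive_on UNIV h" "\<And>x c. (x, c) \<in> R \<Longrightarrow> h x = c" "h \<psi> \<noteq> 0"
      by (rule hom_graph_extends_nonzero) blast
    obtain g where g: "\<And>\<phi>. \<phi> \<in> characters \<Longrightarrow> \<phi> g = h \<phi>"
      using evaluation_surjective[OF compact h(1)] by blast
    have "\<gamma> s g = 0" if "s \<in> S" for s
      using g[OF \<gamma>(1)[OF that]] h(2)[of "\<gamma> s" 0] that gen_incl[of "\<gamma> s" "\<gamma> ` S"] by (auto simp: R_def)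
    then have "g \<in> D" unfolding D_def using add_subgroupD(1)[OF subgroup]
      by (intro CollectI bexI[of _ 0]) simp_all
    then show False using zero g[OF \<psi>] h(3) by simp
  qed
  then obtain F n where F: "finite F" "F \<subseteq> S" "\<psi> = (\<Sum>s\<in>F. zmul (n s) (\<gamma> s))"
    unfolding gen_family by blast
  have "\<exists>s\<in>F. \<not> m dvd n s"
  proof (rule ccontr)
    assume "\<not> ?thesis"
    then have "zmul (n s) (\<gamma> s) = 0" if "s \<in> F" for s
      using zmul_dvd_eq_0[OF \<gamma>(2)] that F(2) by blast
    then show False using nz F(3) by simp
  qed
  then have "(\<Sum>s\<in>F. zmul (n s) (ev \<A> s)) \<noteq> 0" using indepD[OF S_indep F(1,2)] by blast
  then obtain a where a: "(\<Sum>s\<in>F. zmul (n s) (ev \<A> s a)) \<noteq> 0"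
    by (auto simp: fun_eq_iff sum_fun_apply zmul_fun_apply)
  have a\<A>: "a \<in> \<A>"
  proof (rule ccontr)
    assume "a \<notin> \<A>"
    then show False using a by (simp add: ev_def)
  qed
  have za: "zmul m (a s) = 0" for s
    using torsion[OF a\<A>] by (metis zero_fun_apply zmul_fun_apply)
  define R where "R = gen ((\<lambda>s. (\<gamma> s, a s)) ` S)"
  have "hom_graph R"
    unfolding hom_graph_def
  proof (intro conjI allI impI)
    show "add_subgroup R" unfolding R_def by (rule add_subgroup_gen)
    fix c assume "(0, c) \<in> R"
    then obtain H k where H: "finite H" "H \<subseteq> S" "(0, c) = (\<Sum>s\<in>H. zmul (k s) (\<gamma> s, a s))"
      unfolding R_def gen_family by blast
    then have "(0, c) = (\<Sum>s\<in>H. (zmul (k s) (\<gamma> s), zmul (k s) (a s)))" by (simp only: zmul_prod)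
    then have "(\<Sum>s\<in>H. zmul (k s) (\<gamma> s)) = 0" and c: "c = (\<Sum>s\<in>H. zmul (k s) (a s))"
      by (simp_all add: sum_prod)
    then have "m dvd k s" if "s \<in> H" for s using indepD[OF \<gamma>_indep H(1,2)] that by blast
    then show "c = 0" unfolding c using zmul_dvd_eq_0[OF za] by (intro sum.neutral) blast
  qed
  then obtain h where h: "additive_on UNIV h" "\<And>x c. (x, c) \<in> R \<Longrightarrow> h x = c"
    using hom_graph_extends by blast
  obtain g where g: "\<And>\<phi>. \<phi> \<in> characters \<Longrightarrow> \<phi> g = h \<phi>"
    using evaluation_surjective[OF compact h(1)] by blast
  have \<gamma>g: "\<gamma> s g = a s" if "s \<in> S" for s
    using g[OF \<gamma>(1)[OF that]] h(2)[of "\<gamma> s" "a s"] that by (auto simp: R_def intro: gen_incl)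
  then have "g \<in> D" unfolding D_def using a\<A> by blast
  then have "\<psi> g = 0" by (rule zero)
  moreover have "\<psi> g = (\<Sum>s\<in>F. zmul (n s) (\<gamma> s g))" by (simp add: F(3) sum_fun_apply zmul_fun_apply)
  moreover have "\<dots> = (\<Sum>s\<in>F. zmul (n s) (ev \<A> s a))"
    using F(2) by (intro sum.cong) (auto simp: \<gamma>g ev_def a\<A>)
  ultimately show False using a by simp
qed

lemma dense_D: "closure D = UNIV"
  by (rule dense_if_separates_characters[OF compact subgroup_D separates])

text \<open>By definition of \<open>D\<close>, distinct values of \<open>q\<close> on \<open>K\<close> come from distinct elements of \<open>\<A>\<close>. A convergent
sequence of such values contradicts \<open>not_all_convergent\<close>.\<close>

lemma compact_image_finite:
  assumes K: "compact K" "K \<subseteq> D"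
  shows "finite ((\<lambda>g. restrict (\<lambda>s. \<gamma> s g) S) ` K)"
proof (rule ccontr)
  define q where "q g = restrict (\<lambda>s. \<gamma> s g) S" for g
  assume "infinite ((\<lambda>g. restrict (\<lambda>s. \<gamma> s g) S) ` K)"
  then have "infinite (q ` K)" by (simp add: q_def[abs_def])
  then obtain f :: "nat \<Rightarrow> _" where f: "inj f" "range f \<subseteq> q ` K"
    using infinite_countable_subset by blast
  then have "\<forall>j. \<exists>g\<in>K. f j = q g" by blast
  then obtain x where x: "\<And>j. x j \<in> K" "\<And>j. f j = q (x j)" by metis
  have "\<forall>g\<in>D. \<exists>a\<in>\<A>. \<forall>s\<in>S. \<gamma> s g = a s" by (auto simp: D_def)
  then obtain a where a: "\<And>g. g \<in> D \<Longrightarrow> a g \<in> \<A>" "\<And>g s. g \<in> D \<Longrightarrow> s \<in> S \<Longrightarrow> \<gamma> s g = a g s" by metis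
  have q_a: "q g = restrict (a g) S" if "g \<in> K" for g
    using a(2) K(2) that by (auto simp: q_def restrict_def fun_eq_iff)
  have "q ` K \<subseteq> (\<lambda>a. restrict a S) ` \<A>" using q_a a(1) K(2) by auto
  then have "countable (q ` K)" by (rule countable_subset[OF _ countable_image[OF countable]])
  then have count: "countable ((\<lambda>g. restrict (\<lambda>s. \<gamma> s g) S) ` K)" by (simp add: q_def[abs_def])
  have cont: "continuous_on K (\<gamma> s)" if "s \<in> S" for s by (rule characters_continuous[OF \<gamma>(1)[OF that]])
  have "\<exists>r :: nat \<Rightarrow> nat. strict_mono r \<and> (\<forall>s\<in>S. convergent (\<lambda>j. \<gamma> s (x (r j))))"
    by (rule compact_sequence_convergent[where f = \<gamma> and x = x, OF K(1) _ _ count]; fact cont x(1))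
  then obtain r :: "nat \<Rightarrow> nat" where r: "strict_mono r" "\<forall>s\<in>S. convergent (\<lambda>j. \<gamma> s (x (r j)))"
    by blast
  define b where "b j = a (x (r j))" for j
  have "range b \<subseteq> \<A>" using a(1) x(1) K(2) by (auto simp: b_def)
  moreover have "inj b"
  proof (rule injI)
    fix i j assume "b i = b j"
    then have "f (r i) = f (r j)" using x q_a by (simp add: b_def)
    then have "r i = r j" using f(1) by (auto dest: injD)
    then show "i = j" using r(1) by (simp add: strict_mono_eq)
  qed
  ultimately obtain s where s: "s \<in> S" "\<not> convergent (\<lambda>j. b j s)"
    using not_all_convergent[OF Y S_max] by blast
  moreover have "b j s = \<gamma> s (x (r j))" for j
    using a(2)[OF subsetD[OF K(2) x(1)] s(1)] by (simp add: b_def)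
  ultimately show False using r(2) by simp
qed

text \<open>Finitely many points \<open>K0\<close> of \<open>K\<close> represent all of \<open>K\<close>, and infinitely many \<open>\<gamma> s\<close> cannot stay apart on a finite set.\<close>

lemma character_small_on_compact:
  assumes K: "compact K" "K \<subseteq> D" and "e > 0"
  obtains \<psi> where "\<psi> \<in> characters" "\<psi> \<noteq> 0" "\<And>g. g \<in> K \<Longrightarrow> dist (\<psi> g) 0 < e"
proof -
  define q where "q g = restrict (\<lambda>s. \<gamma> s g) S" for g
  have "finite (q ` K)" using compact_image_finite[OF K] by (simp add: q_def[abs_def])
  then obtain K0 where K0: "K0 \<subseteq> K" "finite K0" "q ` K = q ` K0"
    using finite_subset_image[of "q ` K" q K] by blast
  have "infinite S" using uncountable_generators[OF Y S_max] uncountable_infinite by blast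
  then obtain \<sigma> :: "nat \<Rightarrow> circle" where \<sigma>: "inj \<sigma>" "range \<sigma> \<subseteq> S"
    using infinite_countable_subset by blast
  then have \<sigma>S: "\<sigma> j \<in> S" for j by blast
  obtain r where r: "strict_mono (r :: nat \<Rightarrow> nat)" "\<And>g. g \<in> K0 \<Longrightarrow> convergent (\<lambda>j. \<gamma> (\<sigma> (r j)) g)"
    using convergent_subsequence[OF countable_finite[OF K0(2)], of "\<lambda>j. \<gamma> (\<sigma> j)"] by blast
  have "\<forall>\<^sub>F j in sequentially. dist (\<gamma> (\<sigma> (r j)) g) (\<gamma> (\<sigma> (r (Suc j))) g) < e" if "g \<in> K0" for g
  proof -
    have "Cauchy (\<lambda>j. \<gamma> (\<sigma> (r j)) g)"
      using r(2)[OF that] by (auto simp: convergent_def intro: LIMSEQ_imp_Cauchy)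
    then obtain N where "\<And>i j. i \<ge> N \<Longrightarrow> j \<ge> N \<Longrightarrow> dist (\<gamma> (\<sigma> (r i)) g) (\<gamma> (\<sigma> (r j)) g) < e"
      using \<open>e > 0\<close> unfolding Cauchy_def by blast
    then show ?thesis by (intro eventually_sequentiallyI[of N]) auto
  qed
  then have "\<forall>\<^sub>F j in sequentially. \<forall>g\<in>K0. dist (\<gamma> (\<sigma> (r j)) g) (\<gamma> (\<sigma> (r (Suc j))) g) < e"
    using K0(2) by (simp add: eventually_ball_finite)
  then obtain j where j: "\<And>g. g \<in> K0 \<Longrightarrow> dist (\<gamma> (\<sigma> (r j)) g) (\<gamma> (\<sigma> (r (Suc j))) g) < e"
    using eventually_happens by force
  define s where "s = \<sigma> (r j)"
  define s' where "s' = \<sigma> (r (Suc j))"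
  have S: "s \<in> S" "s' \<in> S" by (simp_all add: s_def s'_def \<sigma>S)
  have "r j \<noteq> r (Suc j)" using r(1) by (simp add: strict_mono_eq)
  then have "s \<noteq> s'" unfolding s_def s'_def using \<sigma>(1) by (auto dest: injD)
  show ?thesis
  proof
    show "\<gamma> s - \<gamma> s' \<in> characters" by (intro add_subgroupD(4)[OF add_subgroup_characters] \<gamma>(1) S)
    show "\<gamma> s - \<gamma> s' \<noteq> 0" using inj_onD[OF \<gamma>_inj _ S] \<open>s \<noteq> s'\<close> by auto
    fix g assume "g \<in> K"
    then obtain g0 where g0: "g0 \<in> K0" "q g = q g0" using K0(3) by blast
    then have "\<gamma> t g = \<gamma> t g0" if "t \<in> S" for t using that by (metis q_def restrict_apply')
    then have "dist ((\<gamma> s - \<gamma> s') g) 0 = dist (\<gamma> s g0) (\<gamma> s' g0)"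
      using S by (simp add: dist_circle_def)
    then show "dist ((\<gamma> s - \<gamma> s') g) 0 < e" using j[OF g0(1)] by (simp add: s_def s'_def)
  qed
qed

end

section \<open>Compact groups of large weight are not determined\<close>

text \<open>Doubling a nonzero element within distance 1/4 of zero doubles its distance.\<close>

lemma no_small_circle_element:
  assumes "\<And>n :: nat. dist (zmul (2 ^ n) t) 0 < 1/4"
  shows "t = (0 :: circle)"
proof (rule ccontr)
  assume "t \<noteq> 0"
  then have pos: "dist t 0 > 0" by simp
  have double: "dist (zmul (2 ^ n) t) 0 = 2 ^ n * dist t 0" for n
  proof (induction n)
    case (Suc n)
    define u where "u = zmul (2 ^ n) t"
    have "\<bar>rep_circle u\<bar> < 1/4" using assms[of n] by (simp add: u_def dist_circle_def)
    then have "\<lceil>2 * rep_circle u - 1/2\<rceil> = 0" by linarith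
    then have "rep_circle (to_circle (2 * rep_circle u)) = 2 * rep_circle u" by (simp add: rep_to_circle)
    moreover have "zmul 2 u = to_circle (2 * rep_circle u)" using zmul_to_circle[of 2 "rep_circle u"] by simp
    ultimately have "dist (zmul 2 u) 0 = 2 * dist u 0" by (simp add: dist_circle_def abs_mult)
    then show ?case using Suc zmul_mult[of 2 "2 ^ n" t] by (simp add: u_def)
  qed simp
  obtain n where "1 / (4 * dist t 0) < 2 ^ n" using real_arch_pow[of 2 "1 / (4 * dist t 0)"] by auto
  then have "1/4 < 2 ^ n * dist t 0" using pos by (simp add: field_simps)
  then show False using assms[of n] double[of n] by simp
qed

lemma compact_open_nhd_zero:
  fixes D :: "'a::topological_ab_group_add set"
  assumes "openin (compact_open D) W" "restrict (\<lambda>_. 0) D \<in> W"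
  shows "\<exists>K e. compact K \<and> K \<subseteq> D \<and> e > 0 \<and> {h \<in> dual D. \<forall>g\<in>K. dist (h g) 0 < e} \<subseteq> W"
proof -
  define z :: "'a \<Rightarrow> circle" where "z = restrict (\<lambda>_. 0) D"
  have "generate_topology_on {{h \<in> dual D. h ` K \<subseteq> U} | K U. K \<subseteq> D \<and> compact K \<and> open U} W"
    using assms(1) unfolding compact_open_def by (rule openin_topology_generated_by)
  then have "z \<in> W \<longrightarrow> (\<exists>K e. compact K \<and> K \<subseteq> D \<and> e > 0 \<and> {h \<in> dual D. \<forall>g\<in>K. dist (h g) 0 < e} \<subseteq> W)"
  proof induction
    case Empty
    then show ?case by simp
  next
    case (Int V W)
    show ?case
    proof
      assume "z \<in> V \<inter> W"
      then obtain K e L d where "compact K" "K \<subseteq> D" "e > 0" "{h \<in> dual D. \<forall>g\<in>K. dist (h g) 0 < e} \<subseteq> V"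
        "compact L" "L \<subseteq> D" "d > 0" "{h \<in> dual D. \<forall>g\<in>L. dist (h g) 0 < d} \<subseteq> W"
        using Int.IH by blast
      then show "\<exists>K e. compact K \<and> K \<subseteq> D \<and> e > 0 \<and> {h \<in> dual D. \<forall>g\<in>K. dist (h g) 0 < e} \<subseteq> V \<inter> W"
        by (intro exI[of _ "K \<union> L"] exI[of _ "min e d"]) (auto simp: compact_Un)
    qed
  next
    case (UN \<U>)
    show ?case
    proof
      assume "z \<in> \<Union>\<U>"
      then obtain V where V: "V \<in> \<U>" "z \<in> V" by blast
      then obtain K e where "compact K" "K \<subseteq> D" "e > 0" "{h \<in> dual D. \<forall>g\<in>K. dist (h g) 0 < e} \<subseteq> V"
        using UN.IH[OF V(1)] by blast
      then show "\<exists>K e. compact K \<and> K \<subseteq> D \<and> e > 0 \<and> {h \<in> dual D. \<forall>g\<in>K. dist (h g) 0 < e} \<subseteq> \<Union>\<U>"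
        using V(1) by (intro exI[of _ K] exI[of _ e]) blast
    qed
  next
    case (Basis V)
    then obtain K U where K: "V = {h \<in> dual D. h ` K \<subseteq> U}" "K \<subseteq> D" "compact K" "open U" by blast
    show ?case
    proof
      assume zV: "z \<in> V"
      show "\<exists>K e. compact K \<and> K \<subseteq> D \<and> e > 0 \<and> {h \<in> dual D. \<forall>g\<in>K. dist (h g) 0 < e} \<subseteq> V"
      proof (cases "K = {}")
        case True
        then show ?thesis using K by (intro exI[of _ "{}"] exI[of _ 1]) auto
      next
        case False
        then obtain g where "g \<in> K" by blast
        then have "z g \<in> U" "z g = 0" using zV K(1,2) by (auto simp: z_def)
        then have "0 \<in> U" by simp
        then obtain e where e: "e > 0" "\<And>t. dist t 0 < e \<Longrightarrow> t \<in> U"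
          using K(4) unfolding open_dist by blast
        then have "{h \<in> dual D. \<forall>g\<in>K. dist (h g) 0 < e} \<subseteq> V" unfolding K(1) by blast
        then show ?thesis using K(2,3) e(1) by blast
      qed
    qed
  qed
  then show ?thesis using assms(2) unfolding z_def by blast
qed

lemma zero_open_in_dual_of_compact:
  assumes "compact (UNIV :: 'a::topological_ab_group_add set)"
  shows "openin (compact_open UNIV) {\<lambda>_ :: 'a. 0 :: circle}"
proof -
  have "{h \<in> dual (UNIV :: 'a set). h ` UNIV \<subseteq> ball 0 (1/4)} = {\<lambda>_. 0}"
  proof
    show "{h \<in> dual (UNIV :: 'a set). h ` UNIV \<subseteq> ball 0 (1/4)} \<subseteq> {\<lambda>_. 0}"
    proof
      fix h assume h: "h \<in> {h \<in> dual (UNIV :: 'a set). h ` UNIV \<subseteq> ball 0 (1/4)}"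
      then have add: "additive_on UNIV h" by (auto simp: dual_def additive_on_def)
      have "h x = 0" for x
      proof (rule no_small_circle_element)
        fix n :: nat
        have "h (zmul (2 ^ n) x) \<in> ball 0 (1/4)" using h by blast
        then show "dist (zmul (2 ^ n) (h x)) 0 < 1/4"
          by (simp add: additive_on_zmul[OF add] dist_commute)
      qed
      then show "h \<in> {\<lambda>_. 0}" by auto
    qed
  qed (auto simp: dual_def)
  moreover have "openin (compact_open UNIV) {h \<in> dual (UNIV :: 'a set). h ` UNIV \<subseteq> ball 0 (1/4)}"
    unfolding compact_open_def using assms by (intro topology_generated_by_Basis) blast
  ultimately show ?thesis by simp
qed

text \<open>The restriction map takes the isolated zero character of the compact group to an isolated point.\<close>

lemma determines_compact_set:
  fixes D :: "'a::topological_ab_group_add set"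
  assumes compact: "compact (UNIV :: 'a set)" and D: "add_subgroup D" and det: "determines D"
  obtains K e where "compact K" "K \<subseteq> D" "e > 0"
    "\<And>\<psi>. \<psi> \<in> characters \<Longrightarrow> (\<And>g. g \<in> K \<Longrightarrow> dist (\<psi> g) 0 < e) \<Longrightarrow> (\<forall>d\<in>D. \<psi> d = 0)"
proof -
  have "openin (compact_open D) ((\<lambda>h. restrict h D) ` {\<lambda>_. 0})"
    using homeomorphic_imp_open_map[OF det[unfolded determines_def]] zero_open_in_dual_of_compact[OF compact]
    unfolding open_map_def by blast
  then have "openin (compact_open D) {restrict (\<lambda>_. 0) D}" by (simp only: image_insert image_empty)
  from compact_open_nhd_zero[OF this] obtain K e where K: "compact K" "K \<subseteq> D" "e > 0"
    "{h \<in> dual D. \<forall>g\<in>K. dist (h g) 0 < e} \<subseteq> {restrict (\<lambda>_. 0) D}"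
    by blast
  show ?thesis
  proof (rule that[OF K(1-3)])
    fix \<psi> :: "'a \<Rightarrow> circle" assume \<psi>: "\<psi> \<in> characters" "\<And>g. g \<in> K \<Longrightarrow> dist (\<psi> g) 0 < e"
    have "continuous_on D (restrict \<psi> D)"
      using continuous_on_cong[of D D \<psi> "restrict \<psi> D"] characters_continuous[OF \<psi>(1), of D] by simp
    moreover have "restrict \<psi> D (x + y) = restrict \<psi> D x + restrict \<psi> D y" if "x \<in> D" "y \<in> D" for x y
      using that add_subgroupD(2)[OF D that] additive_onD[OF characters_additive[OF \<psi>(1)]] by simp
    ultimately have "restrict \<psi> D \<in> dual D" by (simp add: dual_def)
    moreover have "\<forall>g\<in>K. dist (restrict \<psi> D g) 0 < e" using \<psi>(2) K(2) by auto
    ultimately have "restrict \<psi> D = restrict (\<lambda>_. 0) D" using K(4) by blast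
    then show "\<forall>d\<in>D. \<psi> d = 0" by (metis restrict_apply')
  qed
qed

theorem theorem6p6:
  assumes "compact (UNIV :: 'a::topological_ab_group_add set)"
    and "non_N \<le>o weight TYPE('a)"
  shows "\<not> determined TYPE('a)"
proof
  assume det: "determined TYPE('a)"
  obtain Y where Y: "non_N = |Y|" "\<not> haar_null Y" "|UNIV :: nat set| <o |Y|"
    "\<And>A :: nat \<Rightarrow> circle set. Y \<subseteq> (\<Union>n. A n) \<Longrightarrow> \<exists>n. |Y| \<le>o |A n|"
    using non_N_witness by metis
  have "|Y| \<le>o |characters :: ('a \<Rightarrow> circle) set|"
    using assms(2) unfolding Y(1) by (rule card_characters_ge[OF assms(1) Y(3)])
  then obtain m and I :: "('a \<Rightarrow> circle) set" where m: "m = 0 \<or> prime m" and I: "I \<subseteq> characters"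
    "indep m (\<lambda>x. x) I" "\<And>x. x \<in> I \<Longrightarrow> zmul m x = 0" "|Y| \<le>o |I|"
    using large_indep[OF add_subgroup_characters _ Y(3,4)] by metis
  obtain \<A> where \<A>: "circle_functions m \<A>" using circle_functions_exists[OF m] by blast
  interpret circle_functions m \<A> by (rule \<A>)
  have "\<not> m dvd 1" using m by (auto dest: not_prime_unit)
  moreover have "zmul m (ev \<A> y) = 0" for y
  proof
    fix a show "zmul m (ev \<A> y) a = 0 a"
      using torsion[of a] by (simp add: zmul_fun_apply ev_def) (metis zero_fun_apply zmul_fun_apply)
  qed
  ultimately obtain S where S: "S \<subseteq> Y" "indep m (ev \<A>) S"
    "\<And>y. y \<in> Y \<Longrightarrow> \<exists>k. \<not> m dvd k \<and> zmul k (ev \<A> y) \<in> gen (ev \<A> ` S)"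
    using maximal_indep[of m Y "ev \<A>"] by metis
  have "|S| \<le>o |I|" using card_of_mono1[OF S(1)] I(4) by (rule ordLeq_transitive)
  then obtain \<gamma> where \<gamma>: "inj_on \<gamma> S" "\<gamma> ` S \<subseteq> I" using card_of_ordLeq[of S I] by blast
  interpret dense_construction m \<A> Y S \<gamma>
  proof
    show "indep m \<gamma> S"
      unfolding indep_def
    proof (intro allI impI ballI)
      fix F n s assume F: "finite F" "F \<subseteq> S" "(\<Sum>s\<in>F. zmul (n s) (\<gamma> s)) = 0" "s \<in> F"
      have inj: "inj_on \<gamma> F" using \<gamma>(1) F(2) by (rule inj_on_subset)
      have "(\<Sum>x\<in>\<gamma> ` F. zmul (n (the_inv_into F \<gamma> x)) x) = 0"
        using F(3) by (simp add: sum.reindex[OF inj] the_inv_into_f_f[OF inj])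
      then have "m dvd n (the_inv_into F \<gamma> (\<gamma> s))"
        using F \<gamma>(2) by (intro indepD[OF I(2), of "\<gamma> ` F" "\<lambda>x. n (the_inv_into F \<gamma> x)"]) auto
      then show "m dvd n s" by (simp add: the_inv_into_f_f[OF inj F(4)])
    qed
  qed (use assms(1) Y(2) S \<gamma> I in auto)
  have "determines D"
    using det subgroup_D dense_D unfolding determined_def by blast
  then obtain K e where K: "compact K" "K \<subseteq> D" "e > 0"
    "\<And>\<psi>. \<psi> \<in> characters \<Longrightarrow> (\<And>g. g \<in> K \<Longrightarrow> dist (\<psi> g) 0 < e) \<Longrightarrow> (\<forall>d\<in>D. \<psi> d = 0)"
    using determines_compact_set[OF assms(1) subgroup_D] by metis
  obtain \<psi> where \<psi>: "\<psi> \<in> characters" "\<psi> \<noteq> 0" "\<And>g. g \<in> K \<Longrightarrow> dist (\<psi> g) 0 < e"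
    using character_small_on_compact[OF K(1-3)] by blast
  then have "\<forall>d\<in>D. \<psi> d = 0" using K(4) by blast
  then show False using separates[OF \<psi>(1)] \<psi>(2) by blast
qed

end
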